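(* Suppose $K$ satisfies (K1) and (K2). Let $\{\varepsilon_n\}_{n\in\mathbb N}\subset(0,1)$ with $\varepsilon_n\to0$. For each $n$ let $u^{(n)}$ be a ground state for the Hamiltonian $H^{(\varepsilon_n)}$ and let $\bar u^{(n)}:=\bar u^{(n)}_{\varepsilon_n}$ be its extension to $\mathbb R^d$. Then there exist a diverging sequence $\{n_k\}_{k\in\mathbb N}$ of natural numbers and a class A minimal surface $E\subseteq\mathbb R^d$ for $\mathrm{Per}_K$ such that $\bar u^{(n_k)}\to\chi_E-\chi_{\mathbb R^d\setminus E}$ a.e. in $\mathbb R^d$ as $k\to+\infty$.
   Context: $d\ge2$; $|\cdot|$ is the $\ell^1$ norm on $\mathbb R^d$, $|x|_\infty=\max_n|x_n|$. For $x\in\mathbb R^d$, $r>0$, $Q_r(x):=\{y\in\mathbb R^d:|y-x|_\infty\le r\}$ (closed cube), $\mathring Q_r(x)$ its interior. $K:\mathbb R^d\times\mathbb R^d\to[0,+\infty]$ is measurable and satisfies (K1) $K(x,y)=K(y,x)$ for a.e. $x,y$; (K2) $\lambda|x-y|^{-d-s}\le K(x,y)\le\Lambda|x-y|^{-d-s}$ for a.e. $x,y$, for some $s\in(0,1)$, $\Lambda\ge\lambda>0$. For measurable $A,B\subseteq\mathbb R^d$, $L_K(A,B):=\int_A\int_BK(x,y)\,dx\,dy$. For open $\Omega$ and measurable $E$, $\mathrm{Per}_K(E;\Omega):=L_K(E\cap\Omega,\Omega\setminus E)+L_K(E\cap\Omega,\mathbb R^d\setminus(E\cup\Omega))+L_K(E\setminus\Omega,\Omega\setminus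 E)$. $E$ is a minimizer for $\mathrm{Per}_K$ in $\Omega$ if $\mathrm{Per}_K(E;\Omega)<\infty$ and $\mathrm{Per}_K(E;\Omega)\le\mathrm{Per}_K(F;\Omega)$ for every measurable $F$ with $F\setminus\Omega=E\setminus\Omega$; $E$ is a class A minimal surface if it is a minimizer in every bounded open $\Omega\subset\mathbb R^d$. For $\varepsilon>0$ and $i,j\in\mathbb Z^d$: $J^{(\varepsilon)}_{ij}:=\varepsilon^{-d+s}\int_{Q_{\varepsilon/2}(\varepsilon i)}\int_{Q_{\varepsilon/2}(\varepsilon j)}K(x,y)\,dx\,dy$ if $i\ne j$, and $J^{(\varepsilon)}_{ii}:=0$. A configuration is $u:\mathbb Z^d\to\{-1,1\}$. For finite $\Gamma\subset\mathbb Z^d$, $H^{(\varepsilon)}_\Gamma(u):=\sum_{(i,j)\in\mathbb Z^{2d}\setminus(\mathbb Z^d\setminus\Gamma)^2}J^{(\varepsilon)}_{ij}(1-u_iu_j)$. $u$ is a minimizer for $H^{(\varepsilon)}$ in $\Gamma$ if $H^{(\varepsilon)}_\Gamma(u)\le H^{(\varepsilon)}_\Gamma(v)$ for all configurations $v$ agreeing with $u$ outside $\Gamma$; a ground state if it is a minimizer in every finite $\Gamma$. The extension of a configuration $u$ is $\bar u_\varepsilon:\mathbb R^d\to\{-1,1\}$, defined a.e. by $\bar u_\varepsilon(x):=u_i$ where $i$ is the unique site with $x\in\mathring Q_{\varepsilon/2}(\varepsilon i)$. *)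

theory Defs
  imports "HOL-Analysis.Analysis"
begin

type_synonym 'n pt = "real ^ 'n"
type_synonym 'n site = "int ^ 'n"

definition l1norm :: "real ^ 'n \<Rightarrow> real" where
  "l1norm x = (\<Sum>k\<in>UNIV. \<bar>x $ k\<bar>)"

definition cubeQ :: "real \<Rightarrow> real ^ 'n \<Rightarrow> (real ^ 'n) set" where
  "cubeQ r x = {y. \<forall>k. \<bar>y $ k - x $ k\<bar> \<le> r}"

definition cubeQ_open :: "real \<Rightarrow> real ^ 'n \<Rightarrow> (real ^ 'n) set" where
  "cubeQ_open r x = {y. \<forall>k. \<bar>y $ k - x $ k\<bar> < r}"

definition kernel_K1K2 ::
  "(real ^ 'n \<Rightarrow> real ^ 'n \<Rightarrow> ennreal) \<Rightarrow> real \<Rightarrow> real \<Rightarrow> real \<Rightarrow> bool" where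
  "kernel_K1K2 K s lam Lam \<longleftrightarrow>
     (\<lambda>p. K (fst p) (snd p)) \<in> borel_measurable (lebesgue :: ((real ^ 'n) \<times> (real ^ 'n)) measure) \<and>
     0 < s \<and> s < 1 \<and> 0 < lam \<and> lam \<le> Lam \<and>
     (AE p in (lebesgue :: ((real ^ 'n) \<times> (real ^ 'n)) measure). K (fst p) (snd p) = K (snd p) (fst p)) \<and>
     (AE p in (lebesgue :: ((real ^ 'n) \<times> (real ^ 'n)) measure).
        ennreal (lam * l1norm (fst p - snd p) powr (- (real CARD('n) + s))) \<le> K (fst p) (snd p) \<and>
        K (fst p) (snd p) \<le> ennreal (Lam * l1norm (fst p - snd p) powr (- (real CARD('n) + s))))"

definition LK :: "(real ^ 'n \<Rightarrow> real ^ 'n \<Rightarrow> ennreal) \<Rightarrow> (real ^ 'n) set \<Rightarrow> (real ^ 'n) set \<Rightarrow> ennreal" where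
  "LK K A B = (\<integral>\<^sup>+ p. indicator (A \<times> B) p * K (fst p) (snd p)
                  \<partial>(lebesgue :: ((real ^ 'n) \<times> (real ^ 'n)) measure))"

definition PerK :: "(real ^ 'n \<Rightarrow> real ^ 'n \<Rightarrow> ennreal) \<Rightarrow> (real ^ 'n) set \<Rightarrow> (real ^ 'n) set \<Rightarrow> ennreal" where
  "PerK K E \<Omega> = LK K (E \<inter> \<Omega>) (\<Omega> - E) + LK K (E \<inter> \<Omega>) (UNIV - (E \<union> \<Omega>)) + LK K (E - \<Omega>) (\<Omega> - E)"

definition PerK_minimizer :: "(real ^ 'n \<Rightarrow> real ^ 'n \<Rightarrow> ennreal) \<Rightarrow> (real ^ 'n) set \<Rightarrow> (real ^ 'n) set \<Rightarrow> bool" where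
  "PerK_minimizer K E \<Omega> \<longleftrightarrow> PerK K E \<Omega> < \<infinity> \<and>
     (\<forall>F \<in> sets lebesgue. F - \<Omega> = E - \<Omega> \<longrightarrow> PerK K E \<Omega> \<le> PerK K F \<Omega>)"

definition classA_minimal :: "(real ^ 'n \<Rightarrow> real ^ 'n \<Rightarrow> ennreal) \<Rightarrow> (real ^ 'n) set \<Rightarrow> bool" where
  "classA_minimal K E \<longleftrightarrow> E \<in> sets lebesgue \<and>
     (\<forall>\<Omega>. open \<Omega> \<and> bounded \<Omega> \<longrightarrow> PerK_minimizer K E \<Omega>)"

definition site_pt :: "real \<Rightarrow> int ^ 'n \<Rightarrow> real ^ 'n" where
  "site_pt eps i = (\<chi> k. eps * real_of_int (i $ k))"

definition Jcoup :: "(real ^ 'n \<Rightarrow> real ^ 'n \<Rightarrow> ennreal) \<Rightarrow> real \<Rightarrow> real \<Rightarrow> int ^ 'n \<Rightarrow> int ^ 'n \<Rightarrow> ennreal" where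
  "Jcoup K s eps i j = (if i = j then 0 else
     ennreal (eps powr (- real CARD('n) + s)) *
     LK K (cubeQ (eps / 2) (site_pt eps i)) (cubeQ (eps / 2) (site_pt eps j)))"

definition config :: "(int ^ 'n \<Rightarrow> int) \<Rightarrow> bool" where
  "config u \<longleftrightarrow> (\<forall>i. u i = -1 \<or> u i = 1)"

definition Ham :: "(real ^ 'n \<Rightarrow> real ^ 'n \<Rightarrow> ennreal) \<Rightarrow> real \<Rightarrow> real \<Rightarrow> (int ^ 'n) set \<Rightarrow> (int ^ 'n \<Rightarrow> int) \<Rightarrow> ennreal" where
  "Ham K s eps \<Gamma> u = (\<Sum>\<^sub>\<infinity> p \<in> UNIV - (UNIV - \<Gamma>) \<times> (UNIV - \<Gamma>).
      Jcoup K s eps (fst p) (snd p) * ennreal (real_of_int (1 - u (fst p) * u (snd p))))"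

definition Ham_minimizer :: "(real ^ 'n \<Rightarrow> real ^ 'n \<Rightarrow> ennreal) \<Rightarrow> real \<Rightarrow> real \<Rightarrow> (int ^ 'n) set \<Rightarrow> (int ^ 'n \<Rightarrow> int) \<Rightarrow> bool" where
  "Ham_minimizer K s eps \<Gamma> u \<longleftrightarrow>
     (\<forall>v. config v \<and> (\<forall>i. i \<notin> \<Gamma> \<longrightarrow> v i = u i) \<longrightarrow> Ham K s eps \<Gamma> u \<le> Ham K s eps \<Gamma> v)"

definition ground_state :: "(real ^ 'n \<Rightarrow> real ^ 'n \<Rightarrow> ennreal) \<Rightarrow> real \<Rightarrow> real \<Rightarrow> (int ^ 'n \<Rightarrow> int) \<Rightarrow> bool" where
  "ground_state K s eps u \<longleftrightarrow> config u \<and> (\<forall>\<Gamma>. finite \<Gamma> \<longrightarrow> Ham_minimizer K s eps \<Gamma> u)"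

text \<open>extension to R^d; on the null set of cube boundaries we put the value 1 (irrelevant)\<close>
definition ext_config :: "real \<Rightarrow> (int ^ 'n \<Rightarrow> int) \<Rightarrow> real ^ 'n \<Rightarrow> int" where
  "ext_config eps u x = (if \<exists>!i. x \<in> cubeQ_open (eps / 2) (site_pt eps i)
      then u (THE i. x \<in> cubeQ_open (eps / 2) (site_pt eps i)) else 1)"

end

theory Submission
  imports Defs "HOL-Complex_Analysis.Great_Picard"
begin

text \<open>
  Write P(E; \<Omega>) for the interaction of pairs separated by E with at least one point in \<Omega>. Up to
  a constant factor the Hamiltonian of a configuration u on a finite set of sites is P of the union
  of the cells where u = 1, so ground states minimize P among unions of lattice cells. Since s < 1, a
  cube has finite interaction with its complement; erasing the phase inside a cube therefore bounds
  the energy of all ground states locally and uniformly. A fractional Poincare inequality on dyadic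
  cells turns this bound into compactness, and Fatou's lemma gives lower semicontinuity.

  A competitor F is discretized by the majority rule on each cell. The discretization is close to F
  in measure by the Poincare inequality, and for every pair of cells that it separates the full
  interaction of the two cells is at most a constant times the part of it that F already separates.
  Hence its energy at short range is controlled by the short-range energy of F, which vanishes with
  the range, while at distances bounded away from zero the kernel is bounded and closeness in measure
  suffices.
\<close>

text \<open>(K2) only compares K with |x-y|^(-d-s), and K need not be translation invariant, so a
  competitor cannot be smoothed by averaging its translates. The majority rule avoids this: it
  compares interactions cell pair by cell pair, where two-sided bounds suffice. For touching cells
  the kernel is unbounded, but their interaction is at most that of a cell with its complement, of
  order e^(d-s). This is also the order e^(2d) e^(-d-s) of the interaction of two half-full cells at
  distance of order e. A discretized competitor is prescribed only in a block of cells; outside it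
  follows the ground state. Pairs across the boundary of the block are therefore split by distance:
  very short and very long ones are absorbed by the finite interaction of the block with its
  complement, the others see a bounded kernel on a bounded region. Blocks also overshoot the given
  cube; the excess is removed at the end by continuity from above. Interactions are encoded as
  measures of sets of pairs, so that sums over sites, Fatou's lemma and limits in the range become
  statements about measures.\<close>

subsection \<open>Lebesgue measure on a product\<close>

text \<open>A null set times the whole space is null because 0 * top = 0 in \<open>ennreal\<close>.
  \<open>lebesgue\<close> on pairs is the completion of \<open>lborel\<close>, not the product of
  two completions, so facts about the factors are transported through Borel null sets, here and
  below.\<close>

lemma AE_lebesgue_fst:
  fixes P :: "'a::euclidean_space \<Rightarrow> bool"
  assumes "AE x in lebesgue. P x"
  shows "AE p in (lebesgue :: ('a \<times> 'b::euclidean_space) measure). P (fst p)"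
proof -
  obtain N where N: "N \<in> null_sets lborel" "{x. \<not> P x} \<subseteq> N"
    using assms unfolding AE_completion_iff by (auto simp: eventually_ae_filter)
  have "N \<times> (UNIV :: 'b set) \<in> null_sets (lborel \<Otimes>\<^sub>M lborel)"
    using N(1) by (auto simp: null_sets_def lborel.emeasure_pair_measure_Times)
  then have "N \<times> (UNIV :: 'b set) \<in> null_sets lborel"
    by (simp add: lborel_prod)
  then have "AE p in (lborel :: ('a \<times> 'b) measure). P (fst p)"
    by (rule AE_I') (use N in auto)
  then show ?thesis by (simp add: AE_completion_iff)
qed

lemma borel_measurable_fst: "fst \<in> borel_measurable (borel :: ('a::euclidean_space \<times> 'b::euclidean_space) measure)"
  and borel_measurable_swap: "prod.swap \<in> borel_measurable (borel :: ('a::euclidean_space \<times> 'b::euclidean_space) measure)"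
  by (auto intro!: borel_measurable_continuous_onI continuous_on_swap continuous_on_fst continuous_on_id)

lemma lborel_distr_swap:
  "distr lborel borel prod.swap = (lborel :: ('a::euclidean_space \<times> 'b::euclidean_space) measure)"
proof -
  have "prod.swap = (\<lambda>(x :: 'b, y :: 'a). (y, x))" by auto
  then show ?thesis
    using lborel_pair.distr_pair_swap[where 'a='a and 'b='b]
    unfolding lborel_prod by (metis (no_types) distr_cong sets_lborel)
qed

lemma AE_lebesgue_swap:
  fixes P :: "'a::euclidean_space \<times> 'b::euclidean_space \<Rightarrow> bool"
  assumes "AE p in lebesgue. P p"
  shows "AE p in lebesgue. P (prod.swap p)"
proof -
  obtain N where N: "N \<in> null_sets lborel" "{x. \<not> P x} \<subseteq> N"
    using assms unfolding AE_completion_iff by (auto simp: eventually_ae_filter)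
  have "AE p in (distr lborel borel prod.swap :: ('a \<times> 'b) measure). p \<notin> N"
    unfolding lborel_distr_swap using N AE_not_in by blast
  then have "AE p in (lborel :: ('b \<times> 'a) measure). prod.swap p \<notin> N"
    using N(1) by (subst (asm) AE_distr_iff) (auto simp: null_sets_def borel_measurable_swap)
  then have "AE p in (lborel :: ('b \<times> 'a) measure). P (prod.swap p)"
    using N(2) by (auto elim!: eventually_mono)
  then show ?thesis by (simp add: AE_completion_iff)
qed

lemma AE_lebesgue_snd:
  fixes P :: "'b::euclidean_space \<Rightarrow> bool"
  assumes "AE x in lebesgue. P x"
  shows "AE p in (lebesgue :: ('a::euclidean_space \<times> 'b) measure). P (snd p)"
  using AE_lebesgue_swap[OF AE_lebesgue_fst[OF assms, where 'b='a]] by simp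

text \<open>Since the target is completed too, measurability requires preimages of null sets to be
  null, which is \<open>AE_lebesgue_fst\<close>.\<close>

lemma lebesgue_measurable_fst:
  "fst \<in> (lebesgue :: ('a::euclidean_space \<times> 'b::euclidean_space) measure) \<rightarrow>\<^sub>M lebesgue"
proof (rule completion.measurable_completion2)
  show m: "fst \<in> (lebesgue :: ('a \<times> 'b) measure) \<rightarrow>\<^sub>M lborel"
    by (rule measurable_completion) (simp add: borel_measurable_fst)
  show "null_sets lborel \<subseteq> null_sets (distr lebesgue lborel (fst :: 'a \<times> 'b \<Rightarrow> 'a))"
  proof
    fix N :: "'a set" assume N: "N \<in> null_sets lborel"
    have "AE x in lebesgue. x \<notin> N"
      using AE_not_in[OF N] by (simp add: AE_completion_iff)
    from AE_lebesgue_fst[OF this, where 'b='b]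
    have "{p. fst p \<in> N} \<in> null_sets (lebesgue :: ('a \<times> 'b) measure)"
      by (simp add: completion.AE_iff_null_sets)
    then show "N \<in> null_sets (distr lebesgue lborel (fst :: 'a \<times> 'b \<Rightarrow> 'a))"
      using N m by (subst null_sets_distr_iff) (auto simp: vimage_def)
  qed
qed

lemma lebesgue_measurable_swap:
  "prod.swap \<in> (lebesgue :: ('a::euclidean_space \<times> 'b::euclidean_space) measure) \<rightarrow>\<^sub>M lebesgue"
proof (rule completion.measurable_completion2)
  have m: "prod.swap \<in> (lborel :: ('a \<times> 'b) measure) \<rightarrow>\<^sub>M lborel"
    by (simp add: borel_measurable_swap)
  then show m': "prod.swap \<in> (lebesgue :: ('a \<times> 'b) measure) \<rightarrow>\<^sub>M lborel"
    by (simp add: measurable_completion)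
  show "null_sets lborel \<subseteq> null_sets (distr lebesgue lborel (prod.swap :: 'a \<times> 'b \<Rightarrow> _))"
  proof
    fix N :: "('b \<times> 'a) set" assume N: "N \<in> null_sets lborel"
    have "AE x in lebesgue. x \<notin> N"
      using AE_not_in[OF N] by (simp add: AE_completion_iff)
    from AE_lebesgue_swap[OF this]
    have "{p. prod.swap p \<in> N} \<in> null_sets (lebesgue :: ('a \<times> 'b) measure)"
      by (simp add: completion.AE_iff_null_sets)
    then show "N \<in> null_sets (distr lebesgue lborel (prod.swap :: 'a \<times> 'b \<Rightarrow> _))"
      using N m' by (subst null_sets_distr_iff) (auto simp: vimage_def)
  qed
qed

lemma lebesgue_measurable_snd:
  "snd \<in> (lebesgue :: ('a::euclidean_space \<times> 'b::euclidean_space) measure) \<rightarrow>\<^sub>M lebesgue"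
proof -
  have "snd = (fst \<circ> prod.swap :: 'a \<times> 'b \<Rightarrow> 'b)" by (simp add: fun_eq_iff)
  then show ?thesis
    using measurable_comp[OF lebesgue_measurable_swap lebesgue_measurable_fst] by metis
qed

lemma lebesgue_vimage_fst:
  "A \<in> sets lebesgue \<Longrightarrow> {p. fst p \<in> A} \<in> sets (lebesgue :: ('a::euclidean_space \<times> 'b::euclidean_space) measure)"
  using measurable_sets[OF lebesgue_measurable_fst] by (force simp: vimage_def)

lemma lebesgue_vimage_snd:
  "A \<in> sets lebesgue \<Longrightarrow> {p. snd p \<in> A} \<in> sets (lebesgue :: ('a::euclidean_space \<times> 'b::euclidean_space) measure)"
  using measurable_sets[OF lebesgue_measurable_snd] by (force simp: vimage_def)

lemma lebesgue_sets_Times: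
  assumes "A \<in> sets lebesgue" "B \<in> sets lebesgue"
  shows "A \<times> B \<in> sets (lebesgue :: ('a::euclidean_space \<times> 'b::euclidean_space) measure)"
proof -
  have "A \<times> B = {p. fst p \<in> A} \<inter> {p. snd p \<in> B}" by auto
  then show ?thesis
    using lebesgue_vimage_fst[OF assms(1)] lebesgue_vimage_snd[OF assms(2)] by auto
qed

lemma emeasure_lebesgue_Times:
  fixes A :: "'a::euclidean_space set" and B :: "'b::euclidean_space set"
  assumes A: "A \<in> sets lebesgue" and B: "B \<in> sets lebesgue"
  shows "emeasure lebesgue (A \<times> B) = emeasure lebesgue A * emeasure lebesgue B"
proof -
  \<comment> \<open>Each factor is replaced by a Borel set equal to it almost everywhere; the
    product formula is then that of \<open>lborel\<close>.\<close>
  have ex: "\<exists>S\<in>sets lborel. AE x in lebesgue. x \<in> A \<longleftrightarrow> x \<in> S" if A: "A \<in> sets lebesgue" for A :: "'c::euclidean_space set"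
  proof -
    obtain S N N' where S: "A = S \<union> N" "S \<in> sets lborel" "N \<subseteq> N'" "N' \<in> null_sets lborel"
      using sets_completionE[OF A] by metis
    have "AE x in lborel. x \<in> A \<longleftrightarrow> x \<in> S"
      using AE_not_in[OF S(4)] by eventually_elim (use S in auto)
    with S(2) show ?thesis by (auto simp: AE_completion_iff)
  qed
  obtain S where S: "S \<in> sets lborel" "AE x in lebesgue. x \<in> A \<longleftrightarrow> x \<in> S" using ex[OF A] by auto
  obtain T where T: "T \<in> sets lborel" "AE x in lebesgue. x \<in> B \<longleftrightarrow> x \<in> T" using ex[OF B] by auto
  have ST: "S \<times> T \<in> sets lborel"
    using S(1) T(1) by (simp add: borel_Times)
  have "emeasure lebesgue (A \<times> B) = emeasure lebesgue (S \<times> T)"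
  proof (rule emeasure_eq_AE)
    show "AE p in lebesgue. p \<in> A \<times> B \<longleftrightarrow> p \<in> S \<times> T"
      using AE_lebesgue_fst[OF S(2), where 'b='b] AE_lebesgue_snd[OF T(2), where 'a='a]
      by eventually_elim auto
    show "A \<times> B \<in> sets lebesgue" by (rule lebesgue_sets_Times[OF A B])
    show "S \<times> T \<in> sets lebesgue" using ST by blast
  qed
  also have "\<dots> = emeasure (lborel \<Otimes>\<^sub>M lborel) (S \<times> T)"
    using ST by (simp add: lborel_prod)
  also have "\<dots> = emeasure lebesgue S * emeasure lebesgue T"
    using S(1) T(1) by (simp add: lborel.emeasure_pair_measure_Times)
  also have "emeasure lebesgue S = emeasure lebesgue A"
    by (rule emeasure_eq_AE) (use S A in auto)
  also have "emeasure lebesgue T = emeasure lebesgue B"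
    by (rule emeasure_eq_AE) (use T B in auto)
  finally show ?thesis .
qed

lemma nn_integral_lebesgue_swap:
  fixes f :: "'a::euclidean_space \<times> 'b::euclidean_space \<Rightarrow> ennreal"
  assumes "f \<in> borel_measurable lebesgue"
  shows "(\<integral>\<^sup>+ p. f (prod.swap p) \<partial>lebesgue) = (\<integral>\<^sup>+ p. f p \<partial>lebesgue)"
proof -
  obtain g where g: "g \<in> borel_measurable lborel" "AE p in lborel. f p = g p"
    using completion_ex_borel_measurable[OF assms] by auto
  then have AE: "AE p in lebesgue. f p = g p" by (simp add: AE_completion_iff)
  have "(\<integral>\<^sup>+ p. f (prod.swap p) \<partial>lebesgue) = (\<integral>\<^sup>+ p. g (prod.swap p) \<partial>lebesgue)"
    using AE_lebesgue_swap[OF AE] by (rule nn_integral_cong_AE)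
  also have "\<dots> = (\<integral>\<^sup>+ p. g (prod.swap p) \<partial>lborel)" by (rule nn_integral_completion)
  also have "\<dots> = (\<integral>\<^sup>+ p. g p \<partial>distr lborel borel prod.swap)"
    using g(1) by (subst nn_integral_distr) (auto simp: borel_measurable_swap)
  also have "\<dots> = (\<integral>\<^sup>+ p. f p \<partial>lebesgue)"
    unfolding lborel_distr_swap nn_integral_completion using g(2) by (intro nn_integral_cong_AE) auto
  finally show ?thesis .
qed

subsection \<open>The l1 norm and lattice cells\<close>

lemma l1norm_nonneg [simp]: "0 \<le> l1norm x"
  by (simp add: l1norm_def sum_nonneg)

lemma l1norm_triangle: "l1norm (x + y) \<le> l1norm x + l1norm y"
  unfolding l1norm_def sum.distrib[symmetric] by (intro sum_mono) auto

lemma l1norm_minus_commute: "l1norm (x - y) = l1norm (y - x)"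
  by (simp add: l1norm_def abs_minus_commute)

lemma l1norm_scaleR: "l1norm (c *\<^sub>R x) = \<bar>c\<bar> * l1norm x"
  by (simp add: l1norm_def abs_mult sum_distrib_left)

lemma l1norm_eq_0_iff [simp]: "l1norm x = 0 \<longleftrightarrow> x = 0"
  by (auto simp: l1norm_def sum_nonneg_eq_0_iff vec_eq_iff)

lemma component_le_l1norm: "\<bar>x $ k\<bar> \<le> l1norm x"
  unfolding l1norm_def by (rule member_le_sum) auto

lemma l1norm_le:
  fixes x :: "real ^ 'n"
  assumes "\<And>k. \<bar>x $ k\<bar> \<le> r"
  shows "l1norm x \<le> real CARD('n) * r"
  unfolding l1norm_def using sum_bounded_above[of UNIV "\<lambda>k. \<bar>x $ k\<bar>" r] assms by simp

lemma borel_measurable_l1norm_diff: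
  "(\<lambda>p. l1norm (fst p - snd p)) \<in> borel_measurable (borel :: ((real ^ 'n) \<times> (real ^ 'n)) measure)"
  unfolding l1norm_def by (intro borel_measurable_continuous_onI continuous_intros)

text \<open>Rounding to the nearest site with half-open cubes gives an exact partition of the space,
  so that products of cells are disjoint. The closed cubes of \<open>Jcoup\<close> and the open
  cubes of \<open>ext_config\<close> differ from these only by null sets.\<close>

definition cell :: "real \<Rightarrow> real ^ 'n \<Rightarrow> int ^ 'n" where
  "cell e x = (\<chi> k. \<lfloor>x $ k / e + 1 / 2\<rfloor>)"

lemma cell_eq_iff:
  assumes "e > 0"
  shows "cell e x = i \<longleftrightarrow> (\<forall>k. e * (real_of_int (i $ k) - 1/2) \<le> x $ k \<and> x $ k < e * (real_of_int (i $ k) + 1/2))"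
proof -
  have "\<lfloor>x $ k / e + 1 / 2\<rfloor> = i $ k \<longleftrightarrow> e * (real_of_int (i $ k) - 1/2) \<le> x $ k \<and> x $ k < e * (real_of_int (i $ k) + 1/2)" for k
    using assms by (simp add: floor_eq_iff field_simps)
  then show ?thesis by (simp add: cell_def vec_eq_iff)
qed

lemma l1norm_cell_site:
  fixes x :: "real ^ 'n"
  assumes "e > 0"
  shows "l1norm (x - site_pt e (cell e x)) \<le> real CARD('n) * (e / 2)"
proof (rule l1norm_le)
  fix k
  have "e * (real_of_int (cell e x $ k) - 1/2) \<le> x $ k \<and> x $ k < e * (real_of_int (cell e x $ k) + 1/2)"
    using cell_eq_iff[OF assms, of x "cell e x"] by simp
  then show "\<bar>(x - site_pt e (cell e x)) $ k\<bar> \<le> e / 2"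
    unfolding site_pt_def abs_le_iff by (simp add: algebra_simps)
qed

lemma l1norm_same_cell:
  fixes x y :: "real ^ 'n"
  assumes "e > 0" "cell e x = cell e y"
  shows "l1norm (x - y) \<le> real CARD('n) * e"
  using l1norm_cell_site[OF assms(1), of x] l1norm_cell_site[OF assms(1), of y] assms(2)
    l1norm_triangle[of "x - site_pt e (cell e x)" "site_pt e (cell e y) - y"]
  by (simp add: l1norm_minus_commute[of "site_pt e (cell e y)"] algebra_simps)

lemma cell_borel_singleton:
  assumes "e > 0"
  shows "{x. cell e x = i} \<in> sets (borel :: (real ^ 'n) measure)"
proof -
  have "{x. cell e x = i} = (\<Inter>k. {x. e * (real_of_int (i $ k) - 1/2) \<le> x $ k} \<inter> {x. x $ k < e * (real_of_int (i $ k) + 1/2)})"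
    using cell_eq_iff[OF assms] by auto
  also have "\<dots> \<in> sets borel"
    by (intro sets.countable_INT'' sets.Int) (auto intro!: borel_closed borel_open closed_Collect_le open_Collect_less continuous_intros)
  finally show ?thesis .
qed

lemma countable_int_vec: "countable (A :: (int ^ 'n) set)"
proof -
  have "countable (PiE (UNIV :: 'n set) (\<lambda>_. UNIV :: int set))"
    by (intro countable_PiE) auto
  then have "countable (vec_lambda ` (PiE (UNIV :: 'n set) (\<lambda>_. UNIV :: int set)))"
    by (rule countable_image)
  moreover have "UNIV = vec_lambda ` (PiE (UNIV :: 'n set) (\<lambda>_. UNIV :: int set))"
    by (auto simp: image_iff PiE_UNIV_domain intro!: exI[of _ "vec_nth _"])
  ultimately show ?thesis by (metis countable_subset subset_UNIV)
qed

lemma cell_borel: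
  assumes "e > 0"
  shows "{x. cell e x \<in> S} \<in> sets (borel :: (real ^ 'n) measure)"
proof -
  have "{x. cell e x \<in> S} = (\<Union>i\<in>S. {x. cell e x = i})" by auto
  also have "\<dots> \<in> sets borel"
    using assms by (intro sets.countable_UN'') (auto simp: cell_borel_singleton countable_int_vec)
  finally show ?thesis .
qed

lemma emeasure_cbox_cart:
  fixes a b :: "real ^ 'n"
  assumes "\<And>k. a $ k \<le> b $ k"
  shows "emeasure lborel (cbox a b) = ennreal (\<Prod>k\<in>UNIV. b $ k - a $ k)"
    "emeasure lborel (box a b) = ennreal (\<Prod>k\<in>UNIV. b $ k - a $ k)"
proof -
  have ne: "cbox a b \<noteq> {}" using assms by (auto simp: cbox_interval less_eq_vec_def)
  have "emeasure lborel (cbox a b) = ennreal (measure lborel (cbox a b))"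
    using emeasure_eq_ennreal_measure[of lborel "cbox a b"] emeasure_lborel_cbox_finite[of a b] by simp
  then show 1: "emeasure lborel (cbox a b) = ennreal (\<Prod>k\<in>UNIV. b $ k - a $ k)"
    using content_cbox_cart[OF ne] by simp
  have "\<And>v. v \<in> Basis \<Longrightarrow> a \<bullet> v \<le> b \<bullet> v"
    using assms by (auto simp: Basis_vec_def inner_axis)
  then have "emeasure lborel (box a b) = emeasure lborel (cbox a b)" by simp
  with 1 show "emeasure lborel (box a b) = ennreal (\<Prod>k\<in>UNIV. b $ k - a $ k)" by simp
qed

lemma emeasure_cubeQ:
  fixes x :: "real ^ 'n"
  assumes "r \<ge> 0"
  shows "emeasure lborel (cubeQ r x) = ennreal ((2 * r) ^ CARD('n))"
    and "emeasure lborel (cubeQ_open r x) = ennreal ((2 * r) ^ CARD('n))"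
    and "cubeQ r x \<in> sets borel" and "cubeQ_open r x \<in> sets borel"
proof -
  let ?a = "\<chi> k. x $ k - r" and ?b = "\<chi> k. x $ k + r"
  have "\<bar>y - c\<bar> \<le> r \<longleftrightarrow> c - r \<le> y \<and> y \<le> c + r" "\<bar>y - c\<bar> < r \<longleftrightarrow> c - r < y \<and> y < c + r" for y c :: real
    by linarith+
  then have eq: "cubeQ r x = cbox ?a ?b" "cubeQ_open r x = box ?a ?b"
    by (auto simp: cubeQ_def cubeQ_open_def mem_box_cart)
  show "emeasure lborel (cubeQ r x) = ennreal ((2 * r) ^ CARD('n))"
    "emeasure lborel (cubeQ_open r x) = ennreal ((2 * r) ^ CARD('n))"
    unfolding eq using emeasure_cbox_cart[of ?a ?b] assms by simp_all
  show "cubeQ r x \<in> sets borel" "cubeQ_open r x \<in> sets borel" unfolding eq by auto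
qed

lemma cell_between_cubes:
  assumes "e > 0"
  shows "cubeQ_open (e / 2) (site_pt e i) \<subseteq> {x. cell e x = i}" "{x. cell e x = i} \<subseteq> cubeQ (e / 2) (site_pt e i)"
proof -
  have 1: "\<bar>y - e * c\<bar> < e / 2 \<Longrightarrow> e * (c - 1/2) \<le> y \<and> y < e * (c + 1/2)"
    and 2: "e * (c - 1/2) \<le> y \<Longrightarrow> y < e * (c + 1/2) \<Longrightarrow> \<bar>y - e * c\<bar> \<le> e / 2" for y c :: real
    unfolding abs_le_iff abs_less_iff right_diff_distrib distrib_left by (linarith | intro conjI)+
  show "cubeQ_open (e / 2) (site_pt e i) \<subseteq> {x. cell e x = i}"
    using 1 by (auto simp: cell_eq_iff[OF assms] cubeQ_open_def site_pt_def)
  show "{x. cell e x = i} \<subseteq> cubeQ (e / 2) (site_pt e i)"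
    using 2 by (auto simp: cell_eq_iff[OF assms] cubeQ_def site_pt_def)
qed

text \<open>The half-open cube is squeezed between an open and a closed cube of the same
  volume.\<close>

lemma emeasure_cell:
  fixes i :: "int ^ 'n"
  assumes "e > 0"
  shows "emeasure lborel {x. cell e x = i} = ennreal (e ^ CARD('n))"
proof (rule antisym)
  show "emeasure lborel {x. cell e x = i} \<le> ennreal (e ^ CARD('n))"
    using emeasure_mono[OF cell_between_cubes(2)[OF assms, of i], of lborel] assms
    by (simp add: emeasure_cubeQ)
  show "ennreal (e ^ CARD('n)) \<le> emeasure lborel {x. cell e x = i}"
    using emeasure_mono[OF cell_between_cubes(1)[OF assms, of i], of lborel] assms
    by (simp add: emeasure_cubeQ cell_borel_singleton)
qed

text \<open>A cell lies between the two cubes compared here, so this identifies all three up to null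
  sets.\<close>

lemma AE_cubeQ_iff_cell:
  fixes i :: "int ^ 'n"
  assumes "e > 0"
  shows "AE x in lebesgue. x \<in> cubeQ (e / 2) (site_pt e i) \<longleftrightarrow> x \<in> cubeQ_open (e / 2) (site_pt e i)"
proof -
  let ?Q = "cubeQ (e / 2) (site_pt e i)" and ?O = "cubeQ_open (e / 2) (site_pt e i)"
  have sub: "?O \<subseteq> ?Q" using cell_between_cubes[OF assms] by blast
  have "emeasure lborel (?Q - ?O) = emeasure lborel ?Q - emeasure lborel ?O"
    using assms by (intro emeasure_Diff sub) (auto simp: emeasure_cubeQ)
  also have "\<dots> = 0" using assms by (simp add: emeasure_cubeQ)
  finally have "?Q - ?O \<in> null_sets lborel"
    using assms by (auto simp: null_sets_def emeasure_cubeQ)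
  from AE_not_in[OF this] have "AE x in lborel. x \<in> ?Q \<longleftrightarrow> x \<in> ?O"
    by eventually_elim (use sub in auto)
  then show ?thesis by (simp add: AE_completion_iff)
qed

text \<open>Off countably many cube boundaries, the site whose open cube contains x is unique and
  equals \<open>cell e x\<close>.\<close>

lemma ext_config_eq_AE:
  fixes u :: "int ^ 'n \<Rightarrow> int"
  assumes "e > 0"
  shows "AE x in lebesgue. ext_config e u x = u (cell e x)"
proof -
  have "AE x in lebesgue. \<forall>i::int^'n. x \<in> cubeQ (e / 2) (site_pt e i) \<longleftrightarrow> x \<in> cubeQ_open (e / 2) (site_pt e i)"
    using AE_cubeQ_iff_cell[OF assms] countable_int_vec[of "UNIV :: (int^'n) set"]
    by (auto simp: AE_ball_countable[of UNIV, simplified])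
  then show ?thesis
  proof eventually_elim
    case (elim x)
    have "x \<in> cubeQ_open (e / 2) (site_pt e i) \<longleftrightarrow> i = cell e x" for i
      using elim cell_between_cubes[OF assms, of i] by auto
    then show ?case by (simp add: ext_config_def)
  qed
qed

subsection \<open>The homogeneous interaction measure\<close>

text \<open>Pairs are taken in both orders, so the set is invariant under swapping, and the
  interaction across E becomes the measure of a single set.\<close>

definition cutset :: "'a set \<Rightarrow> ('a \<times> 'a) set" where
  "cutset E = {p. fst p \<in> E \<longleftrightarrow> snd p \<notin> E}"

definition hker :: "real \<Rightarrow> (real ^ 'n) \<times> (real ^ 'n) \<Rightarrow> real" where
  "hker s p = l1norm (fst p - snd p) powr (- (real CARD('n) + s))"

text \<open>The model interaction to which (K2) compares K; it transforms exactly under translations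
  and dilations, which K need not do.\<close>

definition hmeas :: "real \<Rightarrow> ((real ^ 'n) \<times> (real ^ 'n)) measure" where
  "hmeas s = density lebesgue (\<lambda>p. ennreal (hker s p))"

lemma hker_measurable [measurable]:
  "hker s \<in> borel_measurable (borel :: ((real ^ 'n) \<times> (real ^ 'n)) measure)"
  unfolding hker_def using borel_measurable_l1norm_diff by measurable

lemma hker_measurable_lebesgue [measurable]:
  "(\<lambda>p. ennreal (hker s p)) \<in> borel_measurable (lebesgue :: ((real ^ 'n) \<times> (real ^ 'n)) measure)"
  by (intro measurable_completion measurable_compose[OF _ measurable_ennreal]) (simp add: hker_measurable)

lemma sets_hmeas [simp]: "sets (hmeas s) = sets lebesgue" "space (hmeas s) = UNIV"
  by (auto simp: hmeas_def)

lemma emeasure_hmeas_borel: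
  assumes "S \<in> sets borel"
  shows "emeasure (hmeas s) S = (\<integral>\<^sup>+ p. ennreal (hker s p) * indicator S p \<partial>lborel)"
proof -
  have "S \<in> sets lebesgue" using assms by auto
  then show ?thesis
    unfolding hmeas_def by (subst emeasure_density) (auto simp: hker_measurable_lebesgue nn_integral_completion)
qed

lemma hker_affine:
  fixes a x y :: "real ^ 'n"
  assumes "c > 0"
  shows "hker s (a + c *\<^sub>R x, a + c *\<^sub>R y) = c powr (- (real CARD('n) + s)) * hker s (x, y)"
proof -
  have "(a + c *\<^sub>R x) - (a + c *\<^sub>R y) = c *\<^sub>R (x - y)" by (simp add: algebra_simps)
  then show ?thesis using assms by (simp add: hker_def l1norm_scaleR powr_mult)
qed

text \<open>Moving both points by the same a leaves their difference alone. The dilation has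
  Jacobian c^(2d) on pairs and multiplies the kernel by c^(-d-s), whence the exponent d - s.\<close>

lemma emeasure_hmeas_affine:
  fixes a :: "real ^ 'n"
  assumes c: "c > 0" and S: "S \<in> sets borel"
  shows "emeasure (hmeas s) S =
    ennreal (c powr (real CARD('n) - s)) * emeasure (hmeas s) {p. (a + c *\<^sub>R fst p, a + c *\<^sub>R snd p) \<in> S}"
proof -
  let ?T = "\<lambda>p :: (real ^ 'n) \<times> (real ^ 'n). (a, a) + c *\<^sub>R p"
  have T: "?T p = (a + c *\<^sub>R fst p, a + c *\<^sub>R snd p)" for p by (simp add: prod_eq_iff)
  have m: "?T \<in> borel_measurable borel" 
    by (intro borel_measurable_continuous_onI continuous_intros)
  have S': "{p. ?T p \<in> S} \<in> sets borel"
    using measurable_sets[OF m S] by (simp add: vimage_def)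
  have "emeasure (hmeas s) S = (\<integral>\<^sup>+ p. ennreal (hker s p) * indicator S p \<partial>lborel)"
    by (rule emeasure_hmeas_borel[OF S])
  also have "\<dots> = (\<integral>\<^sup>+ p. ennreal (hker s p) * indicator S p
      \<partial>density (distr lborel borel ?T) (\<lambda>_. ennreal (\<bar>c\<bar> ^ DIM((real ^ 'n) \<times> (real ^ 'n)))))"
    using lborel_affine[of c "(a, a)"] c by simp
  also have "\<dots> = (\<integral>\<^sup>+ p. ennreal (\<bar>c\<bar> ^ DIM((real ^ 'n) \<times> (real ^ 'n))) * (ennreal (hker s (?T p)) * indicator S (?T p)) \<partial>lborel)"
  proof -
    have f: "(\<lambda>p. ennreal (hker s p) * indicator S p) \<in> borel_measurable borel"
      using S by measurable
    have "(\<integral>\<^sup>+ p. ennreal (hker s p) * indicator S p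
        \<partial>density (distr lborel borel ?T) (\<lambda>_. ennreal (\<bar>c\<bar> ^ DIM((real ^ 'n) \<times> (real ^ 'n)))))
      = (\<integral>\<^sup>+ p. ennreal (\<bar>c\<bar> ^ DIM((real ^ 'n) \<times> (real ^ 'n))) * (ennreal (hker s p) * indicator S p) \<partial>distr lborel borel ?T)"
      by (rule nn_integral_density) (simp_all only: measurable_distr_eq1 f borel_measurable_const)
    also have "\<dots> = (\<integral>\<^sup>+ p. ennreal (\<bar>c\<bar> ^ DIM((real ^ 'n) \<times> (real ^ 'n))) * (ennreal (hker s (?T p)) * indicator S (?T p)) \<partial>lborel)"
    proof (rule nn_integral_distr)
      show "?T \<in> lborel \<rightarrow>\<^sub>M borel" by (subst measurable_cong_sets[OF sets_lborel refl]) (rule m)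
      show "(\<lambda>p. ennreal (\<bar>c\<bar> ^ DIM((real ^ 'n) \<times> (real ^ 'n))) * (ennreal (hker s p) * indicator S p))
          \<in> borel_measurable (distr lborel borel ?T)"
        unfolding measurable_distr_eq1 by (intro borel_measurable_times_ennreal f borel_measurable_const)
    qed
    finally show ?thesis .
  qed
  also have "\<dots> = (\<integral>\<^sup>+ p. ennreal (c powr (real CARD('n) - s)) * (ennreal (hker s p) * indicator {p. ?T p \<in> S} p) \<partial>lborel)"
  proof (intro nn_integral_cong)
    fix p :: "(real ^ 'n) \<times> (real ^ 'n)"
    have "\<bar>c\<bar> ^ DIM((real ^ 'n) \<times> (real ^ 'n)) = c powr (2 * real CARD('n))"
    proof -
      have "DIM((real ^ 'n) \<times> (real ^ 'n)) = 2 * CARD('n)" by simp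
      moreover have "c ^ (2 * CARD('n)) = c powr real (2 * CARD('n))" by (rule powr_realpow[OF c, symmetric])
      ultimately show ?thesis using c by (simp only: abs_of_pos of_nat_mult of_nat_numeral)
    qed
    then have "\<bar>c\<bar> ^ DIM((real ^ 'n) \<times> (real ^ 'n)) * hker s (?T p) = c powr (2 * real CARD('n)) * c powr (- (real CARD('n) + s)) * hker s p"
      unfolding T hker_affine[OF c] by simp
    also have "\<dots> = c powr (real CARD('n) - s) * hker s p"
      unfolding powr_add[symmetric] by (simp add: algebra_simps)
    finally have eq: "\<bar>c\<bar> ^ DIM((real ^ 'n) \<times> (real ^ 'n)) * hker s (?T p) = c powr (real CARD('n) - s) * hker s p" .
    have "ennreal (\<bar>c\<bar> ^ DIM((real ^ 'n) \<times> (real ^ 'n))) * ennreal (hker s (?T p)) = ennreal (c powr (real CARD('n) - s)) * ennreal (hker s p)"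
      by (subst (1 2) ennreal_mult[symmetric]) (simp_all only: eq, auto simp: hker_def)
    then show "ennreal (\<bar>c\<bar> ^ DIM((real ^ 'n) \<times> (real ^ 'n))) * (ennreal (hker s (?T p)) * indicator S (?T p)) =
        ennreal (c powr (real CARD('n) - s)) * (ennreal (hker s p) * indicator {p. ?T p \<in> S} p)"
      by (simp add: mult.assoc[symmetric] indicator_def)
  qed
  also have "\<dots> = ennreal (c powr (real CARD('n) - s)) * (\<integral>\<^sup>+ p. (ennreal (hker s p) * indicator {p. ?T p \<in> S} p) \<partial>lborel)"
  proof (intro nn_integral_cmult borel_measurable_times_ennreal borel_measurable_indicator)
    show "(\<lambda>p :: (real ^ 'n) \<times> (real ^ 'n). ennreal (hker s p)) \<in> borel_measurable lborel" by measurable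
    show "{p. ?T p \<in> S} \<in> sets lborel" using S' by (simp only: sets_lborel)
  qed
  also have "(\<integral>\<^sup>+ p. (ennreal (hker s p) * indicator {p. ?T p \<in> S} p) \<partial>lborel) = emeasure (hmeas s) {p. ?T p \<in> S}"
    by (rule emeasure_hmeas_borel[OF S', symmetric])
  finally show ?thesis unfolding T .
qed

text \<open>L is the layer of thickness t along the faces of the unit cell; it is covered by 2d
  slabs of volume at most t. The bound 1 takes over for large t.\<close>

lemma emeasure_unit_cell_layer:
  fixes t :: real
  assumes "t > 0"
  defines "L \<equiv> {x :: real ^ 'n. cell 1 x = 0 \<and> (\<exists>k. x $ k < -1/2 + t \<or> 1/2 - t \<le> x $ k)}"
  shows "L \<in> sets borel" "emeasure lborel L \<le> ennreal (2 * real CARD('n) * t)" "emeasure lborel L \<le> 1"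
proof -
  let ?U = "{x :: real ^ 'n. cell 1 x = 0}"
  let ?A = "\<lambda>k. {x :: real ^ 'n. cell 1 x = 0 \<and> x $ k < -1/2 + t}"
  let ?B = "\<lambda>k. {x :: real ^ 'n. cell 1 x = 0 \<and> 1/2 - t \<le> x $ k}"
  have U: "?U \<in> sets borel" by (rule cell_borel_singleton) simp
  have A: "?A k \<in> sets borel" for k
  proof -
    have "?A k = ?U \<inter> {x. x $ k < -1/2 + t}" by auto
    also have "\<dots> \<in> sets borel" by (intro sets.Int U borel_open open_Collect_less continuous_intros)
    finally show ?thesis .
  qed
  have B: "?B k \<in> sets borel" for k
  proof -
    have "?B k = ?U \<inter> {x. 1/2 - t \<le> x $ k}" by auto
    also have "\<dots> \<in> sets borel" by (intro sets.Int U borel_closed closed_Collect_le continuous_intros)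
    finally show ?thesis .
  qed
  have L: "L = (\<Union>k\<in>UNIV. ?A k \<union> ?B k)" unfolding L_def by auto
  show "L \<in> sets borel" unfolding L using A B by (intro sets.finite_UN sets.Un) auto
  have U1: "x \<in> ?U \<longleftrightarrow> (\<forall>k. -1/2 \<le> x $ k \<and> x $ k < 1/2)" for x
    by (simp add: cell_eq_iff)
  have prod: "(\<Prod>j\<in>UNIV. if j = k then t else 1) = t" for k :: 'n
    by (simp add: prod.delta)
  have "emeasure lborel (?A k) \<le> ennreal t" for k
  proof -
    let ?b = "\<chi> j. if j = k then -1/2 + t else (1/2 :: real)" and ?a = "\<chi> j. (-1/2 :: real)"
    have "?A k \<subseteq> cbox ?a ?b" using U1 by (auto simp: mem_box_cart less_imp_le)
    then have "emeasure lborel (?A k) \<le> emeasure lborel (cbox ?a ?b)" by (intro emeasure_mono) auto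
    also have "\<dots> = ennreal (\<Prod>j\<in>UNIV. ?b $ j - ?a $ j)" using assms(1) by (intro emeasure_cbox_cart) auto
    also have "(\<Prod>j\<in>UNIV. ?b $ j - ?a $ j) = (\<Prod>j\<in>UNIV. if j = k then t else 1)" by (intro prod.cong) auto
    finally show ?thesis using prod by simp
  qed
  moreover have "emeasure lborel (?B k) \<le> ennreal t" for k
  proof -
    let ?b = "\<chi> j. (1/2 :: real)" and ?a = "\<chi> j. if j = k then 1/2 - t else (-1/2 :: real)"
    have "?B k \<subseteq> cbox ?a ?b" using U1 by (auto simp: mem_box_cart less_imp_le)
    then have "emeasure lborel (?B k) \<le> emeasure lborel (cbox ?a ?b)" by (intro emeasure_mono) auto
    also have "\<dots> = ennreal (\<Prod>j\<in>UNIV. ?b $ j - ?a $ j)" using assms(1) by (intro emeasure_cbox_cart) auto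
    also have "(\<Prod>j\<in>UNIV. ?b $ j - ?a $ j) = (\<Prod>j\<in>UNIV. if j = k then t else 1)" by (intro prod.cong) auto
    finally show ?thesis using prod by simp
  qed
  ultimately have AB: "emeasure lborel (?A k \<union> ?B k) \<le> ennreal (2 * t)" for k
    using emeasure_subadditive[of "?A k" lborel "?B k"] A B assms(1)
      add_mono[of "emeasure lborel (?A k)" "ennreal t" "emeasure lborel (?B k)" "ennreal t"]
    by (force simp: ennreal_plus[symmetric] simp del: ennreal_plus intro: order_trans)
  have "emeasure lborel L \<le> (\<Sum>k\<in>UNIV. emeasure lborel (?A k \<union> ?B k))"
    unfolding L using A B by (intro emeasure_subadditive_finite) auto
  also have "\<dots> \<le> (\<Sum>k\<in>(UNIV :: 'n set). ennreal (2 * t))" by (intro sum_mono AB)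
  also have "\<dots> = ennreal (2 * real CARD('n) * t)"
    using assms(1) by (subst sum_ennreal) auto
  finally show "emeasure lborel L \<le> ennreal (2 * real CARD('n) * t)" .
  have "emeasure lborel L \<le> emeasure lborel ?U" unfolding L_def by (intro emeasure_mono) (auto simp: U)
  then show "emeasure lborel L \<le> 1" by (simp add: emeasure_cell)
qed

text \<open>To leave the cell within distance t, the first point must lie in the layer, and the
  second then lies in a cube of side 2t around it. The layer supplies the extra factor t that makes
  the sum over short distances converge; the second bound serves large t.\<close>

lemma unit_cell_near_volume:
  fixes t :: real
  assumes t: "t > 0"
  defines "W \<equiv> {p :: (real ^ 'n) \<times> (real ^ 'n). cell 1 (fst p) = 0 \<and> cell 1 (snd p) \<noteq> 0 \<and> l1norm (fst p - snd p) \<le> t}"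
  shows "emeasure lborel W \<le> ennreal (2 * real CARD('n) * t * (2 * t) ^ CARD('n))"
    "emeasure lborel W \<le> ennreal ((2 * t) ^ CARD('n))" "W \<in> sets borel"
proof -
  let ?L = "{x :: real ^ 'n. cell 1 x = 0 \<and> (\<exists>k. x $ k < -1/2 + t \<or> 1/2 - t \<le> x $ k)}"
  note L = emeasure_unit_cell_layer[OF t, where 'n='n]
  have W: "W = (\<lambda>p. fst p) -` {x. cell 1 x \<in> {0}} \<inter> (\<lambda>p. snd p) -` {x. cell 1 x \<in> - {0}} \<inter> {p. l1norm (fst p - snd p) \<le> t}"
    by (auto simp: W_def)
  have m: "fst \<in> borel_measurable (borel :: ((real ^ 'n) \<times> (real ^ 'n)) measure)"
    "snd \<in> borel_measurable (borel :: ((real ^ 'n) \<times> (real ^ 'n)) measure)"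
    by (auto intro!: borel_measurable_continuous_onI continuous_on_snd continuous_on_fst continuous_on_id)
  show Wm: "W \<in> sets borel"
    unfolding W using measurable_sets[OF m(1) cell_borel[of 1 "{0}"]] measurable_sets[OF m(2) cell_borel[of 1 "- {0}"]]
      measurable_sets[OF borel_measurable_l1norm_diff, of "{..t}"]
    by (auto simp: vimage_def)
  then have "W \<in> sets (lborel \<Otimes>\<^sub>M lborel)" unfolding lborel_prod by simp
  then have "emeasure lborel W = (\<integral>\<^sup>+ x. emeasure lborel (Pair x -` W) \<partial>lborel)"
    using lborel.emeasure_pair_measure_alt[of W lborel] by (simp add: lborel_prod)
  also have "\<dots> \<le> (\<integral>\<^sup>+ x. ennreal ((2 * t) ^ CARD('n)) * indicator ?L x \<partial>lborel)"
  proof (intro nn_integral_mono)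
    fix x :: "real ^ 'n"
    show "emeasure lborel (Pair x -` W) \<le> ennreal ((2 * t) ^ CARD('n)) * indicator ?L x"
    proof (cases "x \<in> ?L")
      case True
      have "Pair x -` W \<subseteq> cubeQ t x"
      proof
        fix y assume "y \<in> Pair x -` W"
        then have "l1norm (y - x) \<le> t" by (simp add: W_def l1norm_minus_commute)
        then have "\<bar>y $ k - x $ k\<bar> \<le> t" for k
          using component_le_l1norm[of "y - x" k] by simp
        then show "y \<in> cubeQ t x" by (simp add: cubeQ_def)
      qed
      then have "emeasure lborel (Pair x -` W) \<le> emeasure lborel (cubeQ t x)"
        using t by (intro emeasure_mono) (auto simp: emeasure_cubeQ)
      then show ?thesis using True t by (simp add: emeasure_cubeQ)
    next
      case False
      have "Pair x -` W = {}"
      proof (rule ccontr)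
        assume "Pair x -` W \<noteq> {}"
        then obtain y where y: "cell 1 x = 0" "cell 1 y \<noteq> 0" "l1norm (x - y) \<le> t" by (auto simp: W_def)
        then obtain k where "y $ k < -1/2 \<or> 1/2 \<le> y $ k"
          by (auto simp: cell_eq_iff[of 1 y 0] not_le not_less)
        moreover have "\<bar>x $ k - y $ k\<bar> \<le> t" using component_le_l1norm[of "x - y" k] y(3) by simp
        ultimately have "x $ k < -1/2 + t \<or> 1/2 - t \<le> x $ k" by linarith
        with y(1) False show False by auto
      qed
      then show ?thesis by simp
    qed
  qed
  also have "\<dots> = ennreal ((2 * t) ^ CARD('n)) * emeasure lborel ?L"
    using L(1) by (intro nn_integral_cmult_indicator) auto
  finally have *: "emeasure lborel W \<le> ennreal ((2 * t) ^ CARD('n)) * emeasure lborel ?L" .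
  have "ennreal ((2 * t) ^ CARD('n)) * emeasure lborel ?L \<le> ennreal ((2 * t) ^ CARD('n)) * ennreal (2 * real CARD('n) * t)"
    by (intro mult_left_mono L(2)) simp
  also have "\<dots> = ennreal (2 * real CARD('n) * t * (2 * t) ^ CARD('n))"
    using t by (subst ennreal_mult[symmetric]) (auto simp: mult_ac)
  finally show "emeasure lborel W \<le> ennreal (2 * real CARD('n) * t * (2 * t) ^ CARD('n))" using * by simp
  have "ennreal ((2 * t) ^ CARD('n)) * emeasure lborel ?L \<le> ennreal ((2 * t) ^ CARD('n)) * 1"
    by (intro mult_left_mono L(3)) simp
  then show "emeasure lborel W \<le> ennreal ((2 * t) ^ CARD('n))" using * by simp
qed


text \<open>Dyadic decomposition of the distance: shells of radius about 2^(-k) below 1 and about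
  2^k above 1. On each shell the kernel is bounded by its value at the inner radius.\<close>

lemma hker_dyadic_bound:
  fixes p :: "(real ^ 'n) \<times> (real ^ 'n)"
  assumes s: "s > 0" and ne: "fst p \<noteq> snd p"
  defines "q \<equiv> 2 powr (real CARD('n) + s)"
  shows "\<exists>k. (hker s p \<le> q ^ k \<and> l1norm (fst p - snd p) \<le> 2 * (1/2) ^ k) \<or>
             (hker s p \<le> (1/q) ^ k \<and> l1norm (fst p - snd p) \<le> 2 * 2 ^ k)"
proof -
  let ?r = "l1norm (fst p - snd p)"
  have r: "?r > 0" using ne l1norm_nonneg[of "fst p - snd p"] by (simp add: less_le del: l1norm_nonneg)
  have anti: "?r powr (- (real CARD('n) + s)) \<le> t powr (- (real CARD('n) + s))" if "0 < t" "t \<le> ?r" for t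
    using that s by (intro powr_mono2') auto
  have pw: "(c ^ k) powr r = (c powr r) ^ k" if "c > 0" for c r :: real and k
    using that by (induction k) (auto simp: powr_mult)
  have q1: "((1/2) ^ k) powr (- (real CARD('n) + s)) = q ^ k" for k
    by (subst pw) (simp_all add: q_def powr_minus powr_divide divide_simps del: minus_add_distrib)
  have q2: "(2 ^ k) powr (- (real CARD('n) + s)) = (1/q) ^ k" for k
    by (subst pw) (simp_all add: q_def powr_minus divide_simps del: minus_add_distrib)
  show ?thesis
  proof (cases "?r \<le> 1")
    case True
    \<comment> \<open>The first k whose inner radius is at most the distance; for k = 0 the outer
      bound 2 holds since the distance is at most 1.\<close>
    define k where "k = (LEAST k. (1/2) ^ k \<le> ?r)"
    have "\<exists>k. (1/2) ^ k \<le> ?r" using real_arch_pow_inv[OF r, of "1/2"] by (auto intro: less_imp_le)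
    then have k: "(1/2) ^ k \<le> ?r" unfolding k_def by (rule LeastI_ex)
    have "?r \<le> 2 * (1/2) ^ k"
    proof (cases k)
      case 0 then show ?thesis using True by simp
    next
      case (Suc j)
      then have "j < k" by simp
      then have "\<not> (1/2) ^ j \<le> ?r" unfolding k_def by (rule not_less_Least)
      with Suc show ?thesis by simp
    qed
    moreover have "hker s p \<le> q ^ k" using anti[OF _ k] q1[of k] by (simp add: hker_def)
    ultimately show ?thesis by blast
  next
    case False
    define k where "k = (LEAST k. ?r \<le> 2 * 2 ^ k)"
    obtain k0 where "?r < 2 ^ k0" using real_arch_pow[of 2 ?r] by auto
    then have "?r \<le> 2 * 2 ^ k0" using zero_le_power[of "2::real" k0] by linarith
    then have k: "?r \<le> 2 * 2 ^ k" unfolding k_def by (rule LeastI)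
    have "2 ^ k \<le> ?r"
    proof (cases k)
      case 0 then show ?thesis using False by simp
    next
      case (Suc j)
      then have "j < k" by simp
      then have "\<not> ?r \<le> 2 * 2 ^ j" unfolding k_def by (rule not_less_Least)
      with Suc show ?thesis by simp
    qed
    then have "hker s p \<le> (1/q) ^ k" using anti[of "2 ^ k"] q2[of k] by (simp add: hker_def)
    with k show ?thesis by blast
  qed
qed

text \<open>Up to constants, the shells contribute q^k 2^(-k(d+1)) = 2^((s-1)k) at short distances
  and q^(-k) 2^(kd) = 2^(-sk) at long ones. The two geometric series converge by s < 1 and s > 0
  respectively.\<close>

lemma hmeas_unit_cell_finite:
  fixes s :: real
  assumes s: "0 < s" "s < 1"
  defines "W \<equiv> {p :: (real ^ 'n) \<times> (real ^ 'n). cell 1 (fst p) = 0 \<and> cell 1 (snd p) \<noteq> 0}"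
  shows "emeasure (hmeas s) W < \<infinity>" "W \<in> sets borel"
proof -
  let ?d = "CARD('n)"
  define q where "q = 2 powr (real ?d + s)"
  define V where "V t = {p \<in> W. l1norm (fst p - snd p) \<le> t}" for t
  have V: "emeasure lborel (V t) \<le> ennreal (2 * real ?d * t * (2 * t) ^ ?d)"
    "emeasure lborel (V t) \<le> ennreal ((2 * t) ^ ?d)" "V t \<in> sets borel" if "t > 0" for t
    using unit_cell_near_volume[OF that, where 'n='n] by (auto simp: V_def W_def conj_assoc)
  have "W = (\<Union>k. V (real (Suc k)))"
  proof (intro set_eqI iffI)
    fix p assume "p \<in> W"
    moreover obtain n where "l1norm (fst p - snd p) < real n" using reals_Archimedean2 by blast
    ultimately have "p \<in> V (real (Suc n))" by (simp add: V_def)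
    then show "p \<in> (\<Union>k. V (real (Suc k)))" by blast
  qed (auto simp: V_def)
  also have "\<dots> \<in> sets borel" by (intro sets.countable_UN'' V(3)) auto
  finally show W: "W \<in> sets borel" .
  have q: "q > 0" by (simp add: q_def)
  let ?f = "\<lambda>k p. ennreal (q ^ k) * indicator (V (2 * (1/2) ^ k)) p + ennreal ((1/q) ^ k) * indicator (V (2 * 2 ^ k)) p"
  have f: "?f k \<in> borel_measurable borel" for k
    using V(3)[of "2 * (1/2) ^ k"] V(3)[of "2 * 2 ^ k"] by measurable
  have bound: "ennreal (hker s p) * indicator W p \<le> (\<Sum>k. ?f k p)" for p
  proof (cases "p \<in> W")
    case True
    then have "fst p \<noteq> snd p" by (auto simp: W_def)
    from hker_dyadic_bound[OF s(1) this]
    obtain k where k: "(hker s p \<le> q ^ k \<and> l1norm (fst p - snd p) \<le> 2 * (1/2) ^ k) \<or>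
             (hker s p \<le> (1/q) ^ k \<and> l1norm (fst p - snd p) \<le> 2 * 2 ^ k)" unfolding q_def by blast
    have "ennreal (hker s p) \<le> ?f k p"
    proof (cases "hker s p \<le> q ^ k \<and> l1norm (fst p - snd p) \<le> 2 * (1/2) ^ k")
      case T: True
      then have "ennreal (hker s p) \<le> ennreal (q ^ k) * indicator (V (2 * (1/2) ^ k)) p"
        using True by (simp add: V_def ennreal_leI)
      then show ?thesis by (rule order_trans) simp
    next
      case False
      then have "ennreal (hker s p) \<le> ennreal ((1/q) ^ k) * indicator (V (2 * 2 ^ k)) p"
        using True k by (auto simp: V_def ennreal_leI)
      then show ?thesis by (rule order_trans) simp
    qed
    also have "\<dots> \<le> (\<Sum>k. ?f k p)"
      using sum_le_suminf[of "\<lambda>k. ?f k p" "{k}"] by simp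
    finally show ?thesis using True by simp
  qed simp
  \<comment> \<open>The two volume bounds, at t = 2 * 2^(-k) and at t = 2 * 2^k, multiplied by the
    kernel bounds q^k and q^(-k).\<close>
  let ?a = "\<lambda>k. 2 * real ?d * 2 * 4 ^ ?d * (2 powr (s - 1)) ^ k" and ?b = "\<lambda>k. 4 ^ ?d * (2 powr (- s)) ^ k"
  have four: "(2 * (2 * a)) ^ ?d = 4 ^ ?d * a ^ ?d" for a :: real
    unfolding power_mult_distrib[symmetric] by simp
  have int: "(\<integral>\<^sup>+ p. ?f k p \<partial>lborel) \<le> ennreal (?a k + ?b k)" for k
  proof -
    have "(\<integral>\<^sup>+ p. ?f k p \<partial>lborel) = ennreal (q ^ k) * emeasure lborel (V (2 * (1/2) ^ k)) + ennreal ((1/q) ^ k) * emeasure lborel (V (2 * 2 ^ k))"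
      using V(3)[of "2 * (1/2) ^ k"] V(3)[of "2 * 2 ^ k"]
      by (subst nn_integral_add) (auto simp: nn_integral_cmult_indicator intro!: borel_measurable_times_ennreal)
    also have "\<dots> \<le> ennreal (q ^ k) * ennreal (2 * real ?d * (2 * (1/2) ^ k) * (2 * (2 * (1/2) ^ k)) ^ ?d)
        + ennreal ((1/q) ^ k) * ennreal ((2 * (2 * 2 ^ k)) ^ ?d)"
      by (intro add_mono mult_left_mono V) auto
    also have "\<dots> = ennreal (q ^ k * (2 * real ?d * (2 * (1/2) ^ k) * (2 * (2 * (1/2) ^ k)) ^ ?d)) + ennreal ((1/q) ^ k * (2 * (2 * 2 ^ k)) ^ ?d)"
      using q by (simp add: ennreal_mult)
    also have "\<dots> = ennreal (q ^ k * (2 * real ?d * (2 * (1/2) ^ k) * (2 * (2 * (1/2) ^ k)) ^ ?d) + (1/q) ^ k * (2 * (2 * 2 ^ k)) ^ ?d)"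
      using q by (intro ennreal_plus[symmetric]) auto
    also have "q ^ k * (2 * real ?d * (2 * (1/2) ^ k) * (2 * (2 * (1/2) ^ k)) ^ ?d) = ?a k"
    proof -
      have "2 powr (s - 1) = q * (1/2) * (1/2) ^ ?d"
        by (simp add: q_def powr_add powr_diff powr_realpow power_divide)
      then have "(2 powr (s - 1)) ^ k = q ^ k * (1/2) ^ k * ((1/2) ^ k) ^ ?d"
        by (simp only: power_mult_distrib power_mult[symmetric] mult.commute[of ?d k])
      then show ?thesis by (simp only: four mult_ac)
    qed
    also have "(1/q) ^ k * (2 * (2 * 2 ^ k)) ^ ?d = ?b k"
    proof -
      have "2 powr (- s) = (1/q) * 2 ^ ?d"
        by (simp add: q_def powr_add powr_minus powr_realpow field_simps)
      then have "(2 powr (- s)) ^ k = (1/q) ^ k * (2 ^ k) ^ ?d"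
        by (simp only: power_mult_distrib power_mult[symmetric] mult.commute[of ?d k])
      then show ?thesis by (simp only: four mult_ac)
    qed
    finally show ?thesis .
  qed
  have "emeasure (hmeas s) W = (\<integral>\<^sup>+ p. ennreal (hker s p) * indicator W p \<partial>lborel)"
    by (rule emeasure_hmeas_borel[OF W])
  also have "\<dots> \<le> (\<integral>\<^sup>+ p. (\<Sum>k. ?f k p) \<partial>lborel)" by (intro nn_integral_mono bound)
  also have "\<dots> = (\<Sum>k. \<integral>\<^sup>+ p. ?f k p \<partial>lborel)"
    using f by (intro nn_integral_suminf) simp
  also have "\<dots> \<le> (\<Sum>k. ennreal (?a k + ?b k))" by (intro suminf_le int) auto
  also have "\<dots> < \<infinity>"
  proof -
    have "2 powr (s - 1) < 2 powr 0" "2 powr (- s) < 2 powr 0" using s by (auto simp only: powr_less_cancel_iff)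
    then have "summable (\<lambda>k. ?a k + ?b k)"
      by (intro summable_add summable_mult summable_geometric) auto
    then have "(\<Sum>k. ennreal (?a k + ?b k)) \<noteq> top" by (intro ennreal_suminf_neq_top) auto
    then show ?thesis by (simp add: top.not_eq_extremum)
  qed
  finally show "emeasure (hmeas s) W < \<infinity>" .
qed

lemma hker_swap: "hker s (prod.swap p) = hker s p"
  by (simp add: hker_def l1norm_minus_commute)

lemma lebesgue_vimage_swap: "S \<in> sets lebesgue \<Longrightarrow>
    {p. prod.swap p \<in> S} \<in> sets (lebesgue :: ('a::euclidean_space \<times> 'b::euclidean_space) measure)"
  using measurable_sets[OF lebesgue_measurable_swap] by (force simp: vimage_def)

lemma emeasure_density_swap:
  fixes f :: "'a::euclidean_space \<times> 'a \<Rightarrow> ennreal"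
  assumes f: "f \<in> borel_measurable lebesgue" and sym: "AE p in lebesgue. f (prod.swap p) = f p"
    and S: "S \<in> sets lebesgue"
  shows "emeasure (density lebesgue f) {p. prod.swap p \<in> S} = emeasure (density lebesgue f) S"
proof -
  have "emeasure (density lebesgue f) {p. prod.swap p \<in> S} = (\<integral>\<^sup>+ p. f p * indicator {p. prod.swap p \<in> S} p \<partial>lebesgue)"
    using f lebesgue_vimage_swap[OF S] by (rule emeasure_density)
  also have "\<dots> = (\<integral>\<^sup>+ p. f (prod.swap p) * indicator S (prod.swap p) \<partial>lebesgue)"
    by (rule nn_integral_cong_AE) (use sym in eventually_elim, simp add: indicator_def)
  also have "\<dots> = (\<integral>\<^sup>+ p. f p * indicator S p \<partial>lebesgue)"
    using f S by (intro nn_integral_lebesgue_swap[of "\<lambda>p. f p * indicator S p"]) simp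
  also have "\<dots> = emeasure (density lebesgue f) S"
    using f S by (rule emeasure_density[symmetric])
  finally show ?thesis .
qed

lemma cutset_sets_lebesgue:
  fixes E :: "'a::euclidean_space set"
  assumes "E \<in> sets lebesgue"
  shows "cutset E \<in> sets lebesgue"
proof -
  have "- E \<in> sets lebesgue" using sets.compl_sets[OF assms] by (simp add: Compl_eq_Diff_UNIV)
  moreover have "cutset E = E \<times> (- E) \<union> (- E) \<times> E" by (auto simp: cutset_def)
  ultimately show ?thesis using assms by (auto intro!: sets.Un lebesgue_sets_Times)
qed

lemma cutset_sets_borel:
  fixes E :: "'a::euclidean_space set"
  assumes "E \<in> sets borel"
  shows "cutset E \<in> sets borel"
proof -
  have "- E \<in> sets borel" using assms by auto
  moreover have "cutset E = E \<times> (- E) \<union> (- E) \<times> E" by (auto simp: cutset_def)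
  ultimately show ?thesis using assms by (simp only: sets.Un borel_Times)
qed

abbreviation unit_cell :: "(real ^ 'n) set" where
  "unit_cell \<equiv> {x. cell 1 x = 0}"

lemma unit_cell_cut:
  fixes s :: real
  assumes s: "0 < s" "s < 1"
  shows "cutset (unit_cell :: (real ^ 'n) set) \<in> sets borel" "emeasure (hmeas s) (cutset (unit_cell :: (real ^ 'n) set)) < \<infinity>"
proof -
  let ?W = "{p :: (real ^ 'n) \<times> (real ^ 'n). cell 1 (fst p) = 0 \<and> cell 1 (snd p) \<noteq> 0}"
  note W = hmeas_unit_cell_finite[OF s, where 'n='n]
  show "cutset (unit_cell :: (real ^ 'n) set) \<in> sets borel" by (intro cutset_sets_borel cell_borel_singleton) simp
  have W': "?W \<in> sets lebesgue" using W(2) by auto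
  have eq: "cutset (unit_cell :: (real ^ 'n) set) = ?W \<union> {p. prod.swap p \<in> ?W}" by (auto simp: cutset_def)
  have "emeasure (hmeas s) (cutset (unit_cell :: (real ^ 'n) set)) \<le> emeasure (hmeas s) ?W + emeasure (hmeas s) {p. prod.swap p \<in> ?W}"
    unfolding eq using W' lebesgue_vimage_swap[OF W'] by (intro emeasure_subadditive) auto
  also have "emeasure (hmeas s) {p. prod.swap p \<in> ?W} = emeasure (hmeas s) ?W"
    unfolding hmeas_def using W' by (intro emeasure_density_swap) (auto simp: hker_swap hker_measurable_lebesgue)
  finally show "emeasure (hmeas s) (cutset (unit_cell :: (real ^ 'n) set)) < \<infinity>"
    using W(1) by (simp add: top.not_eq_extremum order_le_less_trans ennreal_add_less_top)
qed

text \<open>The cells of these sites fill one half-open cube of side (2m+1)e centred at the origin.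
  It is an exact dilate of the unit cell, so its interaction follows by scaling.\<close>

definition block :: "nat \<Rightarrow> (int ^ 'n) set" where
  "block m = {i. \<forall>k. \<bar>i $ k\<bar> \<le> int m}"

lemma finite_block: "finite (block m :: (int ^ 'n) set)"
proof -
  have "finite (vec_lambda ` (PiE (UNIV :: 'n set) (\<lambda>_. {- int m .. int m})))"
    by (intro finite_imageI finite_PiE) auto
  moreover have "i \<in> vec_lambda ` (PiE (UNIV :: 'n set) (\<lambda>_. {- int m .. int m}))" if "i \<in> block m" for i :: "int ^ 'n"
    using that by (intro image_eqI[of _ _ "vec_nth i"]) (auto simp: block_def abs_le_iff minus_le_iff)
  ultimately show ?thesis by (metis finite_subset subsetI)
qed

lemma cell_affine:
  assumes e: "e > 0"
  shows "cell e (site_pt e i + e *\<^sub>R x) = i \<longleftrightarrow> x \<in> unit_cell"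
proof -
  have "(e * (r - 1/2) \<le> e * r + e * y \<and> e * r + e * y < e * (r + 1/2)) \<longleftrightarrow> (-1/2 \<le> y \<and> y < 1/2)" for r y :: real
  proof -
    have "e * (r - 1/2) \<le> e * r + e * y \<longleftrightarrow> e * (-1/2) \<le> e * y"
      "e * r + e * y < e * (r + 1/2) \<longleftrightarrow> e * y < e * (1/2)"
      unfolding right_diff_distrib distrib_left by linarith+
    then show ?thesis using e by (simp only: mult_le_cancel_left_pos mult_less_cancel_left_pos)
  qed
  then show ?thesis using e by (simp add: cell_eq_iff site_pt_def)
qed

lemma block_affine:
  assumes e: "e > 0"
  shows "cell e (0 + ((2 * real m + 1) * e) *\<^sub>R x) \<in> block m \<longleftrightarrow> x \<in> unit_cell"
proof -
  have "\<bar>\<lfloor>(2 * real m + 1) * e * y / e + 1/2\<rfloor>\<bar> \<le> int m \<longleftrightarrow> (-1/2 \<le> y \<and> y < 1/2)" for y :: real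
  proof -
    have "\<bar>\<lfloor>(2 * real m + 1) * e * y / e + 1/2\<rfloor>\<bar> \<le> int m \<longleftrightarrow>
        - int m \<le> \<lfloor>(2 * real m + 1) * y + 1/2\<rfloor> \<and> \<lfloor>(2 * real m + 1) * y + 1/2\<rfloor> < int m + 1"
      using e by (auto simp: abs_le_iff)
    also have "\<dots> \<longleftrightarrow> - real m \<le> (2 * real m + 1) * y + 1/2 \<and> (2 * real m + 1) * y + 1/2 < real m + 1"
      unfolding le_floor_iff floor_less_iff by simp
    also have "\<dots> \<longleftrightarrow> (2 * real m + 1) * (-1/2) \<le> (2 * real m + 1) * y \<and> (2 * real m + 1) * y < (2 * real m + 1) * (1/2)"
      unfolding distrib_right by linarith
    also have "\<dots> \<longleftrightarrow> (-1/2 \<le> y \<and> y < 1/2)"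
      by (subst mult_le_cancel_left_pos, simp, subst mult_less_cancel_left_pos) simp_all
    finally show ?thesis .
  qed
  then show ?thesis by (simp add: block_def cell_def[of e] cell_eq_iff[of 1])
qed

lemma l1norm_affine: "c > 0 \<Longrightarrow> l1norm ((a + c *\<^sub>R x) - (a + c *\<^sub>R y)) = c * l1norm (x - y)"
  using l1norm_scaleR[of c "x - y"] by (simp add: scaleR_diff_right)

lemma hmeas_cut_cell:
  fixes i :: "int ^ 'n"
  assumes e: "e > 0"
  shows "emeasure (hmeas s) (cutset {x. cell e x = i}) = ennreal (e powr (real CARD('n) - s)) * emeasure (hmeas s) (cutset (unit_cell :: (real ^ 'n) set))"
proof -
  have "cutset {x. cell e x = i} \<in> sets borel" using e by (intro cutset_sets_borel cell_borel_singleton)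
  note emeasure_hmeas_affine[OF e this, of s "site_pt e i"]
  also have "{p. (site_pt e i + e *\<^sub>R fst p, site_pt e i + e *\<^sub>R snd p) \<in> cutset {x. cell e x = i}} = cutset unit_cell"
    by (simp add: cutset_def cell_affine[OF e])
  finally show ?thesis .
qed

text \<open>In the complementary range, from r to 1/r, the kernel is bounded and the partners of a
  bounded set stay in a bounded set. As r tends to 0 these sets shrink to the diagonal.\<close>

definition shortlong :: "real \<Rightarrow> ((real ^ 'n) \<times> (real ^ 'n)) set" where
  "shortlong r = {p. l1norm (fst p - snd p) < r \<or> 1 / r < l1norm (fst p - snd p)}"

lemma shortlong_borel: "shortlong r \<in> sets (borel :: ((real ^ 'n) \<times> (real ^ 'n)) measure)"
proof -
  have "(shortlong r :: ((real ^ 'n) \<times> (real ^ 'n)) set) = (\<lambda>p. l1norm (fst p - snd p)) -` ({..<r} \<union> {1/r<..}) \<inter> space borel"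
    by (auto simp: shortlong_def)
  also have "\<dots> \<in> sets borel"
    by (rule measurable_sets[OF borel_measurable_l1norm_diff]) simp
  finally show ?thesis .
qed

lemma cutset_block_borel: "e > 0 \<Longrightarrow> cutset {x. cell e x \<in> block m} \<in> sets borel"
  by (intro cutset_sets_borel cell_borel)

lemma hmeas_cut_block_affine:
  fixes e s :: real and m :: nat
  assumes e: "e > 0" and B: "B \<in> sets (borel :: ((real ^ 'n) \<times> (real ^ 'n)) measure)"
  defines "c \<equiv> (2 * real m + 1) * e"
  shows "emeasure (hmeas s) (cutset {x :: real ^ 'n. cell e x \<in> block m} \<inter> B) =
    ennreal (c powr (real CARD('n) - s)) * emeasure (hmeas s) (cutset (unit_cell :: (real ^ 'n) set) \<inter> {p. (c *\<^sub>R fst p, c *\<^sub>R snd p) \<in> B})"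
proof -
  have c: "c > 0" unfolding c_def using e by simp
  have "cutset {x :: real ^ 'n. cell e x \<in> block m} \<inter> B \<in> sets borel" using e B by (intro sets.Int cutset_block_borel)
  note emeasure_hmeas_affine[OF c this, of s 0]
  also have "{p. (0 + c *\<^sub>R fst p, 0 + c *\<^sub>R snd p) \<in> cutset {x :: real ^ 'n. cell e x \<in> block m} \<inter> B}
      = cutset (unit_cell :: (real ^ 'n) set) \<inter> {p. (c *\<^sub>R fst p, c *\<^sub>R snd p) \<in> B}"
    using block_affine[OF e, of m] by (auto simp: cutset_def c_def)
  finally show ?thesis .
qed

text \<open>Uniform in e and m, because the block is the dilate of the unit cell by its side c in
  [1, R]. After division by c, short pairs stay short since c \<ge> 1, and long pairs stay long with
  threshold 1/(R r) since c \<le> R.\<close>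

lemma hmeas_cut_block_le:
  fixes e s r R :: real and m :: nat
  assumes s: "0 < s" "s < 1" and e: "e > 0" and r: "r > 0"
    and R: "1 \<le> (2 * real m + 1) * e" "(2 * real m + 1) * e \<le> R"
  shows "emeasure (hmeas s) (cutset {x :: real ^ 'n. cell e x \<in> block m} \<inter> shortlong r) \<le>
      ennreal (R powr (real CARD('n) - s)) * emeasure (hmeas s) (cutset (unit_cell :: (real ^ 'n) set) \<inter> shortlong (R * r))"
    "emeasure (hmeas s) (cutset {x :: real ^ 'n. cell e x \<in> block m}) \<le>
      ennreal (R powr (real CARD('n) - s)) * emeasure (hmeas s) (cutset (unit_cell :: (real ^ 'n) set))"
proof -
  define c where "c = (2 * real m + 1) * e"
  have c: "1 \<le> c" "c \<le> R" using R by (auto simp: c_def)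
  have d: "real CARD('n) \<ge> 1" by (simp add: Suc_le_eq)
  have *: "ennreal (c powr (real CARD('n) - s)) \<le> ennreal (R powr (real CARD('n) - s))"
    using c d s by (intro ennreal_leI powr_mono2) linarith+
  have "{p :: (real ^ 'n) \<times> (real ^ 'n). (c *\<^sub>R fst p, c *\<^sub>R snd p) \<in> shortlong r} \<subseteq> shortlong (R * r)"
  proof
    fix p :: "(real ^ 'n) \<times> (real ^ 'n)"
    assume "p \<in> {p. (c *\<^sub>R fst p, c *\<^sub>R snd p) \<in> shortlong r}"
    then have "c * l1norm (fst p - snd p) < r \<or> 1 / r < c * l1norm (fst p - snd p)"
      using c l1norm_affine[of c 0 "fst p" "snd p"] by (simp add: shortlong_def)
    then show "p \<in> shortlong (R * r)"
    proof
      assume "c * l1norm (fst p - snd p) < r"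
      moreover have "l1norm (fst p - snd p) \<le> c * l1norm (fst p - snd p)"
        using mult_right_mono[OF c(1) l1norm_nonneg] by simp
      moreover have "r \<le> R * r" using c r by simp
      ultimately show ?thesis by (simp add: shortlong_def)
    next
      assume "1 / r < c * l1norm (fst p - snd p)"
      also have "\<dots> \<le> R * l1norm (fst p - snd p)" using c by (intro mult_right_mono) auto
      finally show ?thesis using c r by (simp add: shortlong_def field_simps)
    qed
  qed
  then have "emeasure (hmeas s) (cutset (unit_cell :: (real ^ 'n) set) \<inter> {p. (c *\<^sub>R fst p, c *\<^sub>R snd p) \<in> shortlong r})
      \<le> emeasure (hmeas s) (cutset (unit_cell :: (real ^ 'n) set) \<inter> shortlong (R * r))"
    using unit_cell_cut(1)[OF s, where 'n='n] shortlong_borel[of "R * r", where 'n='n]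
    by (intro emeasure_mono) auto
  with * show "emeasure (hmeas s) (cutset {x :: real ^ 'n. cell e x \<in> block m} \<inter> shortlong r) \<le>
      ennreal (R powr (real CARD('n) - s)) * emeasure (hmeas s) (cutset (unit_cell :: (real ^ 'n) set) \<inter> shortlong (R * r))"
    using hmeas_cut_block_affine[OF e shortlong_borel[where 'n='n], of s m r] c_def by (simp add: mult_mono)
  show "emeasure (hmeas s) (cutset {x :: real ^ 'n. cell e x \<in> block m}) \<le>
      ennreal (R powr (real CARD('n) - s)) * emeasure (hmeas s) (cutset (unit_cell :: (real ^ 'n) set))"
    using hmeas_cut_block_affine[OF e, of "UNIV :: ((real ^ 'n) \<times> (real ^ 'n)) set" s m] c_def * by (simp add: mult_right_mono)
qed

text \<open>Continuity from above inside a set of finite measure: a separated pair has positive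
  distance, so it leaves every \<open>shortlong\<close> set of small parameter.\<close>

lemma hmeas_shortlong_tendsto:
  fixes s :: real
  assumes s: "0 < s" "s < 1" and c: "c > 0"
  shows "(\<lambda>j. emeasure (hmeas s) (cutset (unit_cell :: (real ^ 'n) set) \<inter> shortlong (c / real (Suc j)))) \<longlonglongrightarrow> 0"
proof -
  let ?A = "\<lambda>j. cutset (unit_cell :: (real ^ 'n) set) \<inter> shortlong (c / real (Suc j))"
  note U = unit_cell_cut[OF s, where 'n='n]
  have "decseq ?A"
  proof (rule decseq_SucI)
    fix j
    have "c / real (Suc (Suc j)) \<le> c / real (Suc j)" "1 / (c / real (Suc j)) \<le> 1 / (c / real (Suc (Suc j)))"
      using c by (auto intro!: divide_left_mono divide_right_mono)
    then show "?A (Suc j) \<subseteq> ?A j" unfolding shortlong_def by force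
  qed
  moreover have A: "range ?A \<subseteq> sets (hmeas s)"
    using U(1) shortlong_borel[where 'n='n] by (auto simp: image_subset_iff intro!: sets.Int)
  moreover have "emeasure (hmeas s) (?A j) \<noteq> \<infinity>" for j
    using emeasure_mono[of "?A j" "cutset unit_cell" "hmeas s"] U by (auto simp: top_unique)
  ultimately have lim: "(\<lambda>j. emeasure (hmeas s) (?A j)) \<longlonglongrightarrow> emeasure (hmeas s) (\<Inter>j. ?A j)"
    by (intro Lim_emeasure_decseq)
  have empty: "(\<Inter>j. ?A j) = {}"
  proof (rule ccontr)
    assume "(\<Inter>j. ?A j) \<noteq> {}"
    then obtain p where p: "\<And>j. p \<in> ?A j" by blast
    define l where "l = l1norm (fst p - snd p)"
    have "fst p \<noteq> snd p" using p[of 0] by (auto simp: cutset_def)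
    then have l: "l > 0" by (simp add: l_def less_le)
    obtain j where j: "max (c / l) (c * l) < real j" using reals_Archimedean2 by blast
    then have "c / l < real (Suc j)" "l * c < real (Suc j)" by (auto simp: mult.commute)
    then have "c < l * real (Suc j)" "l * c < real (Suc j)" using l by (simp_all only: pos_divide_less_eq mult.commute)
    then have "\<not> l < c / real (Suc j)" "\<not> 1 / (c / real (Suc j)) < l"
      using c by (simp_all add: not_less pos_divide_le_eq pos_le_divide_eq del: of_nat_Suc)
    with p[of j] show False by (simp add: shortlong_def l_def)
  qed
  show ?thesis using lim unfolding empty emeasure_empty .
qed

subsection \<open>The interaction energy\<close>

definition touch :: "'a set \<Rightarrow> ('a \<times> 'a) set" where
  "touch \<Omega> = {p. fst p \<in> \<Omega> \<or> snd p \<in> \<Omega>}"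

lemma touch_sets_lebesgue:
  fixes \<Omega> :: "'a::euclidean_space set"
  assumes "\<Omega> \<in> sets lebesgue"
  shows "touch \<Omega> \<in> sets lebesgue"
proof -
  have "touch \<Omega> = {p. fst p \<in> \<Omega>} \<union> {p. snd p \<in> \<Omega>}" by (auto simp: touch_def)
  then show ?thesis using lebesgue_vimage_fst[OF assms, where 'b='a] lebesgue_vimage_snd[OF assms, where 'a='a]
    by (simp only: sets.Un)
qed

text \<open>\<open>Ham\<close> sums over an unordered countable index set, while countable
  additivity concerns sequences; the link is that both sides are suprema over finite partial
  unions.\<close>

lemma emeasure_UN_infsum:
  assumes I: "countable I" and X: "\<And>i. i \<in> I \<Longrightarrow> X i \<in> sets M" and disj: "disjoint_family_on X I"
  shows "emeasure M (\<Union>i\<in>I. X i) = (\<Sum>\<^sub>\<infinity>i\<in>I. emeasure M (X i))"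
proof (cases "I = {}")
  case False
  have fin: "(\<Sum>i\<in>F. emeasure M (X i)) = emeasure M (\<Union>i\<in>F. X i)" if "finite F" "F \<subseteq> I" for F
    using that X disj by (intro sum_emeasure) (auto intro: disjoint_family_on_mono)
  have inf: "(\<Sum>\<^sub>\<infinity>i\<in>I. emeasure M (X i)) = (SUP F\<in>{F. finite F \<and> F \<subseteq> I}. (\<Sum>i\<in>F. emeasure M (X i)))"
    by (rule nonneg_infsum_complete) simp
  \<comment> \<open>Images of initial segments are used because the enumeration repeats indices when
    I is finite.\<close>
  let ?F = "\<lambda>n. from_nat_into I ` {..n}"
  have F: "finite (?F n)" "?F n \<subseteq> I" for n using from_nat_into[OF False] by auto
  have UF: "(\<Union>i\<in>I. X i) = (\<Union>n. \<Union>i\<in>?F n. X i)"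
    using from_nat_into_surj[OF I] from_nat_into[OF False] by fastforce
  have "emeasure M (\<Union>i\<in>I. X i) = (SUP n. emeasure M (\<Union>i\<in>?F n. X i))"
    unfolding UF
  proof (rule SUP_emeasure_incseq[symmetric])
    show "range (\<lambda>n. \<Union>i\<in>?F n. X i) \<subseteq> sets M" using X F by (auto intro!: sets.finite_UN)
    show "incseq (\<lambda>n. \<Union>i\<in>?F n. X i)" by (auto simp: incseq_def) (meson atMost_iff order_trans)
  qed
  also have "\<dots> \<le> (\<Sum>\<^sub>\<infinity>i\<in>I. emeasure M (X i))"
    unfolding inf using F by (intro SUP_least) (subst fin[symmetric], auto intro!: SUP_upper)
  finally have le: "emeasure M (\<Union>i\<in>I. X i) \<le> (\<Sum>\<^sub>\<infinity>i\<in>I. emeasure M (X i))" .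
  have "(\<Sum>\<^sub>\<infinity>i\<in>I. emeasure M (X i)) \<le> emeasure M (\<Union>i\<in>I. X i)"
    unfolding inf
  proof (rule SUP_least)
    fix F assume "F \<in> {F. finite F \<and> F \<subseteq> I}"
    then show "(\<Sum>i\<in>F. emeasure M (X i)) \<le> emeasure M (\<Union>i\<in>I. X i)"
      using X I by (subst fin) (auto intro!: emeasure_mono sets.countable_UN')
  qed
  with le show ?thesis by (rule antisym)
qed simp

section \<open>Perimeter and Hamiltonian as values of one measure on pairs\<close>

locale nonlocal_kernel =
  fixes K :: "real ^ 'n \<Rightarrow> real ^ 'n \<Rightarrow> ennreal" and s lam Lam :: real
  assumes kernel: "kernel_K1K2 K s lam Lam"
begin

definition mu :: "((real ^ 'n) \<times> (real ^ 'n)) measure" where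
  "mu = density lebesgue (\<lambda>p. K (fst p) (snd p))"

text \<open>Twice the perimeter: pairs on different sides of the boundary are counted in both orders,
  as in the Hamiltonian.\<close>

definition energy :: "(real ^ 'n) set \<Rightarrow> (real ^ 'n) set \<Rightarrow> ennreal" where
  "energy E \<Omega> = emeasure mu (cutset E \<inter> touch \<Omega>)"

lemma s_pos: "0 < s" and s_less_1: "s < 1" and lam_pos: "0 < lam" and Lam_pos: "0 < Lam"
  using kernel by (auto simp: kernel_K1K2_def)

lemma K_measurable: "(\<lambda>p. K (fst p) (snd p)) \<in> borel_measurable lebesgue"
  using kernel by (simp add: kernel_K1K2_def)

lemma K_bounds: "AE p in lebesgue. ennreal (lam * hker s p) \<le> K (fst p) (snd p) \<and> K (fst p) (snd p) \<le> ennreal (Lam * hker s p)"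
  using kernel by (simp add: kernel_K1K2_def hker_def)

lemma sets_mu [simp]: "sets mu = sets lebesgue" "space mu = UNIV"
  by (auto simp: mu_def)

lemma emeasure_mu: "S \<in> sets lebesgue \<Longrightarrow> emeasure mu S = (\<integral>\<^sup>+ p. K (fst p) (snd p) * indicator S p \<partial>lebesgue)"
  unfolding mu_def using K_measurable by (rule emeasure_density)

lemma LK_eq_mu:
  assumes "A \<in> sets lebesgue" "B \<in> sets lebesgue"
  shows "LK K A B = emeasure mu (A \<times> B)"
  using lebesgue_sets_Times[OF assms] by (simp add: emeasure_mu LK_def mult.commute)

lemma emeasure_mu_eq_AE:
  assumes "AE p in lebesgue. p \<in> A \<longleftrightarrow> p \<in> B" "A \<in> sets lebesgue" "B \<in> sets lebesgue"
  shows "emeasure mu A = emeasure mu B"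
proof (rule emeasure_eq_AE)
  show "AE p in mu. p \<in> A \<longleftrightarrow> p \<in> B"
    unfolding mu_def AE_density[OF K_measurable] using assms(1) by eventually_elim simp
qed (use assms in auto)

lemma mu_le_hmeas:
  assumes "S \<in> sets lebesgue"
  shows "emeasure mu S \<le> ennreal Lam * emeasure (hmeas s) S"
proof -
  have "emeasure mu S \<le> (\<integral>\<^sup>+ p. ennreal Lam * (ennreal (hker s p) * indicator S p) \<partial>lebesgue)"
    unfolding emeasure_mu[OF assms]
  proof (rule nn_integral_mono_AE)
    show "AE p in lebesgue. K (fst p) (snd p) * indicator S p \<le> ennreal Lam * (ennreal (hker s p) * indicator S p)"
      using K_bounds by eventually_elim (use Lam_pos in \<open>auto simp: indicator_def ennreal_mult hker_def\<close>)
  qed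
  also have "\<dots> = ennreal Lam * (\<integral>\<^sup>+ p. (ennreal (hker s p) * indicator S p) \<partial>lebesgue)"
    using assms by (intro nn_integral_cmult borel_measurable_times_ennreal hker_measurable_lebesgue) auto
  also have "(\<integral>\<^sup>+ p. (ennreal (hker s p) * indicator S p) \<partial>lebesgue) = emeasure (hmeas s) S"
    unfolding hmeas_def using assms hker_measurable_lebesgue by (subst emeasure_density) auto
  finally show ?thesis .
qed

lemma mu_le_volume:
  assumes S: "S \<in> sets lebesgue" and a: "0 < a" and l: "\<And>p. p \<in> S \<Longrightarrow> a \<le> l1norm (fst p - snd p)"
  shows "emeasure mu S \<le> ennreal (Lam * a powr (- (real CARD('n) + s))) * emeasure lebesgue S"
proof -
  have "emeasure mu S \<le> (\<integral>\<^sup>+ p. ennreal (Lam * a powr (- (real CARD('n) + s))) * indicator S p \<partial>lebesgue)"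
    unfolding emeasure_mu[OF S]
  proof (rule nn_integral_mono_AE)
    show "AE p in lebesgue. K (fst p) (snd p) * indicator S p \<le> ennreal (Lam * a powr (- (real CARD('n) + s))) * indicator S p"
      using K_bounds
    proof eventually_elim
      case (elim p)
      show ?case
      proof (cases "p \<in> S")
        case True
        have "hker s p \<le> a powr (- (real CARD('n) + s))"
          unfolding hker_def using l[OF True] a s_pos by (intro powr_mono2') auto
        then have "ennreal (Lam * hker s p) \<le> ennreal (Lam * a powr (- (real CARD('n) + s)))"
          using Lam_pos by (intro ennreal_leI mult_left_mono) auto
        with elim True show ?thesis by (auto intro: order_trans simp del: minus_add_distrib)
      qed simp
    qed
  qed
  also have "\<dots> = ennreal (Lam * a powr (- (real CARD('n) + s))) * emeasure lebesgue S"
    using S by (rule nn_integral_cmult_indicator)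
  finally show ?thesis .
qed

text \<open>The points must differ: 0 \<open>powr\<close> anything is 0, so \<open>hker\<close>
  vanishes on the diagonal and gives no lower bound there.\<close>

lemma volume_le_mu:
  assumes S: "S \<in> sets lebesgue" and l: "\<And>p. p \<in> S \<Longrightarrow> fst p \<noteq> snd p \<and> l1norm (fst p - snd p) \<le> b"
  shows "ennreal (lam * b powr (- (real CARD('n) + s))) * emeasure lebesgue S \<le> emeasure mu S"
proof -
  have "ennreal (lam * b powr (- (real CARD('n) + s))) * emeasure lebesgue S
      = (\<integral>\<^sup>+ p. ennreal (lam * b powr (- (real CARD('n) + s))) * indicator S p \<partial>lebesgue)"
    using S by (rule nn_integral_cmult_indicator[symmetric])
  also have "\<dots> \<le> emeasure mu S"
    unfolding emeasure_mu[OF S]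
  proof (rule nn_integral_mono_AE)
    show "AE p in lebesgue. ennreal (lam * b powr (- (real CARD('n) + s))) * indicator S p \<le> K (fst p) (snd p) * indicator S p"
      using K_bounds
    proof eventually_elim
      case (elim p)
      show ?case
      proof (cases "p \<in> S")
        case True
        have "0 < l1norm (fst p - snd p)" using l[OF True] by (simp add: less_le)
        then have "b powr (- (real CARD('n) + s)) \<le> hker s p"
          unfolding hker_def using l[OF True] s_pos by (intro powr_mono2') auto
        then have "ennreal (lam * b powr (- (real CARD('n) + s))) \<le> ennreal (lam * hker s p)"
          using lam_pos by (intro ennreal_leI mult_left_mono) auto
        with elim True show ?thesis by (auto intro: order_trans simp del: minus_add_distrib)
      qed simp
    qed
  qed
  finally show ?thesis .
qed

lemma mu_swap:
  assumes "S \<in> sets lebesgue"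
  shows "emeasure mu {p. prod.swap p \<in> S} = emeasure mu S"
  unfolding mu_def
proof (rule emeasure_density_swap[OF K_measurable _ assms])
  have "AE p in lebesgue. K (fst p) (snd p) = K (snd p) (fst p)"
    using kernel by (simp add: kernel_K1K2_def)
  then show "AE p in lebesgue. K (fst (prod.swap p)) (snd (prod.swap p)) = K (fst p) (snd p)"
    by eventually_elim simp
qed

lemma cut_touch_sets:
  "E \<in> sets lebesgue \<Longrightarrow> \<Omega> \<in> sets lebesgue \<Longrightarrow> cutset E \<inter> touch \<Omega> \<in> sets lebesgue"
  by (intro sets.Int cutset_sets_lebesgue touch_sets_lebesgue)

lemma energy_mono:
  "E \<in> sets lebesgue \<Longrightarrow> \<Omega>' \<in> sets lebesgue \<Longrightarrow> \<Omega> \<subseteq> \<Omega>' \<Longrightarrow> energy E \<Omega> \<le> energy E \<Omega>'"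
  unfolding energy_def by (intro emeasure_mono) (auto simp: touch_def cut_touch_sets[unfolded touch_def])

text \<open>The three products in \<open>PerK\<close> list, without overlap, the separated pairs
  touching \<Omega> whose first point lies in E. The remaining pairs are their swaps, which have the
  same measure by (K1).\<close>

lemma energy_eq_PerK:
  assumes E: "E \<in> sets lebesgue" and O: "\<Omega> \<in> sets lebesgue"
  shows "energy E \<Omega> = 2 * PerK K E \<Omega>"
proof -
  have EO: "E \<inter> \<Omega> \<in> sets lebesgue" "\<Omega> - E \<in> sets lebesgue" "E - \<Omega> \<in> sets lebesgue"
    using E O by auto
  have EO': "UNIV - (E \<union> \<Omega>) \<in> sets lebesgue" using sets.compl_sets[of "E \<union> \<Omega>" lebesgue] E O by auto
  let ?A = "(E \<inter> \<Omega>) \<times> (\<Omega> - E)" and ?B = "(E \<inter> \<Omega>) \<times> (UNIV - (E \<union> \<Omega>))" and ?C = "(E - \<Omega>) \<times> (\<Omega> - E)"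
  let ?S = "(?A \<union> ?B) \<union> ?C"
  have ABC: "?A \<in> sets lebesgue" "?B \<in> sets lebesgue" "?C \<in> sets lebesgue"
    using EO EO' by (auto intro!: lebesgue_sets_Times)
  then have S: "?S \<in> sets lebesgue" by (intro sets.Un)
  have Per: "PerK K E \<Omega> = emeasure mu ?S"
  proof -
    have "emeasure mu ?S = emeasure mu (?A \<union> ?B) + emeasure mu ?C"
      by (rule plus_emeasure[symmetric]) (use ABC in auto)
    also have "emeasure mu (?A \<union> ?B) = emeasure mu ?A + emeasure mu ?B"
      by (rule plus_emeasure[symmetric]) (use ABC in auto)
    finally show ?thesis using EO EO' by (simp add: PerK_def LK_eq_mu)
  qed
  have "cutset E \<inter> touch \<Omega> = ?S \<union> {p. prod.swap p \<in> ?S}"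
    by (auto simp: cutset_def touch_def)
  then have "energy E \<Omega> = emeasure mu (?S \<union> {p. prod.swap p \<in> ?S})" by (simp only: energy_def)
  also have "\<dots> = emeasure mu ?S + emeasure mu {p. prod.swap p \<in> ?S}"
    using S lebesgue_vimage_swap[OF S] by (intro plus_emeasure[symmetric]) auto
  also have "\<dots> = 2 * PerK K E \<Omega>" by (simp only: mu_swap[OF S] Per mult_2)
  finally show ?thesis .
qed

lemma LK_cubes_eq_cells:
  assumes e: "e > 0"
  shows "LK K (cubeQ (e / 2) (site_pt e i)) (cubeQ (e / 2) (site_pt e j)) = emeasure mu ({x. cell e x = i} \<times> {x. cell e x = j})"
proof -
  have c: "cubeQ (e / 2) (site_pt e i) \<in> sets lebesgue" for i :: "int ^ 'n" using e emeasure_cubeQ(3)[of "e / 2" "site_pt e i"] by auto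
  have C: "{x. cell e x = i} \<in> sets lebesgue" for i :: "int ^ 'n" using e cell_borel_singleton[of e i] by auto
  have AE: "AE x in lebesgue. x \<in> cubeQ (e / 2) (site_pt e i) \<longleftrightarrow> x \<in> {x. cell e x = i}" for i :: "int ^ 'n"
    using AE_cubeQ_iff_cell[OF e, of i] by eventually_elim (use cell_between_cubes[OF e, of i] in auto)
  show ?thesis
    unfolding LK_eq_mu[OF c c]
  proof (rule emeasure_mu_eq_AE)
    show "AE p in lebesgue. p \<in> cubeQ (e / 2) (site_pt e i) \<times> cubeQ (e / 2) (site_pt e j) \<longleftrightarrow> p \<in> {x. cell e x = i} \<times> {x. cell e x = j}"
      using AE_lebesgue_fst[OF AE[of i], where 'b="real ^ 'n"] AE_lebesgue_snd[OF AE[of j], where 'a="real ^ 'n"]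
      by eventually_elim (auto simp: mem_Times_iff)
  qed (use c C in \<open>auto intro!: lebesgue_sets_Times\<close>)
qed

text \<open>The factor 1 - u_i u_j is 2 for sites with different values and 0 otherwise, and the
  disjoint products of the cells of such sites make up the set of separated pairs exactly.\<close>

lemma Ham_eq_energy:
  fixes u :: "int ^ 'n \<Rightarrow> int"
  assumes e: "e > 0" and u: "config u"
  shows "Ham K s e \<Gamma> u = ennreal (2 * e powr (- real CARD('n) + s)) * energy {x. u (cell e x) = 1} {x. cell e x \<in> \<Gamma>}"
proof -
  let ?c = "ennreal (2 * e powr (- real CARD('n) + s))"
  let ?I = "UNIV - (UNIV - \<Gamma>) \<times> (UNIV - \<Gamma>)"
  let ?I' = "{p \<in> ?I. u (fst p) \<noteq> u (snd p)}"
  let ?X = "\<lambda>p. {x. cell e x = fst p} \<times> {x. cell e x = snd p}"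
  \<comment> \<open>The prefactor is absorbed into the measure, so that the infinite sum is a single
    application of additivity.\<close>
  let ?M = "scale_measure ?c mu"
  have C: "{x. cell e x = i} \<in> sets lebesgue" for i :: "int ^ 'n" using e cell_borel_singleton[of e i] by auto
  have X: "?X p \<in> sets lebesgue" for p :: "(int ^ 'n) \<times> (int ^ 'n)" by (intro lebesgue_sets_Times C)
  have pm: "u i = 1 \<or> u i = -1" for i using u by (auto simp: config_def)
  have tm: "Jcoup K s e (fst p) (snd p) * ennreal (real_of_int (1 - u (fst p) * u (snd p))) = emeasure ?M (?X p)"
    if "u (fst p) \<noteq> u (snd p)" for p
  proof -
    have "fst p \<noteq> snd p" using that by auto
    moreover have "1 - u (fst p) * u (snd p) = 2" using that pm[of "fst p"] pm[of "snd p"] by auto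
    moreover have "?c = ennreal (e powr (- real CARD('n) + s)) * 2"
      by (simp add: ennreal_mult mult.commute)
    ultimately show ?thesis
      by (simp add: Jcoup_def LK_cubes_eq_cells[OF e] mult_ac)
  qed
  have tm0: "Jcoup K s e (fst p) (snd p) * ennreal (real_of_int (1 - u (fst p) * u (snd p))) = 0"
    if "u (fst p) = u (snd p)" for p
    using that pm[of "fst p"] by auto
  have "Ham K s e \<Gamma> u = (\<Sum>\<^sub>\<infinity>p\<in>?I'. emeasure ?M (?X p))"
    unfolding Ham_def
  proof (rule infsum_cong_neutral)
    fix p assume "p \<in> ?I - ?I'"
    then have "u (fst p) = u (snd p)" by blast
    then show "Jcoup K s e (fst p) (snd p) * ennreal (real_of_int (1 - u (fst p) * u (snd p))) = 0" by (rule tm0)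
  next
    fix p assume "p \<in> ?I \<inter> ?I'"
    then have "u (fst p) \<noteq> u (snd p)" by blast
    then show "Jcoup K s e (fst p) (snd p) * ennreal (real_of_int (1 - u (fst p) * u (snd p))) = emeasure ?M (?X p)" by (rule tm)
  qed blast
  also have "\<dots> = emeasure ?M (\<Union>p\<in>?I'. ?X p)"
  proof (rule emeasure_UN_infsum[symmetric])
    have "countable (UNIV \<times> UNIV :: ((int ^ 'n) \<times> (int ^ 'n)) set)"
      by (intro countable_SIGMA countable_int_vec)
    then show "countable ?I'" by (rule countable_subset[rotated]) auto
    show "?X p \<in> sets ?M" for p using X by simp
    show "disjoint_family_on ?X ?I'" by (auto simp: disjoint_family_on_def)
  qed
  also have "(\<Union>p\<in>?I'. ?X p) = cutset {x. u (cell e x) = 1} \<inter> touch {x. cell e x \<in> \<Gamma>}"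
  proof (intro set_eqI iffI)
    fix p assume "p \<in> (\<Union>p\<in>?I'. ?X p)"
    then show "p \<in> cutset {x. u (cell e x) = 1} \<inter> touch {x. cell e x \<in> \<Gamma>}"
      using pm[of "cell e (fst p)"] pm[of "cell e (snd p)"] by (auto simp: cutset_def touch_def)
  next
    fix p assume "p \<in> cutset {x. u (cell e x) = 1} \<inter> touch {x. cell e x \<in> \<Gamma>}"
    then have "(cell e (fst p), cell e (snd p)) \<in> ?I'" by (auto simp: cutset_def touch_def)
    then show "p \<in> (\<Union>p\<in>?I'. ?X p)" by (rule UN_I) (simp add: mem_Times_iff)
  qed
  finally show ?thesis by (simp add: energy_def)
qed

lemma ground_state_energy_le:
  fixes u v :: "int ^ 'n \<Rightarrow> int"
  assumes e: "e > 0" and u: "ground_state K s e u" and v: "config v" "\<And>i. i \<notin> \<Gamma> \<Longrightarrow> v i = u i" and \<Gamma>: "finite \<Gamma>"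
  shows "energy {x. u (cell e x) = 1} {x. cell e x \<in> \<Gamma>} \<le> energy {x. v (cell e x) = 1} {x. cell e x \<in> \<Gamma>}"
proof -
  let ?c = "2 * e powr (- real CARD('n) + s)"
  have "config u" using u by (simp add: ground_state_def)
  have "Ham K s e \<Gamma> u \<le> Ham K s e \<Gamma> v"
    using u v \<Gamma> by (simp add: ground_state_def Ham_minimizer_def)
  then have "ennreal ?c * energy {x. u (cell e x) = 1} {x. cell e x \<in> \<Gamma>} \<le> ennreal ?c * energy {x. v (cell e x) = 1} {x. cell e x \<in> \<Gamma>}"
    using Ham_eq_energy[OF e] \<open>config u\<close> v(1) by simp
  \<comment> \<open>Multiplying by the reciprocal cancels the positive factor even when the energies
    are infinite.\<close>
  then have "ennreal (1 / ?c) * (ennreal ?c * energy {x. u (cell e x) = 1} {x. cell e x \<in> \<Gamma>})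
      \<le> ennreal (1 / ?c) * (ennreal ?c * energy {x. v (cell e x) = 1} {x. cell e x \<in> \<Gamma>})"
    by (rule mult_left_mono) simp
  moreover have "ennreal (1 / ?c) * (ennreal ?c * a) = a" for a
    using e by (subst mult.assoc[symmetric], subst ennreal_mult[symmetric]) auto
  ultimately show ?thesis by simp
qed

end

subsection \<open>Energy estimates on lattice cells\<close>

lemma cell_lebesgue: "e > 0 \<Longrightarrow> {x :: real ^ 'n. cell e x \<in> S} \<in> sets lebesgue"
  using cell_borel[of e S] by auto

lemma cell_lebesgue_singleton: "e > 0 \<Longrightarrow> {x :: real ^ 'n. cell e x = i} \<in> sets lebesgue"
  using cell_borel_singleton[of e i] by auto

lemma cubeQ_lebesgue: "r \<ge> 0 \<Longrightarrow> cubeQ r (x :: real ^ 'n) \<in> sets lebesgue"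
  using emeasure_cubeQ(3)[of r x] by auto

lemma cubeQ_mono: "r \<le> r' \<Longrightarrow> cubeQ r x \<subseteq> cubeQ r' x"
  unfolding cubeQ_def by (auto intro: order_trans)

lemma measure_cell:
  fixes i :: "int ^ 'n"
  assumes e: "e > 0"
  shows "{x. cell e x = i} \<in> lmeasurable" "measure lebesgue {x. cell e x = i} = e ^ CARD('n)"
proof -
  have "emeasure lebesgue {x. cell e x = i} = ennreal (e ^ CARD('n))"
    using emeasure_cell[OF e, of i] cell_borel_singleton[OF e, of i] by simp
  then show "{x. cell e x = i} \<in> lmeasurable" "measure lebesgue {x. cell e x = i} = e ^ CARD('n)"
    using e cell_lebesgue_singleton[OF e, of i] by (auto simp: measure_def intro!: fmeasurableI)
qed

text \<open>Rounding R/e up makes the block cover the cube, with an excess of at most two cells on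
  each side. For e < 1 this is the origin of the radii R + 2 and the sides 2R + 3 below.\<close>

lemma block_cube_bounds:
  fixes e R :: real
  assumes e: "e > 0" and R: "R \<ge> 0"
  defines "m \<equiv> nat \<lceil>R / e\<rceil>"
  shows "cubeQ R 0 \<subseteq> {x :: real ^ 'n. cell e x \<in> block m}"
    "{x :: real ^ 'n. cell e x \<in> block m} \<subseteq> cubeQ (R + 2 * e) 0"
    "2 * R \<le> (2 * real m + 1) * e" "(2 * real m + 1) * e \<le> 2 * R + 3 * e"
proof -
  have m: "R / e \<le> real m" "real m \<le> R / e + 1" using e R by (auto simp: m_def)
  then have m': "R \<le> real m * e" "real m * e \<le> R + e" using e by (auto simp: field_simps)
  show "2 * R \<le> (2 * real m + 1) * e" "(2 * real m + 1) * e \<le> 2 * R + 3 * e"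
    using m' e by (auto simp: algebra_simps)
  show "cubeQ R 0 \<subseteq> {x :: real ^ 'n. cell e x \<in> block m}"
  proof
    fix x :: "real ^ 'n" assume "x \<in> cubeQ R 0"
    then have x: "\<bar>x $ k\<bar> \<le> R" for k by (simp add: cubeQ_def)
    have "\<bar>\<lfloor>x $ k / e + 1 / 2\<rfloor>\<bar> \<le> int m" for k
    proof -
      have "x $ k / e \<le> R / e" "- R / e \<le> x $ k / e"
        using x[of k] e by (auto simp: abs_le_iff field_simps)
      with m show ?thesis by linarith
    qed
    then show "x \<in> {x. cell e x \<in> block m}" by (simp add: cell_def block_def)
  qed
  show "{x :: real ^ 'n. cell e x \<in> block m} \<subseteq> cubeQ (R + 2 * e) 0"
  proof
    fix x :: "real ^ 'n" assume x: "x \<in> {x. cell e x \<in> block m}"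
    have "\<bar>x $ k\<bar> \<le> R + 2 * e" for k
    proof -
      have "\<bar>\<lfloor>x $ k / e + 1 / 2\<rfloor>\<bar> \<le> int m" using x by (simp add: cell_def block_def)
      then have "\<bar>x $ k / e\<bar> \<le> real m + 1" by linarith
      then have "\<bar>x $ k\<bar> \<le> (real m + 1) * e" using e by (simp add: field_simps)
      then show ?thesis using m' e by (simp add: distrib_right)
    qed
    then show "x \<in> cubeQ (R + 2 * e) 0" by (simp add: cubeQ_def)
  qed
qed

section \<open>Local energy bound, fractional Poincare inequality and interaction of cell
  pairs\<close>

context nonlocal_kernel
begin

definition H0 :: ennreal where
  "H0 = emeasure (hmeas s) (cutset (unit_cell :: (real ^ 'n) set))"

lemma H0_finite: "H0 < \<infinity>"
  unfolding H0_def by (rule unit_cell_cut(2)[OF s_pos s_less_1])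

lemma ground_state_energy_block:
  fixes u :: "int ^ 'n \<Rightarrow> int"
  assumes e: "e > 0" and u: "ground_state K s e u"
    and R: "1 \<le> (2 * real m + 1) * e" "(2 * real m + 1) * e \<le> R"
  shows "energy {x. u (cell e x) = 1} {x. cell e x \<in> block m} \<le> ennreal Lam * (ennreal (R powr (real CARD('n) - s)) * H0)"
proof -
  let ?Q = "{x :: real ^ 'n. cell e x \<in> block m}"
  let ?v = "\<lambda>i. if i \<in> block m then -1 else u i"
  have "config u" using u by (simp add: ground_state_def)
  then have "config ?v" by (simp add: config_def)
  then have "energy {x. u (cell e x) = 1} ?Q \<le> energy {x. ?v (cell e x) = 1} ?Q"
    by (intro ground_state_energy_le[OF e u _ _ finite_block]) auto
  \<comment> \<open>The competitor has no phase in \<open>?Q\<close>, so a pair that it separates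
    and that meets \<open>?Q\<close> has exactly one point there.\<close>
  also have "\<dots> \<le> emeasure mu (cutset ?Q)"
    unfolding energy_def using e
      cutset_sets_lebesgue[OF cell_lebesgue[OF e, of "block m"]]
    by (intro emeasure_mono) (auto simp: cutset_def touch_def split: if_splits)
  also have "\<dots> \<le> ennreal Lam * emeasure (hmeas s) (cutset ?Q)"
    using e by (intro mu_le_hmeas cutset_sets_lebesgue cell_lebesgue)
  also have "\<dots> \<le> ennreal Lam * (ennreal (R powr (real CARD('n) - s)) * H0)"
    unfolding H0_def using hmeas_cut_block_le(2)[OF s_pos s_less_1 e zero_less_one R, where 'n='n] by (intro mult_left_mono) auto
  finally show ?thesis .
qed

lemma ground_state_energy_cube:
  fixes u :: "int ^ 'n \<Rightarrow> int"
  assumes e: "0 < e" "e < 1" and u: "ground_state K s e u" and R: "R \<ge> 1"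
  shows "energy {x. u (cell e x) = 1} (cubeQ R 0) \<le> ennreal Lam * (ennreal ((2 * R + 3) powr (real CARD('n) - s)) * H0)"
proof -
  let ?m = "nat \<lceil>R / e\<rceil>"
  have "R \<ge> 0" using R by simp
  note b = block_cube_bounds[OF e(1) this]
  have "energy {x. u (cell e x) = 1} (cubeQ R 0) \<le> energy {x. u (cell e x) = 1} {x. cell e x \<in> block ?m}"
    using e b(1) cell_lebesgue[OF e(1), of "{i. u i = 1}"] by (intro energy_mono cell_lebesgue) auto
  also have "\<dots> \<le> ennreal Lam * (ennreal ((2 * R + 3) powr (real CARD('n) - s)) * H0)"
    using b(3,4) e R by (intro ground_state_energy_block u) auto
  finally show ?thesis .
qed

text \<open>Two points of a cell are at l1 distance at most d e, which gives the lower kernel bound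
  lam (d e)^(-d-s). The factor 2 appears because the larger of the two parts of a cell fills at
  least half of it.\<close>

definition poincare_const :: real where
  "poincare_const = 2 * real CARD('n) powr (real CARD('n) + s) / lam"

text \<open>The smaller part measures how far the indicator of F is from being constant on the cell.
  Multiplied by half the cell volume it is at most the product of the two parts, which is the volume
  of the pairs separated within the cell.\<close>

lemma poincare_cell:
  fixes i :: "int ^ 'n"
  assumes e: "e > 0" and F: "F \<in> sets lebesgue"
  defines "C \<equiv> {x. cell e x = i}"
  shows "ennreal (min (measure lebesgue (F \<inter> C)) (measure lebesgue (C - F)))
    \<le> ennreal (poincare_const * e powr s) * emeasure mu ((F \<inter> C) \<times> (C - F))"
proof -
  let ?d = "real CARD('n)"
  have C: "C \<in> lmeasurable" "measure lebesgue C = e ^ CARD('n)" using measure_cell[OF e, of i] by (auto simp: C_def)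
  then have m: "F \<inter> C \<in> lmeasurable" "C - F \<in> lmeasurable" using F fmeasurableD[OF C(1)] by (auto intro!: fmeasurableI2[OF C(1)])
  define a b where "a = measure lebesgue (F \<inter> C)" and "b = measure lebesgue (C - F)"
  have "measure lebesgue ((F \<inter> C) \<union> (C - F)) = a + b"
    unfolding a_def b_def
    by (rule measure_Union) (use m fmeasurableD2[OF m(1)] fmeasurableD2[OF m(2)] in auto)
  moreover have "(F \<inter> C) \<union> (C - F) = C" by auto
  ultimately have ab: "a + b = e ^ CARD('n)" using C(2) by (simp only:)
  have nn: "a \<ge> 0" "b \<ge> 0" by (auto simp: a_def b_def)
  have v: "e ^ CARD('n) > 0" using e by simp
  have "e ^ CARD('n) / 2 \<le> max a b" using ab by linarith
  then have "min a b * (e ^ CARD('n) / 2) \<le> min a b * max a b" using nn by (intro mult_left_mono) auto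
  also have "\<dots> = a * b" by (auto simp: min_def max_def)
  finally have mab: "min a b \<le> 2 / e ^ CARD('n) * (a * b)" using v by (simp add: field_simps)
  let ?S = "(F \<inter> C) \<times> (C - F)"
  have S: "?S \<in> sets lebesgue" using m by (intro lebesgue_sets_Times) auto
  have eS: "emeasure lebesgue ?S = ennreal (a * b)"
    using m nn by (subst emeasure_lebesgue_Times) (auto simp: a_def b_def emeasure_eq_measure2 ennreal_mult)
  have "ennreal (lam * (?d * e) powr (- (?d + s))) * emeasure lebesgue ?S \<le> emeasure mu ?S"
  proof (rule volume_le_mu[OF S])
    fix p assume "p \<in> ?S"
    then show "fst p \<noteq> snd p \<and> l1norm (fst p - snd p) \<le> ?d * e"
      using l1norm_same_cell[OF e, of "fst p" "snd p"] by (auto simp: C_def)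
  qed
  then have le: "ennreal (lam * (?d * e) powr (- (?d + s)) * (a * b)) \<le> emeasure mu ?S"
    using lam_pos nn by (simp add: eS ennreal_mult)
  have const: "poincare_const * e powr s * (lam * (?d * e) powr (- (?d + s)) * (a * b)) = 2 / e ^ CARD('n) * (a * b)"
  proof -
    have "(?d * e) powr (- (?d + s)) = ?d powr (- (?d + s)) * e powr (- (?d + s))"
      using e by (simp add: powr_mult)
    moreover have "?d powr (?d + s) * ?d powr (- (?d + s)) = 1" by (simp add: powr_add[symmetric])
    moreover have "e powr s * e powr (- (?d + s)) = 1 / e ^ CARD('n)"
      using e by (simp add: powr_add[symmetric] powr_minus powr_realpow divide_inverse)
    moreover have "?d powr (?d + s) * e powr s * (?d powr (- (?d + s)) * e powr (- (?d + s)))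
        = (?d powr (?d + s) * ?d powr (- (?d + s))) * (e powr s * e powr (- (?d + s)))"
      by (simp only: mult_ac)
    ultimately have *: "?d powr (?d + s) * e powr s * (?d * e) powr (- (?d + s)) = 1 / e ^ CARD('n)"
      by (simp only: mult_1)
    have "poincare_const * e powr s * (lam * (?d * e) powr (- (?d + s)) * (a * b))
        = 2 * (?d powr (?d + s) * e powr s * (?d * e) powr (- (?d + s))) * (a * b)"
      using lam_pos by (simp add: poincare_const_def del: minus_add_distrib)
    then show ?thesis unfolding * by simp
  qed
  have "ennreal (min a b) \<le> ennreal (poincare_const * e powr s * (lam * (?d * e) powr (- (?d + s)) * (a * b)))"
    unfolding const by (rule ennreal_leI[OF mab])
  also have "\<dots> = ennreal (poincare_const * e powr s) * ennreal (lam * (?d * e) powr (- (?d + s)) * (a * b))"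
    using lam_pos nn by (intro ennreal_mult) (auto simp: poincare_const_def)
  also have "\<dots> \<le> ennreal (poincare_const * e powr s) * emeasure mu ?S"
    by (intro mult_left_mono le) simp
  finally show ?thesis by (simp add: a_def b_def)
qed

text \<open>The pairs used in different cells are disjoint parts of the cutset, so the cellwise
  bounds add up. The factor e^s is the smallness exploited both for compactness and for the
  discretization of competitors.\<close>

lemma poincare_sum:
  fixes I :: "(int ^ 'n) set"
  assumes e: "e > 0" and F: "F \<in> sets lebesgue" and I: "finite I"
    and O: "\<Omega> \<in> sets lebesgue" "{x. cell e x \<in> I} \<subseteq> \<Omega>"
  shows "ennreal (\<Sum>i\<in>I. min (measure lebesgue (F \<inter> {x. cell e x = i})) (measure lebesgue ({x. cell e x = i} - F)))
    \<le> ennreal (poincare_const * e powr s) * energy F \<Omega>"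
proof -
  let ?X = "\<lambda>i. (F \<inter> {x. cell e x = i}) \<times> ({x. cell e x = i} - F)"
  have X: "?X i \<in> sets lebesgue" for i
    using F cell_lebesgue_singleton[OF e, of i] by (intro lebesgue_sets_Times) auto
  have "ennreal (\<Sum>i\<in>I. min (measure lebesgue (F \<inter> {x. cell e x = i})) (measure lebesgue ({x. cell e x = i} - F)))
      = (\<Sum>i\<in>I. ennreal (min (measure lebesgue (F \<inter> {x. cell e x = i})) (measure lebesgue ({x. cell e x = i} - F))))"
    by (intro sum_ennreal[symmetric]) auto
  also have "\<dots> \<le> (\<Sum>i\<in>I. ennreal (poincare_const * e powr s) * emeasure mu (?X i))"
    by (intro sum_mono poincare_cell e F)
  also have "\<dots> = ennreal (poincare_const * e powr s) * emeasure mu (\<Union>i\<in>I. ?X i)"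
    unfolding sum_distrib_left[symmetric] using X I
    by (subst sum_emeasure) (auto simp: disjoint_family_on_def)
  also have "\<dots> \<le> ennreal (poincare_const * e powr s) * energy F \<Omega>"
    unfolding energy_def using cut_touch_sets[OF F O(1)] O(2)
    by (intro mult_left_mono emeasure_mono) (auto simp: cutset_def touch_def)
  finally show ?thesis .
qed

text \<open>The summands belong to near and to distant cells in \<open>cell_pair_le\<close>. The 4
  undoes the two factors 1/2 of the majority rule; 3d and 3 are the ratios of the largest distance
  between points of the cells to the length used in the upper bound (e and half the distance of the
  centres).\<close>

definition pair_const :: real where
  "pair_const = 4 * Lam * enn2real H0 * (3 * real CARD('n)) powr (real CARD('n) + s) / lam
     + 4 * Lam * 3 powr (real CARD('n) + s) / lam"

lemma l1norm_cells:
  fixes x y :: "real ^ 'n"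
  assumes e: "e > 0"
  shows "\<bar>l1norm (x - y) - l1norm (site_pt e (cell e x) - site_pt e (cell e y))\<bar> \<le> real CARD('n) * e"
proof -
  let ?a = "site_pt e (cell e x)" and ?b = "site_pt e (cell e y)"
  have 1: "l1norm (x - y) \<le> l1norm (x - ?a) + (l1norm (?a - ?b) + l1norm (?b - y))"
    using l1norm_triangle[of "x - ?a" "(?a - ?b) + (?b - y)"] l1norm_triangle[of "?a - ?b" "?b - y"] by simp
  have 2: "l1norm (?a - ?b) \<le> l1norm (?a - x) + (l1norm (x - y) + l1norm (y - ?b))"
    using l1norm_triangle[of "?a - x" "(x - y) + (y - ?b)"] l1norm_triangle[of "x - y" "y - ?b"] by simp
  have "l1norm (x - ?a) \<le> real CARD('n) * (e / 2)" "l1norm (y - ?b) \<le> real CARD('n) * (e / 2)"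
    by (rule l1norm_cell_site[OF e])+
  with 1 2 show ?thesis
    unfolding l1norm_minus_commute[of ?b y] l1norm_minus_commute[of ?a x] by (simp add: abs_le_iff)
qed

text \<open>A cell pair that the majority rule separates already carries a fixed fraction of its
  full interaction in the original set.\<close>

lemma cell_pair_le:
  fixes i j :: "int ^ 'n"
  assumes e: "e > 0" and ij: "i \<noteq> j"
    and A: "A \<in> sets lebesgue" "A \<subseteq> {x. cell e x = i}" "e ^ CARD('n) / 2 \<le> measure lebesgue A"
    and B: "B \<in> sets lebesgue" "B \<subseteq> {x. cell e x = j}" "e ^ CARD('n) / 2 \<le> measure lebesgue B"
  shows "emeasure mu ({x. cell e x = i} \<times> {x. cell e x = j}) \<le> ennreal pair_const * emeasure mu (A \<times> B)"
proof -
  let ?d = "real CARD('n)" and ?C = "\<lambda>i. {x. cell e x = i}"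
  let ?v = "e ^ CARD('n)" and ?\<rho> = "l1norm (site_pt e i - site_pt e j)"
  define h0 where "h0 = enn2real H0"
  have h0: "H0 = ennreal h0" "h0 \<ge> 0" using H0_finite by (auto simp: h0_def)
  have d: "?d \<ge> 1" by (simp add: Suc_le_eq)
  have AB: "A \<times> B \<in> sets lebesgue" using A B by (intro lebesgue_sets_Times)
  have CC: "?C i \<times> ?C j \<in> sets lebesgue" by (intro lebesgue_sets_Times cell_lebesgue_singleton e)
  have Am: "A \<in> lmeasurable" "B \<in> lmeasurable"
    using A B measure_cell(1)[OF e] by (auto intro: fmeasurableI2)
  have "emeasure lebesgue (A \<times> B) = ennreal (measure lebesgue A * measure lebesgue B)"
    using A B Am by (subst emeasure_lebesgue_Times) (auto simp: emeasure_eq_measure2 ennreal_mult)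
  moreover have "?v / 2 * (?v / 2) \<le> measure lebesgue A * measure lebesgue B"
    using A(3) B(3) e by (intro mult_mono) auto
  ultimately have volAB: "ennreal (?v * ?v / 4) \<le> emeasure lebesgue (A \<times> B)" by (simp add: ennreal_leI)
  have volCC: "emeasure lebesgue (?C i \<times> ?C j) = ennreal (?v * ?v)"
    using measure_cell[OF e, of i] measure_cell[OF e, of j] e by (subst emeasure_lebesgue_Times) (auto simp: emeasure_eq_measure2 ennreal_mult)
  have dist: "\<bar>l1norm (fst p - snd p) - ?\<rho>\<bar> \<le> ?d * e" if "p \<in> ?C i \<times> ?C j" for p
    using l1norm_cells[OF e, of "fst p" "snd p"] that by (auto simp: mem_Times_iff)
  have lower: "ennreal (lam * b powr (- (?d + s)) * (?v * ?v / 4)) \<le> emeasure mu (A \<times> B)"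
    if "\<And>p. p \<in> ?C i \<times> ?C j \<Longrightarrow> l1norm (fst p - snd p) \<le> b" for b
  proof -
    have "ennreal (lam * b powr (- (?d + s)) * (?v * ?v / 4)) = ennreal (lam * b powr (- (?d + s))) * ennreal (?v * ?v / 4)"
      using lam_pos e by (intro ennreal_mult) auto
    also have "\<dots> \<le> ennreal (lam * b powr (- (?d + s))) * emeasure lebesgue (A \<times> B)"
      by (intro mult_left_mono volAB) simp
    also have "\<dots> \<le> emeasure mu (A \<times> B)"
    proof (rule volume_le_mu[OF AB])
      fix p assume "p \<in> A \<times> B"
      then have "p \<in> ?C i \<times> ?C j" using A(2) B(2) by auto
      then show "fst p \<noteq> snd p \<and> l1norm (fst p - snd p) \<le> b" using that[of p] ij by auto
    qed
    finally show ?thesis .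
  qed
  have final: ?thesis if up: "emeasure mu (?C i \<times> ?C j) \<le> ennreal z" and z: "z \<le> pair_const * (lam * b powr (- (?d + s)) * (?v * ?v / 4))"
    and b: "\<And>p. p \<in> ?C i \<times> ?C j \<Longrightarrow> l1norm (fst p - snd p) \<le> b" for z b
  proof -
    have "emeasure mu (?C i \<times> ?C j) \<le> ennreal (pair_const * (lam * b powr (- (?d + s)) * (?v * ?v / 4)))"
      using up ennreal_leI[OF z] by (rule order_trans)
    also have "\<dots> = ennreal pair_const * ennreal (lam * b powr (- (?d + s)) * (?v * ?v / 4))"
      using lam_pos Lam_pos e by (intro ennreal_mult) (auto simp: pair_const_def)
    also have "\<dots> \<le> ennreal pair_const * emeasure mu (A \<times> B)" by (intro mult_left_mono lower b) auto
    finally show ?thesis .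
  qed
  have v: "?v = e powr ?d" using e by (simp add: powr_realpow)
  show ?thesis
  proof (cases "?\<rho> < 2 * ?d * e")
    \<comment> \<open>Near cells: the kernel may be unbounded on their product, so the interaction
      is estimated by that of one cell with its complement, which scales like e^(d-s). All distances
      are at most 3 d e, so the lower bound scales in the same way.\<close>
    case True
    have "emeasure mu (?C i \<times> ?C j) \<le> ennreal Lam * emeasure (hmeas s) (?C i \<times> ?C j)"
      by (rule mu_le_hmeas[OF CC])
    also have "\<dots> \<le> ennreal Lam * emeasure (hmeas s) (cutset (?C i))"
      using ij cutset_sets_lebesgue[OF cell_lebesgue_singleton[OF e, of i]]
      by (intro mult_left_mono emeasure_mono) (auto simp: cutset_def)
    also have "\<dots> = ennreal (Lam * (e powr (?d - s) * h0))"
      using hmeas_cut_cell[OF e, of s i] h0 Lam_pos by (simp add: H0_def[symmetric] ennreal_mult)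
    finally have up: "emeasure mu (?C i \<times> ?C j) \<le> ennreal (Lam * (e powr (?d - s) * h0))" .
    show ?thesis
    proof (rule final[OF up])
      show "l1norm (fst p - snd p) \<le> 3 * ?d * e" if "p \<in> ?C i \<times> ?C j" for p
        using dist[OF that] True by simp
      have "(3 * ?d * e) powr (- (?d + s)) = (3 * ?d) powr (- (?d + s)) * e powr (- (?d + s))"
        using e by (simp add: powr_mult)
      moreover have "(3 * ?d) powr (?d + s) * (3 * ?d) powr (- (?d + s)) = 1"
        using d by (simp add: powr_add[symmetric])
      moreover have "e powr (- (?d + s)) * (?v * ?v) = e powr (?d - s)"
        unfolding v by (simp add: powr_add[symmetric])
      moreover have "4 * Lam * h0 * (3 * ?d) powr (?d + s) / lam * (lam * ((3 * ?d) powr (- (?d + s)) * e powr (- (?d + s))) * (?v * ?v / 4))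
          = Lam * h0 * ((3 * ?d) powr (?d + s) * (3 * ?d) powr (- (?d + s))) * (e powr (- (?d + s)) * (?v * ?v))"
        using lam_pos by (simp del: minus_add_distrib)
      ultimately have "4 * Lam * h0 * (3 * ?d) powr (?d + s) / lam * (lam * (3 * ?d * e) powr (- (?d + s)) * (?v * ?v / 4)) = Lam * (e powr (?d - s) * h0)"
        by (simp only: mult_1_right mult_ac)
      moreover have "0 \<le> 4 * Lam * 3 powr (?d + s) / lam * (lam * (3 * ?d * e) powr (- (?d + s)) * (?v * ?v / 4))"
        using lam_pos Lam_pos e by simp
      ultimately show "Lam * (e powr (?d - s) * h0) \<le> pair_const * (lam * (3 * ?d * e) powr (- (?d + s)) * (?v * ?v / 4))"
        unfolding pair_const_def h0_def[symmetric] distrib_right by linarith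
    qed
  next
    \<comment> \<open>Distant cells: d e is at most half the distance of the centres, so all
      distances between their points agree up to a factor 3 and the kernel is constant up to a
      bounded factor.\<close>
    case False
    then have \<rho>: "2 * ?d * e \<le> ?\<rho>" by simp
    moreover have "?d * e > 0" using d e by simp
    ultimately have \<rho>0: "?\<rho> > 0" by linarith
    have up: "emeasure mu (?C i \<times> ?C j) \<le> ennreal (Lam * (?\<rho> / 2) powr (- (?d + s)) * (?v * ?v))"
    proof -
      have "emeasure mu (?C i \<times> ?C j) \<le> ennreal (Lam * (?\<rho> / 2) powr (- (?d + s))) * emeasure lebesgue (?C i \<times> ?C j)"
      proof (rule mu_le_volume[OF CC])
        show "0 < ?\<rho> / 2" using \<rho>0 by simp
        show "?\<rho> / 2 \<le> l1norm (fst p - snd p)" if "p \<in> ?C i \<times> ?C j" for p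
          using dist[OF that] \<rho> by simp
      qed
      then show ?thesis unfolding volCC using Lam_pos e by (simp add: ennreal_mult)
    qed
    show ?thesis
    proof (rule final[OF up])
      show "l1norm (fst p - snd p) \<le> 3 * (?\<rho> / 2)" if "p \<in> ?C i \<times> ?C j" for p
        using dist[OF that] \<rho> by simp
      have three: "3 powr (?d + s) * (3 * (?\<rho> / 2)) powr (- (?d + s)) = (?\<rho> / 2) powr (- (?d + s))"
      proof -
        have "(3 * (?\<rho> / 2)) powr (- (?d + s)) = 3 powr (- (?d + s)) * (?\<rho> / 2) powr (- (?d + s))"
          by (rule powr_mult)
        moreover have "3 powr (?d + s) * 3 powr (- (?d + s)) = (1::real)" by (simp add: powr_add[symmetric])
        ultimately show ?thesis by (simp only: mult.assoc[symmetric] mult_1)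
      qed
      have "4 * Lam * 3 powr (?d + s) / lam * (lam * (3 * (?\<rho> / 2)) powr (- (?d + s)) * (?v * ?v / 4))
          = Lam * (3 powr (?d + s) * (3 * (?\<rho> / 2)) powr (- (?d + s))) * (?v * ?v)"
        using lam_pos by (simp del: minus_add_distrib)
      then have "4 * Lam * 3 powr (?d + s) / lam * (lam * (3 * (?\<rho> / 2)) powr (- (?d + s)) * (?v * ?v / 4)) = Lam * (?\<rho> / 2) powr (- (?d + s)) * (?v * ?v)"
        unfolding three .
      moreover have "0 \<le> 4 * Lam * h0 * (3 * ?d) powr (?d + s) / lam * (lam * (3 * (?\<rho> / 2)) powr (- (?d + s)) * (?v * ?v / 4))"
        using lam_pos Lam_pos e h0 by simp
      ultimately show "Lam * (?\<rho> / 2) powr (- (?d + s)) * (?v * ?v) \<le> pair_const * (lam * (3 * (?\<rho> / 2)) powr (- (?d + s)) * (?v * ?v / 4))"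
        unfolding pair_const_def h0_def[symmetric] distrib_right by linarith
    qed
  qed
qed

end

subsection \<open>Compactness\<close>

text \<open>If E and F are both mostly full or both mostly empty in C, their symmetric difference
  there lies in the two minority parts. Otherwise their volumes differ by all of C except the
  minority parts, so the difference of the volumes pays for it.\<close>

lemma measure_sym_diff_le:
  fixes E F C :: "'a::euclidean_space set"
  assumes E: "E \<in> sets lebesgue" and F: "F \<in> sets lebesgue" and C: "C \<in> lmeasurable"
  shows "measure lebesgue ((E - F \<union> (F - E)) \<inter> C) \<le> \<bar>measure lebesgue (E \<inter> C) - measure lebesgue (F \<inter> C)\<bar>
    + 2 * min (measure lebesgue (E \<inter> C)) (measure lebesgue (C - E)) + 2 * min (measure lebesgue (F \<inter> C)) (measure lebesgue (C - F))"
proof -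
  have m: "S \<in> lmeasurable" if "S \<in> sets lebesgue" "S \<subseteq> C" for S
    using that C by (auto intro: fmeasurableI2)
  have mE: "E \<inter> C \<in> lmeasurable" "C - E \<in> lmeasurable" and mF: "F \<inter> C \<in> lmeasurable" "C - F \<in> lmeasurable"
    and mS: "(E - F \<union> (F - E)) \<inter> C \<in> lmeasurable"
    using E F fmeasurableD[OF C] by (auto intro!: m)
  have split: "measure lebesgue (S \<inter> C) + measure lebesgue (C - S) = measure lebesgue C"
    if "S \<inter> C \<in> lmeasurable" "C - S \<in> lmeasurable" for S
  proof -
    have "measure lebesgue ((S \<inter> C) \<union> (C - S)) = measure lebesgue (S \<inter> C) + measure lebesgue (C - S)"
      by (rule measure_Union) (use that fmeasurableD2[OF that(1)] fmeasurableD2[OF that(2)] in auto)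
    moreover have "(S \<inter> C) \<union> (C - S) = C" by auto
    ultimately show ?thesis by (simp only:)
  qed
  have le: "measure lebesgue ((E - F \<union> (F - E)) \<inter> C) \<le> measure lebesgue A + measure lebesgue B"
    if "(E - F \<union> (F - E)) \<inter> C \<subseteq> A \<union> B" "A \<in> lmeasurable" "B \<in> lmeasurable" for A B
  proof -
    have "measure lebesgue ((E - F \<union> (F - E)) \<inter> C) \<le> measure lebesgue (A \<union> B)"
      using that mS by (intro measure_mono_fmeasurable) auto
    also have "\<dots> \<le> measure lebesgue A + measure lebesgue B"
      using that by (intro measure_Un_le) auto
    finally show ?thesis .
  qed
  have "measure lebesgue ((E - F \<union> (F - E)) \<inter> C) \<le> measure lebesgue (E \<inter> C) + measure lebesgue (F \<inter> C)"
    by (rule le) (use mE mF in auto)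
  moreover have "measure lebesgue ((E - F \<union> (F - E)) \<inter> C) \<le> measure lebesgue (C - E) + measure lebesgue (C - F)"
    by (rule le) (use mE mF in auto)
  moreover have "measure lebesgue ((E - F \<union> (F - E)) \<inter> C) \<le> measure lebesgue (E \<inter> C) + measure lebesgue (C - E)"
    by (rule le) (use mE mF in auto)
  moreover note split[OF mE] split[OF mF]
  ultimately show ?thesis
    using measure_nonneg[of lebesgue "E \<inter> C"] measure_nonneg[of lebesgue "F \<inter> C"]
      measure_nonneg[of lebesgue "C - E"] measure_nonneg[of lebesgue "C - F"] by linarith
qed

section \<open>From bounded energy to almost everywhere convergence\<close>

context nonlocal_kernel
begin

text \<open>Total boundedness in measure: under an energy bound, finitely many cell volumes
  determine a set on the cube up to an error of order e^s. The 4 is two sets times the factor 2 in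
  \<open>measure_sym_diff_le\<close>.\<close>

lemma measure_sym_diff_cube_le:
  assumes E: "E \<in> sets lebesgue" and F: "F \<in> sets lebesgue" and e: "0 < e" "e \<le> 1" and T: "T \<ge> 0"
    and b: "0 \<le> b" "energy E (cubeQ (T + 2) 0) \<le> ennreal b" "energy F (cubeQ (T + 2) 0) \<le> ennreal b"
  defines "I \<equiv> block (nat \<lceil>T / e\<rceil>) :: (int ^ 'n) set"
  shows "measure lebesgue ((E - F \<union> (F - E)) \<inter> cubeQ T 0) \<le>
    (\<Sum>i\<in>I. \<bar>measure lebesgue (E \<inter> {x. cell e x = i}) - measure lebesgue (F \<inter> {x. cell e x = i})\<bar>)
     + 4 * (poincare_const * e powr s * b)"
proof -
  let ?C = "\<lambda>i. {x. cell e x = i}" and ?S = "E - F \<union> (F - E)"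
  let ?min = "\<lambda>G i. min (measure lebesgue (G \<inter> ?C i)) (measure lebesgue (?C i - G))"
  have I: "finite I" unfolding I_def by (rule finite_block)
  note bl = block_cube_bounds[OF e(1) T]
  have sub: "{x. cell e x \<in> I} \<subseteq> cubeQ (T + 2) 0"
    unfolding I_def using bl(2) cubeQ_mono[of "T + 2 * e" "T + 2" 0] e by auto
  have S: "?S \<in> sets lebesgue" using E F by auto
  have SC: "?S \<inter> ?C i \<in> lmeasurable" for i
    using S measure_cell(1)[OF e(1), of i] by (auto intro!: fmeasurableI2[OF measure_cell(1)[OF e(1), of i]])
  have "measure lebesgue (?S \<inter> cubeQ T 0) \<le> measure lebesgue (\<Union>i\<in>I. ?S \<inter> ?C i)"
  proof (rule measure_mono_fmeasurable)
    show "?S \<inter> cubeQ T 0 \<subseteq> (\<Union>i\<in>I. ?S \<inter> ?C i)" using bl(1) by (auto simp: I_def)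
    show "?S \<inter> cubeQ T 0 \<in> sets lebesgue" using S cubeQ_lebesgue[OF T] by auto
    show "(\<Union>i\<in>I. ?S \<inter> ?C i) \<in> lmeasurable" using SC I by (intro fmeasurable.finite_UN) auto
  qed
  also have "\<dots> \<le> (\<Sum>i\<in>I. measure lebesgue (?S \<inter> ?C i))"
    using SC I by (intro measure_UNION_le) auto
  also have "\<dots> \<le> (\<Sum>i\<in>I. \<bar>measure lebesgue (E \<inter> ?C i) - measure lebesgue (F \<inter> ?C i)\<bar> + 2 * ?min E i + 2 * ?min F i)"
    by (intro sum_mono measure_sym_diff_le E F measure_cell(1) e)
  also have "\<dots> = (\<Sum>i\<in>I. \<bar>measure lebesgue (E \<inter> ?C i) - measure lebesgue (F \<inter> ?C i)\<bar>) + 2 * (\<Sum>i\<in>I. ?min E i) + 2 * (\<Sum>i\<in>I. ?min F i)"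
    by (simp only: sum.distrib sum_distrib_left)
  finally have *: "measure lebesgue (?S \<inter> cubeQ T 0) \<le> \<dots>" .
  have pc: "0 \<le> poincare_const * e powr s" using lam_pos by (simp add: poincare_const_def)
  have "(\<Sum>i\<in>I. ?min G i) \<le> poincare_const * e powr s * b"
    if "G \<in> sets lebesgue" "energy G (cubeQ (T + 2) 0) \<le> ennreal b" for G
  proof -
    have "ennreal (\<Sum>i\<in>I. ?min G i) \<le> ennreal (poincare_const * e powr s) * energy G (cubeQ (T + 2) 0)"
      using T by (intro poincare_sum e that I cubeQ_lebesgue sub) simp
    also have "\<dots> \<le> ennreal (poincare_const * e powr s) * ennreal b" by (intro mult_left_mono that) simp
    also have "\<dots> = ennreal (poincare_const * e powr s * b)" using pc b by (simp add: ennreal_mult)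
    finally show ?thesis using pc b by (simp add: ennreal_le_iff)
  qed
  from this[OF E b(2)] this[OF F b(3)] * show ?thesis by linarith
qed

text \<open>Along a diagonal subsequence the volumes in all dyadic cells converge, which makes the
  sets Cauchy in measure on every cube. A further, fast subsequence converges almost everywhere by
  Borel-Cantelli. The limit set is left to be read off from the alternative in the
  conclusion.\<close>

lemma energy_compactness:
  fixes E :: "nat \<Rightarrow> (real ^ 'n) set"
  assumes E: "\<And>n. E n \<in> sets lebesgue"
    and bound: "\<And>R. R \<ge> 1 \<Longrightarrow> \<exists>b\<ge>0. \<forall>n. energy (E n) (cubeQ R 0) \<le> ennreal b"
  obtains r where "strict_mono r"
    "AE x in lebesgue. (\<forall>\<^sub>F n in sequentially. x \<in> E (r n)) \<or> (\<forall>\<^sub>F n in sequentially. x \<notin> E (r n))"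
proof -
  define f where "f n = (\<lambda>(k, i). measure lebesgue (E n \<inter> {x. cell ((1/2) ^ k) x = i}))" for n :: nat
  have "countable (UNIV \<times> UNIV :: (nat \<times> (int ^ 'n)) set)" by (intro countable_SIGMA countable_int_vec) auto
  then have cnt: "countable (UNIV :: (nat \<times> (int ^ 'n)) set)" by simp
  have f1: "norm (f n z) \<le> 1" for n z
  proof -
    obtain k i where z: "z = (k, i)" by (cases z)
    have C: "{x. cell ((1/2) ^ k) x = i} \<in> lmeasurable" "measure lebesgue {x. cell ((1/2) ^ k) x = i} = ((1/2) ^ k) ^ CARD('n)"
      by (rule measure_cell; simp)+
    have "measure lebesgue (E n \<inter> {x. cell ((1/2) ^ k) x = i}) \<le> measure lebesgue {x. cell ((1/2) ^ k) x = i}"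
      using E[of n] C(1) by (intro measure_mono_fmeasurable) auto
    also have "\<dots> \<le> 1" unfolding C(2) by (intro power_le_one) auto
    finally show ?thesis by (simp add: f_def z)
  qed
  obtain r0 :: "nat \<Rightarrow> nat" where r0: "strict_mono r0" and lim: "\<And>z. z \<in> UNIV \<Longrightarrow> \<exists>l. (\<lambda>n. f (r0 n) z) \<longlonglongrightarrow> l"
    using function_convergent_subsequence[OF cnt, of f 1] f1 by metis
  obtain l where l: "\<And>z. (\<lambda>n. f (r0 n) z) \<longlonglongrightarrow> l z" using lim by (metis UNIV_I)
  define G where "G n = E (r0 n)" for n
  have G: "G n \<in> sets lebesgue" for n by (simp add: G_def E)
  let ?D = "\<lambda>m n T. (G m - G n \<union> (G n - G m)) \<inter> cubeQ T 0"
  have cauchy: "\<exists>N. \<forall>m\<ge>N. \<forall>n\<ge>N. measure lebesgue (?D m n T) \<le> \<delta>" if T: "T \<ge> 0" and \<delta>: "\<delta> > 0" for T \<delta>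
  proof -
    obtain b where b: "b \<ge> 0" "\<And>n. energy (E n) (cubeQ (T + 2) 0) \<le> ennreal b" using bound[of "T + 2"] T by auto
    \<comment> \<open>First the scale is chosen to make the Poincare error small, then the index to
      make the finitely many volumes at that scale nearly equal.\<close>
    have "(\<lambda>k. 4 * (poincare_const * (((1/2) powr s) ^ k) * b)) \<longlonglongrightarrow> 4 * (poincare_const * 0 * b)"
    proof (intro tendsto_intros LIMSEQ_power_zero)
      have "(1/2) powr s < (1/2 :: real) powr 0" using s_pos by (intro powr_less_mono') auto
      then show "norm ((1/2 :: real) powr s) < 1" by simp
    qed
    then have "\<forall>\<^sub>F k in sequentially. 4 * (poincare_const * (((1/2) powr s) ^ k) * b) < \<delta> / 2"
      by (rule order_tendstoD(2)) (use \<delta> in simp)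
    then obtain k where "4 * (poincare_const * (((1/2) powr s) ^ k) * b) < \<delta> / 2"
      by (auto simp: eventually_sequentially)
    moreover have "((1/2 :: real) powr s) ^ k = ((1/2) ^ k) powr s"
      by (induction k) (auto simp: powr_mult powr_divide)
    ultimately have k: "4 * (poincare_const * ((1/2) ^ k) powr s * b) < \<delta> / 2" by simp
    let ?I = "block (nat \<lceil>T / (1/2) ^ k\<rceil>) :: (int ^ 'n) set"
    have "(\<lambda>n. \<Sum>i\<in>?I. \<bar>f (r0 n) (k, i) - l (k, i)\<bar>) \<longlonglongrightarrow> (\<Sum>i\<in>?I. \<bar>l (k, i) - l (k, i)\<bar>)"
      by (intro tendsto_intros l)
    then have "\<forall>\<^sub>F n in sequentially. (\<Sum>i\<in>?I. \<bar>f (r0 n) (k, i) - l (k, i)\<bar>) < \<delta> / 4"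
      using \<delta> by (intro order_tendstoD) auto
    then obtain N where N: "\<And>n. n \<ge> N \<Longrightarrow> (\<Sum>i\<in>?I. \<bar>f (r0 n) (k, i) - l (k, i)\<bar>) < \<delta> / 4"
      by (auto simp: eventually_sequentially)
    have "measure lebesgue (?D m n T) \<le> \<delta>" if "m \<ge> N" "n \<ge> N" for m n
    proof -
      have "measure lebesgue (?D m n T) \<le> (\<Sum>i\<in>?I. \<bar>measure lebesgue (G m \<inter> {x. cell ((1/2) ^ k) x = i}) - measure lebesgue (G n \<inter> {x. cell ((1/2) ^ k) x = i})\<bar>)
         + 4 * (poincare_const * ((1/2) ^ k) powr s * b)"
        using T b by (intro measure_sym_diff_cube_le G) (auto simp: G_def power_le_one)
      also have "(\<Sum>i\<in>?I. \<bar>measure lebesgue (G m \<inter> {x. cell ((1/2) ^ k) x = i}) - measure lebesgue (G n \<inter> {x. cell ((1/2) ^ k) x = i})\<bar>)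
          \<le> (\<Sum>i\<in>?I. \<bar>f (r0 m) (k, i) - l (k, i)\<bar> + \<bar>f (r0 n) (k, i) - l (k, i)\<bar>)"
        by (intro sum_mono) (simp add: f_def G_def)
      also have "\<dots> = (\<Sum>i\<in>?I. \<bar>f (r0 m) (k, i) - l (k, i)\<bar>) + (\<Sum>i\<in>?I. \<bar>f (r0 n) (k, i) - l (k, i)\<bar>)"
        by (rule sum.distrib)
      finally show ?thesis using N[OF that(1)] N[OF that(2)] k by linarith
    qed
    then show ?thesis by blast
  qed
  have "\<exists>N. \<forall>m\<ge>N. \<forall>n\<ge>N. measure lebesgue (?D m n (real j + 1)) \<le> (1/2) ^ j" for j
    by (rule cauchy) auto
  then obtain N where N: "\<And>j m n. m \<ge> N j \<Longrightarrow> n \<ge> N j \<Longrightarrow> measure lebesgue (?D m n (real j + 1)) \<le> (1/2) ^ j" by metis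
  \<comment> \<open>These partial sums increase strictly and dominate \<open>N j\<close>.\<close>
  define r1 where "r1 j = (\<Sum>l\<le>j. Suc (N l))" for j
  have r1: "strict_mono r1" unfolding strict_mono_Suc_iff r1_def by simp
  have r1N: "N j \<le> r1 j" for j
    using member_le_sum[of j "{..j}" "\<lambda>l. Suc (N l)"] by (simp add: r1_def)
  \<comment> \<open>Error and cube vary together with j: the errors are summable, and every point
    eventually lies in all the cubes.\<close>
  let ?A = "\<lambda>j. ?D (r1 j) (r1 (Suc j)) (real j + 1)"
  have cube: "cubeQ (real j + 1) (0 :: real ^ 'n) \<in> lmeasurable" for j
    using emeasure_cubeQ(1)[of "real j + 1" "0 :: real ^ 'n"] emeasure_cubeQ(3)[of "real j + 1" "0 :: real ^ 'n"]
    by (intro fmeasurableI) (auto simp: cubeQ_lebesgue)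
  have Am: "?A j \<in> lmeasurable" for j
    using G fmeasurableD[OF cube[of j]] by (intro fmeasurableI2[OF cube[of j]]) auto
  have A1: "measure lebesgue (?A j) \<le> (1/2) ^ j" for j
    using r1N[of j] strict_monoD[OF r1, of j "Suc j"] by (intro N) auto
  have "AE x in lebesgue. eventually (\<lambda>j. x \<in> space lebesgue - ?A j) sequentially"
  proof (rule borel_cantelli_AE1)
    show "?A j \<in> sets lebesgue" for j using Am[of j] by (rule fmeasurableD)
    show "emeasure lebesgue (?A j) < \<infinity>" for j using fmeasurableD2[OF Am[of j]] by (simp add: top.not_eq_extremum)
    show "summable (\<lambda>j. measure lebesgue (?A j))"
      by (rule summable_comparison_test'[of "\<lambda>j. (1/2) ^ j" 0]) (use A1 in \<open>auto intro: summable_geometric\<close>)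
  qed
  then have "AE x in lebesgue. (\<forall>\<^sub>F j in sequentially. x \<in> E ((r0 \<circ> r1) j)) \<or> (\<forall>\<^sub>F j in sequentially. x \<notin> E ((r0 \<circ> r1) j))"
  proof eventually_elim
    case (elim x)
    then obtain J1 where J1: "\<And>j. j \<ge> J1 \<Longrightarrow> x \<notin> ?A j" by (auto simp: eventually_sequentially)
    obtain J2 where J2: "l1norm x < real J2" using reals_Archimedean2 by blast
    have cube: "x \<in> cubeQ (real j + 1) 0" if "j \<ge> J2" for j
    proof -
      have "\<bar>x $ k\<bar> \<le> real j + 1" for k using component_le_l1norm[of x k] J2 that by linarith
      then show ?thesis by (simp add: cubeQ_def)
    qed
    let ?J = "max J1 J2"
    have const: "x \<in> G (r1 (?J + j)) \<longleftrightarrow> x \<in> G (r1 ?J)" for j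
    proof (induction j)
      case (Suc j)
      have "x \<in> G (r1 (?J + j)) \<longleftrightarrow> x \<in> G (r1 (Suc (?J + j)))"
        using J1[of "?J + j"] cube[of "?J + j"] by auto
      with Suc show ?case by simp
    qed simp
    have "x \<in> G (r1 j) \<longleftrightarrow> x \<in> G (r1 ?J)" if "j \<ge> ?J" for j
      using const[of "j - ?J"] that by simp
    then show ?case unfolding eventually_sequentially G_def comp_def by blast
  qed
  with strict_mono_o[OF r0 r1] show ?thesis by (rule that)
qed

end

subsection \<open>Passage to the limit\<close>

lemma l1norm_sublevel_lebesgue:
  "{p :: (real ^ 'n) \<times> (real ^ 'n). l1norm (fst p - snd p) < r} \<in> sets lebesgue"
proof -
  have "{p :: (real ^ 'n) \<times> (real ^ 'n). l1norm (fst p - snd p) < r} = (\<lambda>p. l1norm (fst p - snd p)) -` {..<r} \<inter> space borel"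
    by auto
  also have "\<dots> \<in> sets borel" by (rule measurable_sets[OF borel_measurable_l1norm_diff]) simp
  finally show ?thesis by auto
qed

lemma l1norm_superlevel_lebesgue:
  "{p :: (real ^ 'n) \<times> (real ^ 'n). r \<le> l1norm (fst p - snd p)} \<in> sets lebesgue"
proof -
  have "{p :: (real ^ 'n) \<times> (real ^ 'n). r \<le> l1norm (fst p - snd p)} = (\<lambda>p. l1norm (fst p - snd p)) -` {r..} \<inter> space borel"
    by auto
  also have "\<dots> \<in> sets borel" by (rule measurable_sets[OF borel_measurable_l1norm_diff]) simp
  finally show ?thesis by auto
qed

lemma emeasure_cubeQ_lebesgue:
  "r \<ge> 0 \<Longrightarrow> emeasure lebesgue (cubeQ r (x :: real ^ 'n)) = ennreal ((2 * r) ^ CARD('n))"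
  using emeasure_cubeQ(1,3)[of r x] by simp

section \<open>Lower semicontinuity and the majority rule\<close>

context nonlocal_kernel
begin

text \<open>For almost every pair both points are eventually on their limiting side, so the
  integrand eventually takes its limiting value.\<close>

lemma energy_fatou:
  fixes E :: "nat \<Rightarrow> (real ^ 'n) set"
  assumes E: "\<And>n. E n \<in> sets lebesgue" and E0: "E0 \<in> sets lebesgue" and O: "\<Omega> \<in> sets lebesgue"
    and conv: "AE x in lebesgue. \<forall>\<^sub>F n in sequentially. x \<in> E n \<longleftrightarrow> x \<in> E0"
  shows "energy E0 \<Omega> \<le> liminf (\<lambda>n. energy (E n) \<Omega>)"
proof -
  let ?k = "\<lambda>p. K (fst p) (snd p)"
  have m: "(\<lambda>p. ?k p * indicator (cutset (E n) \<inter> touch \<Omega>) p) \<in> borel_measurable lebesgue" for n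
    using cut_touch_sets[OF E[of n] O] K_measurable by (intro borel_measurable_times_ennreal) auto
  have "energy E0 \<Omega> = (\<integral>\<^sup>+ p. ?k p * indicator (cutset E0 \<inter> touch \<Omega>) p \<partial>lebesgue)"
    unfolding energy_def by (rule emeasure_mu[OF cut_touch_sets[OF E0 O]])
  also have "\<dots> \<le> (\<integral>\<^sup>+ p. liminf (\<lambda>n. ?k p * indicator (cutset (E n) \<inter> touch \<Omega>) p) \<partial>lebesgue)"
  proof (rule nn_integral_mono_AE)
    show "AE p in lebesgue. ?k p * indicator (cutset E0 \<inter> touch \<Omega>) p \<le> liminf (\<lambda>n. ?k p * indicator (cutset (E n) \<inter> touch \<Omega>) p)"
      using AE_lebesgue_fst[OF conv, where 'b="real ^ 'n"] AE_lebesgue_snd[OF conv, where 'a="real ^ 'n"]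
    proof eventually_elim
      case (elim p)
      then have "\<forall>\<^sub>F n in sequentially. ?k p * indicator (cutset E0 \<inter> touch \<Omega>) p \<le> ?k p * indicator (cutset (E n) \<inter> touch \<Omega>) p"
        by eventually_elim (auto simp: cutset_def indicator_def)
      then show ?case by (rule Liminf_bounded)
    qed
  qed
  also have "\<dots> \<le> liminf (\<lambda>n. \<integral>\<^sup>+ p. ?k p * indicator (cutset (E n) \<inter> touch \<Omega>) p \<partial>lebesgue)"
    by (rule nn_integral_liminf[OF m])
  also have "\<dots> = liminf (\<lambda>n. energy (E n) \<Omega>)"
    unfolding energy_def using emeasure_mu[OF cut_touch_sets[OF E O]] by simp
  finally show ?thesis .
qed

text \<open>Ties are given to F; in every case the winning side fills at least half of the
  cell.\<close>

definition majority :: "real \<Rightarrow> (real ^ 'n) set \<Rightarrow> int ^ 'n \<Rightarrow> bool" where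
  "majority e F i \<longleftrightarrow> measure lebesgue ({x. cell e x = i} - F) \<le> measure lebesgue (F \<inter> {x. cell e x = i})"

text \<open>\<open>cell_pair_le\<close> is summed over the pairs of cells with opposite majorities
  that contain points at distance less than r. The cell products are disjoint, so the right-hand
  sides add up inside \<open>cutset F\<close>. Replacing the two points by others of their cells
  costs one diameter d e each, whence the enlarged range.\<close>

lemma majority_short_energy:
  fixes \<Gamma> :: "(int ^ 'n) set"
  assumes e: "e > 0" and F: "F \<in> sets lebesgue" and \<Gamma>: "finite \<Gamma>" and O: "\<Omega> \<in> sets lebesgue" "{x. cell e x \<in> \<Gamma>} \<subseteq> \<Omega>"
    and G: "\<And>x. cell e x \<in> \<Gamma> \<Longrightarrow> x \<in> G \<longleftrightarrow> majority e F (cell e x)"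
  shows "emeasure mu {p \<in> cutset G. cell e (fst p) \<in> \<Gamma> \<and> cell e (snd p) \<in> \<Gamma> \<and> l1norm (fst p - snd p) < r}
    \<le> ennreal pair_const * emeasure mu (cutset F \<inter> touch \<Omega> \<inter> {p. l1norm (fst p - snd p) < r + 2 * real CARD('n) * e})"
proof -
  let ?C = "\<lambda>i. {x. cell e x = i}"
  let ?P = "{q \<in> \<Gamma> \<times> \<Gamma>. (majority e F (fst q) \<longleftrightarrow> \<not> majority e F (snd q)) \<and> (\<exists>x\<in>?C (fst q). \<exists>y\<in>?C (snd q). l1norm (x - y) < r)}"
  let ?X = "\<lambda>q. ?C (fst q) \<times> ?C (snd q)"
  have X: "?X q \<in> sets lebesgue" for q :: "(int ^ 'n) \<times> (int ^ 'n)"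
    by (intro lebesgue_sets_Times cell_lebesgue_singleton e)
  have P: "finite ?P" using \<Gamma> by auto
  have sub: "{p \<in> cutset G. cell e (fst p) \<in> \<Gamma> \<and> cell e (snd p) \<in> \<Gamma> \<and> l1norm (fst p - snd p) < r} \<subseteq> (\<Union>q\<in>?P. ?X q)"
  proof
    fix p assume p: "p \<in> {p \<in> cutset G. cell e (fst p) \<in> \<Gamma> \<and> cell e (snd p) \<in> \<Gamma> \<and> l1norm (fst p - snd p) < r}"
    let ?q = "(cell e (fst p), cell e (snd p))"
    have "\<exists>x\<in>?C (fst ?q). \<exists>y\<in>?C (snd ?q). l1norm (x - y) < r"
      using p by (intro bexI[of _ "fst p"] bexI[of _ "snd p"]) auto
    moreover have "majority e F (fst ?q) \<longleftrightarrow> \<not> majority e F (snd ?q)"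
      using p G[of "fst p"] G[of "snd p"] by (auto simp: cutset_def)
    ultimately have "?q \<in> ?P" using p by simp
    then show "p \<in> (\<Union>q\<in>?P. ?X q)" by (rule UN_I) (simp add: mem_Times_iff)
  qed
  have half: "majority e F i \<Longrightarrow> e ^ CARD('n) / 2 \<le> measure lebesgue (F \<inter> ?C i)"
    and half': "\<not> majority e F i \<Longrightarrow> e ^ CARD('n) / 2 \<le> measure lebesgue (?C i - F)" for i
  proof -
    have m: "F \<inter> ?C i \<in> lmeasurable" "?C i - F \<in> lmeasurable" for i
      using F measure_cell(1)[OF e, of i] fmeasurableD[OF measure_cell(1)[OF e, of i]]
      by (auto intro!: fmeasurableI2[OF measure_cell(1)[OF e, of i]])
    have "measure lebesgue (F \<inter> ?C i) + measure lebesgue (?C i - F) = e ^ CARD('n)"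
    proof -
      have "measure lebesgue ((F \<inter> ?C i) \<union> (?C i - F)) = measure lebesgue (F \<inter> ?C i) + measure lebesgue (?C i - F)"
        by (rule measure_Union) (use m fmeasurableD2[OF m(1)] fmeasurableD2[OF m(2)] in auto)
      moreover have "(F \<inter> ?C i) \<union> (?C i - F) = ?C i" by auto
      ultimately show ?thesis using measure_cell(2)[OF e, of i] by (simp only:)
    qed
    then show "majority e F i \<Longrightarrow> e ^ CARD('n) / 2 \<le> measure lebesgue (F \<inter> ?C i)"
      "\<not> majority e F i \<Longrightarrow> e ^ CARD('n) / 2 \<le> measure lebesgue (?C i - F)"
      unfolding majority_def by linarith+
  qed
  have FC: "F \<inter> ?C i \<in> sets lebesgue" "?C i - F \<in> sets lebesgue" for i
    using F cell_lebesgue_singleton[OF e, of i] by auto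
  have cF: "cutset F \<in> sets lebesgue" by (rule cutset_sets_lebesgue[OF F])
  have pair: "emeasure mu (?X q) \<le> ennreal pair_const * emeasure mu (cutset F \<inter> ?X q)" if q: "q \<in> ?P" for q
  proof -
    have ne: "fst q \<noteq> snd q" using q by auto
    have XF: "cutset F \<inter> ?X q \<in> sets lebesgue" using cF X by (rule sets.Int)
    show ?thesis
    proof (cases "majority e F (fst q)")
      case True
      then have "\<not> majority e F (snd q)" using q by auto
      then have "emeasure mu (?X q) \<le> ennreal pair_const * emeasure mu ((F \<inter> ?C (fst q)) \<times> (?C (snd q) - F))"
        using True by (intro cell_pair_le[OF e ne] FC half half') auto
      also have "\<dots> \<le> ennreal pair_const * emeasure mu (cutset F \<inter> ?X q)"
        using XF by (intro mult_left_mono emeasure_mono) (auto simp: cutset_def)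
      finally show ?thesis .
    next
      case False
      then have "majority e F (snd q)" using q by auto
      then have "emeasure mu (?X q) \<le> ennreal pair_const * emeasure mu ((?C (fst q) - F) \<times> (F \<inter> ?C (snd q)))"
        using False by (intro cell_pair_le[OF e ne] FC half half') auto
      also have "\<dots> \<le> ennreal pair_const * emeasure mu (cutset F \<inter> ?X q)"
        using XF by (intro mult_left_mono emeasure_mono) (auto simp: cutset_def)
      finally show ?thesis .
    qed
  qed
  have "emeasure mu {p \<in> cutset G. cell e (fst p) \<in> \<Gamma> \<and> cell e (snd p) \<in> \<Gamma> \<and> l1norm (fst p - snd p) < r} \<le> emeasure mu (\<Union>q\<in>?P. ?X q)"
    using X P by (intro emeasure_mono[OF sub]) auto
  also have "\<dots> \<le> (\<Sum>q\<in>?P. emeasure mu (?X q))"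
    using X P by (intro emeasure_subadditive_finite) auto
  also have "\<dots> \<le> (\<Sum>q\<in>?P. ennreal pair_const * emeasure mu (cutset F \<inter> ?X q))"
    by (intro sum_mono pair)
  also have "\<dots> = ennreal pair_const * emeasure mu (\<Union>q\<in>?P. cutset F \<inter> ?X q)"
    unfolding sum_distrib_left[symmetric] using X P cF
    by (subst sum_emeasure) (auto simp: disjoint_family_on_def)
  also have "\<dots> \<le> ennreal pair_const * emeasure mu (cutset F \<inter> touch \<Omega> \<inter> {p. l1norm (fst p - snd p) < r + 2 * real CARD('n) * e})"
  proof (intro mult_left_mono emeasure_mono)
    show "(\<Union>q\<in>?P. cutset F \<inter> ?X q) \<subseteq> cutset F \<inter> touch \<Omega> \<inter> {p. l1norm (fst p - snd p) < r + 2 * real CARD('n) * e}"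
    proof
      fix p assume "p \<in> (\<Union>q\<in>?P. cutset F \<inter> ?X q)"
      then obtain q where q: "q \<in> ?P" "p \<in> cutset F" "p \<in> ?X q" by blast
      then obtain x y where xy: "cell e x = fst q" "cell e y = snd q" "l1norm (x - y) < r" by auto
      have p: "cell e (fst p) = fst q" "cell e (snd p) = snd q" using q(3) by auto
      have "l1norm (fst p - x) \<le> real CARD('n) * e" "l1norm (y - snd p) \<le> real CARD('n) * e"
        using l1norm_same_cell[OF e] p xy by metis+
      moreover have "l1norm (fst p - snd p) \<le> l1norm (fst p - x) + (l1norm (x - y) + l1norm (y - snd p))"
        using l1norm_triangle[of "fst p - x" "(x - y) + (y - snd p)"] l1norm_triangle[of "x - y" "y - snd p"] by simp
      ultimately have "l1norm (fst p - snd p) < r + 2 * real CARD('n) * e" using xy(3) by simp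
      moreover have "fst p \<in> \<Omega>" using O(2) q(1) p(1) by auto
      ultimately show "p \<in> cutset F \<inter> touch \<Omega> \<inter> {p. l1norm (fst p - snd p) < r + 2 * real CARD('n) * e}"
        using q(2) by (simp add: touch_def)
    qed
    show "cutset F \<inter> touch \<Omega> \<inter> {p. l1norm (fst p - snd p) < r + 2 * real CARD('n) * e} \<in> sets mu"
      unfolding sets_mu by (intro sets.Int cF touch_sets_lebesgue O l1norm_sublevel_lebesgue)
  qed simp
  finally show ?thesis .
qed

text \<open>On a cell of \<Gamma> the set G is full or empty according to the majority, so it
  differs from F exactly in the minority part, which \<open>poincare_sum\<close> controls.\<close>

lemma majority_sym_diff:
  fixes \<Gamma> :: "(int ^ 'n) set"
  assumes e: "e > 0" and F: "F \<in> sets lebesgue" and \<Gamma>: "finite \<Gamma>" and O: "\<Omega> \<in> sets lebesgue" "{x. cell e x \<in> \<Gamma>} \<subseteq> \<Omega>"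
    and G: "\<And>x. cell e x \<in> \<Gamma> \<Longrightarrow> x \<in> G \<longleftrightarrow> majority e F (cell e x)" "G \<in> sets lebesgue"
  shows "emeasure lebesgue ((G - F \<union> (F - G)) \<inter> {x. cell e x \<in> \<Gamma>}) \<le> ennreal (poincare_const * e powr s) * energy F \<Omega>"
proof -
  let ?C = "\<lambda>i. {x. cell e x = i}" and ?D = "G - F \<union> (F - G)"
  have DC: "?D \<inter> ?C i \<in> sets lebesgue" for i using F G cell_lebesgue_singleton[OF e, of i] by auto
  have m: "F \<inter> ?C i \<in> lmeasurable" "?C i - F \<in> lmeasurable" for i
    using F measure_cell(1)[OF e, of i] fmeasurableD[OF measure_cell(1)[OF e, of i]]
    by (auto intro!: fmeasurableI2[OF measure_cell(1)[OF e, of i]])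
  have "?D \<inter> {x. cell e x \<in> \<Gamma>} = (\<Union>i\<in>\<Gamma>. ?D \<inter> ?C i)" by auto
  then have "emeasure lebesgue (?D \<inter> {x. cell e x \<in> \<Gamma>}) \<le> (\<Sum>i\<in>\<Gamma>. emeasure lebesgue (?D \<inter> ?C i))"
    using DC \<Gamma> by (simp only:) (intro emeasure_subadditive_finite, auto)
  also have "\<dots> \<le> (\<Sum>i\<in>\<Gamma>. ennreal (min (measure lebesgue (F \<inter> ?C i)) (measure lebesgue (?C i - F))))"
  proof (intro sum_mono)
    fix i assume i: "i \<in> \<Gamma>"
    show "emeasure lebesgue (?D \<inter> ?C i) \<le> ennreal (min (measure lebesgue (F \<inter> ?C i)) (measure lebesgue (?C i - F)))"
    proof (cases "majority e F i")
      case True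
      then have "?D \<inter> ?C i \<subseteq> ?C i - F" using G(1) i by auto
      then have "emeasure lebesgue (?D \<inter> ?C i) \<le> emeasure lebesgue (?C i - F)"
        using m[of i] by (intro emeasure_mono) auto
      also have "\<dots> = ennreal (measure lebesgue (?C i - F))" using m(2)[of i] by (rule emeasure_eq_measure2)
      finally show ?thesis using True by (simp add: majority_def min_def)
    next
      case False
      then have "?D \<inter> ?C i \<subseteq> F \<inter> ?C i" using G(1) i by auto
      then have "emeasure lebesgue (?D \<inter> ?C i) \<le> emeasure lebesgue (F \<inter> ?C i)"
        using m[of i] by (intro emeasure_mono) auto
      also have "\<dots> = ennreal (measure lebesgue (F \<inter> ?C i))" using m(1)[of i] by (rule emeasure_eq_measure2)
      finally show ?thesis using False by (simp add: majority_def min_def)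
    qed
  qed
  also have "\<dots> = ennreal (\<Sum>i\<in>\<Gamma>. min (measure lebesgue (F \<inter> ?C i)) (measure lebesgue (?C i - F)))"
    by (intro sum_ennreal) auto
  also have "\<dots> \<le> ennreal (poincare_const * e powr s) * energy F \<Omega>"
    by (rule poincare_sum[OF e F \<Gamma> O])
  finally show ?thesis .
qed

text \<open>A pair separated by G and touching Q is separated by F, or short with both points in Q,
  or across the boundary of Q and very short or very long, or else at distance at least r with both
  points in C. In the last case, F not separating it, one of its points lies in the symmetric
  difference, and the kernel is bounded. The margin 1/r in C makes room for partners outside
  Q.\<close>

lemma energy_perturbation:
  fixes G F Q :: "(real ^ 'n) set"
  assumes G: "G \<in> sets lebesgue" and F: "F \<in> sets lebesgue" and Q: "Q \<in> sets lebesgue" "Q \<subseteq> cubeQ T 0"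
    and r: "r > 0" and T: "T \<ge> 0"
  defines "C \<equiv> cubeQ (T + 1 / r) (0 :: real ^ 'n)"
  shows "energy G Q \<le> energy F Q + emeasure mu {p \<in> cutset G. fst p \<in> Q \<and> snd p \<in> Q \<and> l1norm (fst p - snd p) < r}
    + ennreal Lam * emeasure (hmeas s) (cutset Q \<inter> shortlong r)
    + ennreal (Lam * r powr (- (real CARD('n) + s))) * (2 * emeasure lebesgue C * emeasure lebesgue ((G - F \<union> (F - G)) \<inter> C))"
proof -
  let ?D = "(G - F \<union> (F - G)) \<inter> C"
  let ?S0 = "cutset F \<inter> touch Q"
  let ?S1 = "{p \<in> cutset G. fst p \<in> Q \<and> snd p \<in> Q \<and> l1norm (fst p - snd p) < r}"
  let ?S2 = "cutset Q \<inter> shortlong r"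
  let ?L = "{p :: (real ^ 'n) \<times> (real ^ 'n). r \<le> l1norm (fst p - snd p)}"
  let ?S3 = "?L \<inter> (?D \<times> C \<union> C \<times> ?D)"
  have C: "C \<in> sets lebesgue" unfolding C_def using r T by (intro cubeQ_lebesgue) simp
  have D: "?D \<in> sets lebesgue" using G F C by auto
  have S0: "?S0 \<in> sets lebesgue" by (rule cut_touch_sets[OF F Q(1)])
  have "?S1 = cutset G \<inter> Q \<times> Q \<inter> {p. l1norm (fst p - snd p) < r}" by auto
  then have S1: "?S1 \<in> sets lebesgue"
    using cutset_sets_lebesgue[OF G] lebesgue_sets_Times[OF Q(1) Q(1)] l1norm_sublevel_lebesgue[of r, where 'n='n]
    by (simp only: sets.Int)
  have S2: "?S2 \<in> sets lebesgue"
    using cutset_sets_lebesgue[OF Q(1)] shortlong_borel[of r, where 'n='n] by auto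
  have DC: "?D \<times> C \<in> sets lebesgue" "C \<times> ?D \<in> sets lebesgue" using C D by (auto intro: lebesgue_sets_Times)
  then have S3: "?S3 \<in> sets lebesgue"
    using l1norm_superlevel_lebesgue[of r, where 'n='n] by (simp only: sets.Int sets.Un)
  have QC: "Q \<subseteq> C"
    using Q(2) cubeQ_mono[of T "T + 1 / r" 0] r unfolding C_def by auto
  have near: "y \<in> C" if "x \<in> Q" "l1norm (x - y) \<le> 1 / r" for x y
  proof -
    have "\<bar>y $ k\<bar> \<le> T + 1 / r" for k
    proof -
      have "\<bar>x $ k\<bar> \<le> T" using that(1) Q(2) by (auto simp: cubeQ_def)
      moreover have "\<bar>x $ k - y $ k\<bar> \<le> 1 / r" using component_le_l1norm[of "x - y" k] that(2) by simp
      ultimately show ?thesis by linarith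
    qed
    then show ?thesis by (simp add: C_def cubeQ_def)
  qed
  have "cutset G \<inter> touch Q \<subseteq> ?S0 \<union> ?S1 \<union> ?S2 \<union> ?S3"
  proof
    fix p assume p: "p \<in> cutset G \<inter> touch Q"
    obtain x y where xy: "p = (x, y)" by (cases p)
    show "p \<in> ?S0 \<union> ?S1 \<union> ?S2 \<union> ?S3"
    proof (rule ccontr)
      assume n: "p \<notin> ?S0 \<union> ?S1 \<union> ?S2 \<union> ?S3"
      then have F0: "p \<notin> cutset F" using p by auto
      have "x \<in> C \<and> y \<in> C \<and> r \<le> l1norm (x - y)"
      proof (cases "x \<in> Q \<and> y \<in> Q")
        case True
        then show ?thesis using n p QC by (auto simp: xy)
      next
        case False
        then have "p \<in> cutset Q" using p by (auto simp: xy cutset_def touch_def)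
        then have "p \<notin> shortlong r" using n by auto
        then have l: "r \<le> l1norm (x - y)" "l1norm (x - y) \<le> 1 / r" by (auto simp: shortlong_def xy not_less)
        have "x \<in> Q \<or> y \<in> Q" using p by (auto simp: xy touch_def)
        then show ?thesis using l near[of x y] near[of y x] QC by (auto simp: l1norm_minus_commute[of y x])
      qed
      moreover have "x \<in> G - F \<union> (F - G) \<or> y \<in> G - F \<union> (F - G)"
        using p F0 by (auto simp: xy cutset_def)
      ultimately have "p \<in> ?S3" by (auto simp: xy)
      with n show False by blast
    qed
  qed
  then have "energy G Q \<le> emeasure mu (?S0 \<union> ?S1 \<union> ?S2 \<union> ?S3)"
    unfolding energy_def using S0 S1 S2 S3 by (intro emeasure_mono) (auto simp only: sets_mu sets.Un)
  also have "\<dots> \<le> emeasure mu ?S0 + emeasure mu ?S1 + emeasure mu ?S2 + emeasure mu ?S3"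
    using S0 S1 S2 S3
    by (intro order_trans[OF emeasure_subadditive] add_right_mono order_trans[OF emeasure_subadditive])
      (simp_all only: sets_mu sets.Un order_refl)
  also have "\<dots> \<le> energy F Q + emeasure mu ?S1 + ennreal Lam * emeasure (hmeas s) ?S2
      + ennreal (Lam * r powr (- (real CARD('n) + s))) * (2 * emeasure lebesgue C * emeasure lebesgue ?D)"
  proof (intro add_mono)
    show "emeasure mu ?S0 \<le> energy F Q" by (simp add: energy_def)
    show "emeasure mu ?S2 \<le> ennreal Lam * emeasure (hmeas s) ?S2" by (rule mu_le_hmeas[OF S2])
    have "emeasure mu ?S3 \<le> ennreal (Lam * r powr (- (real CARD('n) + s))) * emeasure lebesgue ?S3"
      by (rule mu_le_volume[OF S3 r]) simp
    also have "\<dots> \<le> ennreal (Lam * r powr (- (real CARD('n) + s))) * (2 * emeasure lebesgue C * emeasure lebesgue ?D)"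
    proof (intro mult_left_mono)
      have "emeasure lebesgue ?S3 \<le> emeasure lebesgue (?D \<times> C \<union> C \<times> ?D)"
        using DC by (intro emeasure_mono) auto
      also have "\<dots> \<le> emeasure lebesgue (?D \<times> C) + emeasure lebesgue (C \<times> ?D)"
        using DC by (rule emeasure_subadditive)
      also have "\<dots> = 2 * emeasure lebesgue C * emeasure lebesgue ?D"
        unfolding emeasure_lebesgue_Times[OF C D] emeasure_lebesgue_Times[OF D C] by (simp add: mult_2 distrib_right mult.commute)
      finally show "emeasure lebesgue ?S3 \<le> 2 * emeasure lebesgue C * emeasure lebesgue ?D" .
    qed simp
    finally show "emeasure mu ?S3 \<le> ennreal (Lam * r powr (- (real CARD('n) + s))) * (2 * emeasure lebesgue C * emeasure lebesgue ?D)" .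
  qed simp
  finally show ?thesis .
qed

end

section \<open>Comparison of a ground state with a discretized competitor\<close>

context nonlocal_kernel
begin

text \<open>The ground state is tested against the configuration that follows the majority of F in a
  block and the ground state itself outside. In the block this is close to F by
  \<open>majority_sym_diff\<close>; outside, F equals the prospective limit \<open>E0\<close>, and
  the deviation is that of the ground state from \<open>E0\<close>. The cube of radius R' absorbs
  the overshoot of the block.\<close>

lemma majority_config_energy:
  fixes u :: "int ^ 'n \<Rightarrow> int"
  assumes e: "0 < e" "e < 1" and u: "ground_state K s e u" and R: "R \<ge> 1"
    and F: "F \<in> sets lebesgue" and E0: "E0 \<in> sets lebesgue" "F - cubeQ R 0 = E0 - cubeQ R 0"
    and r: "r > 0" "e \<le> r" and R': "R + 2 * e \<le> R'"
  defines "E \<equiv> {x. u (cell e x) = 1}" and "C \<equiv> cubeQ (R + 2 + 1 / r) (0 :: real ^ 'n)"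
  shows "energy E (cubeQ R 0) \<le> energy F (cubeQ R' 0)
     + ennreal pair_const * emeasure mu (cutset F \<inter> touch (cubeQ (R + 2) 0) \<inter> {p. l1norm (fst p - snd p) < (1 + 2 * real CARD('n)) * r})
     + ennreal Lam * (ennreal ((2 * R + 3) powr (real CARD('n) - s)) * emeasure (hmeas s) (cutset (unit_cell :: (real ^ 'n) set) \<inter> shortlong ((2 * R + 3) * r)))
     + ennreal (Lam * r powr (- (real CARD('n) + s))) * (2 * emeasure lebesgue C *
         (ennreal (poincare_const * e powr s) * energy F (cubeQ (R + 2) 0) + emeasure lebesgue ((E - E0 \<union> (E0 - E)) \<inter> C)))"
proof -
  let ?m = "nat \<lceil>R / e\<rceil>"
  let ?\<Gamma> = "block ?m :: (int ^ 'n) set"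
  let ?Q = "{x :: real ^ 'n. cell e x \<in> ?\<Gamma>}"
  let ?v = "\<lambda>i. if i \<in> ?\<Gamma> then (if majority e F i then 1 else -1) else u i"
  let ?G = "{x. ?v (cell e x) = 1}"
  have R0: "R \<ge> 0" using R by simp
  note b = block_cube_bounds[OF e(1) R0]
  have Q: "?Q \<in> sets lebesgue" by (rule cell_lebesgue[OF e(1)])
  have cQ: "cubeQ R 0 \<subseteq> ?Q" "?Q \<subseteq> cubeQ R' 0" "?Q \<subseteq> cubeQ (R + 2) 0"
    using b(1,2) cubeQ_mono[of "R + 2 * e" R' 0] cubeQ_mono[of "R + 2 * e" "R + 2" 0] R' e by auto
  have E: "E \<in> sets lebesgue" unfolding E_def using cell_lebesgue[OF e(1), of "{i. u i = 1}"] by simp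
  have G: "?G \<in> sets lebesgue" using cell_lebesgue[OF e(1), of "{i. ?v i = 1}"] by simp
  have Gmaj: "x \<in> ?G \<longleftrightarrow> majority e F (cell e x)" if "cell e x \<in> ?\<Gamma>" for x using that by auto
  have C: "C \<in> sets lebesgue" unfolding C_def using R r by (intro cubeQ_lebesgue) simp
  have QR2: "cubeQ (R + 2) (0 :: real ^ 'n) \<in> sets lebesgue" using R by (intro cubeQ_lebesgue) simp
  have QR': "cubeQ R' (0 :: real ^ 'n) \<in> sets lebesgue" using R R' e by (intro cubeQ_lebesgue) simp
  have "config u" using u by (simp add: ground_state_def)
  then have v: "config ?v" by (simp add: config_def)
  have "energy E (cubeQ R 0) \<le> energy E ?Q" by (rule energy_mono[OF E Q cQ(1)])
  also have "\<dots> \<le> energy ?G ?Q"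
    unfolding E_def by (rule ground_state_energy_le[OF e(1) u v _ finite_block]) simp
  also have "\<dots> \<le> energy F ?Q + emeasure mu {p \<in> cutset ?G. fst p \<in> ?Q \<and> snd p \<in> ?Q \<and> l1norm (fst p - snd p) < r}
    + ennreal Lam * emeasure (hmeas s) (cutset ?Q \<inter> shortlong r)
    + ennreal (Lam * r powr (- (real CARD('n) + s))) * (2 * emeasure lebesgue C * emeasure lebesgue ((?G - F \<union> (F - ?G)) \<inter> C))"
    unfolding C_def using R by (intro energy_perturbation G F Q cQ r) simp
  also have "\<dots> \<le> energy F (cubeQ R' 0)
     + ennreal pair_const * emeasure mu (cutset F \<inter> touch (cubeQ (R + 2) 0) \<inter> {p. l1norm (fst p - snd p) < (1 + 2 * real CARD('n)) * r})
     + ennreal Lam * (ennreal ((2 * R + 3) powr (real CARD('n) - s)) * emeasure (hmeas s) (cutset (unit_cell :: (real ^ 'n) set) \<inter> shortlong ((2 * R + 3) * r)))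
     + ennreal (Lam * r powr (- (real CARD('n) + s))) * (2 * emeasure lebesgue C *
         (ennreal (poincare_const * e powr s) * energy F (cubeQ (R + 2) 0) + emeasure lebesgue ((E - E0 \<union> (E0 - E)) \<inter> C)))"
  proof (intro add_mono mult_left_mono)
    show "energy F ?Q \<le> energy F (cubeQ R' 0)" by (rule energy_mono[OF F QR' cQ(2)])
    have "emeasure mu {p \<in> cutset ?G. fst p \<in> ?Q \<and> snd p \<in> ?Q \<and> l1norm (fst p - snd p) < r}
        \<le> ennreal pair_const * emeasure mu (cutset F \<inter> touch (cubeQ (R + 2) 0) \<inter> {p. l1norm (fst p - snd p) < r + 2 * real CARD('n) * e})"
      using majority_short_energy[OF e(1) F finite_block QR2 cQ(3) Gmaj, of r] by simp
    also have "\<dots> \<le> ennreal pair_const * emeasure mu (cutset F \<inter> touch (cubeQ (R + 2) 0) \<inter> {p. l1norm (fst p - snd p) < (1 + 2 * real CARD('n)) * r})"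
    proof (intro mult_left_mono emeasure_mono)
      have "r + 2 * real CARD('n) * e \<le> (1 + 2 * real CARD('n)) * r"
        using mult_left_mono[OF r(2), of "2 * real CARD('n)"] by (simp add: distrib_right)
      then show "cutset F \<inter> touch (cubeQ (R + 2) 0) \<inter> {p. l1norm (fst p - snd p) < r + 2 * real CARD('n) * e}
        \<subseteq> cutset F \<inter> touch (cubeQ (R + 2) 0) \<inter> {p. l1norm (fst p - snd p) < (1 + 2 * real CARD('n)) * r}" by auto
      show "cutset F \<inter> touch (cubeQ (R + 2) 0) \<inter> {p. l1norm (fst p - snd p) < (1 + 2 * real CARD('n)) * r} \<in> sets mu"
        unfolding sets_mu by (intro sets.Int cutset_sets_lebesgue F touch_sets_lebesgue QR2 l1norm_sublevel_lebesgue)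
    qed simp
    finally show "emeasure mu {p \<in> cutset ?G. fst p \<in> ?Q \<and> snd p \<in> ?Q \<and> l1norm (fst p - snd p) < r}
        \<le> ennreal pair_const * emeasure mu (cutset F \<inter> touch (cubeQ (R + 2) 0) \<inter> {p. l1norm (fst p - snd p) < (1 + 2 * real CARD('n)) * r})" .
    show "emeasure (hmeas s) (cutset ?Q \<inter> shortlong r)
        \<le> ennreal ((2 * R + 3) powr (real CARD('n) - s)) * emeasure (hmeas s) (cutset (unit_cell :: (real ^ 'n) set) \<inter> shortlong ((2 * R + 3) * r))"
      using b(3,4) R e by (intro hmeas_cut_block_le(1)[OF s_pos s_less_1 e(1) r(1)]) auto
    have "(?G - F \<union> (F - ?G)) \<inter> C \<subseteq> ((?G - F \<union> (F - ?G)) \<inter> ?Q) \<union> ((E - E0 \<union> (E0 - E)) \<inter> C)"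
    proof
      fix x assume x: "x \<in> (?G - F \<union> (F - ?G)) \<inter> C"
      show "x \<in> ((?G - F \<union> (F - ?G)) \<inter> ?Q) \<union> ((E - E0 \<union> (E0 - E)) \<inter> C)"
      proof (cases "x \<in> ?Q")
        case False
        then have "x \<notin> cubeQ R 0" using cQ(1) by auto
        then have "x \<in> F \<longleftrightarrow> x \<in> E0" using E0(2) by blast
        moreover have "x \<in> ?G \<longleftrightarrow> x \<in> E" using False by (simp add: E_def)
        ultimately show ?thesis using x by blast
      qed (use x in blast)
    qed
    then have "emeasure lebesgue ((?G - F \<union> (F - ?G)) \<inter> C) \<le> emeasure lebesgue (((?G - F \<union> (F - ?G)) \<inter> ?Q) \<union> ((E - E0 \<union> (E0 - E)) \<inter> C))"
      using G F Q E E0(1) C by (intro emeasure_mono) (auto simp only: intro!: sets.Un sets.Int sets.Diff)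
    also have "\<dots> \<le> emeasure lebesgue ((?G - F \<union> (F - ?G)) \<inter> ?Q) + emeasure lebesgue ((E - E0 \<union> (E0 - E)) \<inter> C)"
      using G F Q E E0(1) C by (intro emeasure_subadditive) (auto simp only: intro!: sets.Un sets.Int sets.Diff)
    also have "\<dots> \<le> ennreal (poincare_const * e powr s) * energy F (cubeQ (R + 2) 0) + emeasure lebesgue ((E - E0 \<union> (E0 - E)) \<inter> C)"
      by (intro add_right_mono majority_sym_diff[OF e(1) F finite_block QR2 cQ(3) Gmaj G])
    finally show "emeasure lebesgue ((?G - F \<union> (F - ?G)) \<inter> C) \<le> \<dots>" .
  qed simp_all
  finally show ?thesis .
qed

text \<open>Continuity from above: \<open>cutset F\<close> contains no pair of equal points, so
  every pair eventually drops out.\<close>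

lemma short_energy_tendsto:
  assumes F: "F \<in> sets lebesgue" and O: "\<Omega> \<in> sets lebesgue" and fin: "energy F \<Omega> < \<infinity>"
  shows "(\<lambda>j. emeasure mu (cutset F \<inter> touch \<Omega> \<inter> {p. l1norm (fst p - snd p) < c * (1 / real (Suc j))})) \<longlonglongrightarrow> 0"
proof -
  let ?A = "\<lambda>j. cutset F \<inter> touch \<Omega> \<inter> {p. l1norm (fst p - snd p) < c * (1 / real (Suc j))}"
  have A: "?A j \<in> sets lebesgue" for j by (intro sets.Int cut_touch_sets F O l1norm_sublevel_lebesgue)
  have empty: "(\<Inter>j. ?A j) = {}"
  proof (rule ccontr)
    assume "(\<Inter>j. ?A j) \<noteq> {}"
    then obtain p where p: "\<And>j. p \<in> ?A j" by blast
    have "fst p \<noteq> snd p" using p[of 0] by (auto simp: cutset_def)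
    then have l: "l1norm (fst p - snd p) > 0" by (simp add: less_le)
    have "(\<lambda>j. c * (1 / real (Suc j))) \<longlonglongrightarrow> c * 0"
      by (intro tendsto_intros LIMSEQ_Suc[OF lim_1_over_n])
    then have "l1norm (fst p - snd p) \<le> c * 0"
      by (rule LIMSEQ_le_const) (use p in \<open>auto intro!: exI[of _ 0] less_imp_le\<close>)
    with l show False by simp
  qed
  \<comment> \<open>No sign of \<open>c\<close> is assumed; if it is not positive the sets are
    empty, so monotonicity has to be checked only where some pair occurs.\<close>
  have c: "0 < c" if "p \<in> ?A j" for p j
  proof -
    have "0 < c * (1 / real (Suc j))" using that l1norm_nonneg[of "fst p - snd p"] by (auto simp del: l1norm_nonneg)
    then show ?thesis by (simp add: zero_less_mult_iff zero_less_divide_iff)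
  qed
  have "(\<lambda>j. emeasure mu (?A j)) \<longlonglongrightarrow> emeasure mu (\<Inter>j. ?A j)"
  proof (rule Lim_emeasure_decseq)
    show "range ?A \<subseteq> sets mu" using A by auto
    show "decseq ?A"
    proof (rule decseq_SucI)
      fix j
      show "?A (Suc j) \<subseteq> ?A j"
      proof
        fix p assume p: "p \<in> ?A (Suc j)"
        have "c * (1 / real (Suc (Suc j))) \<le> c * (1 / real (Suc j))"
          using c[OF p] by (intro mult_left_mono divide_left_mono) auto
        with p show "p \<in> ?A j" by auto
      qed
    qed
    show "emeasure mu (?A j) \<noteq> \<infinity>" for j
    proof -
      have "emeasure mu (?A j) \<le> energy F \<Omega>"
        unfolding energy_def using cut_touch_sets[OF F O] by (intro emeasure_mono) auto
      then show ?thesis using fin by (auto simp: top_unique)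
    qed
  qed
  then show ?thesis unfolding empty emeasure_empty .
qed

text \<open>This lets the overshoot of the lattice blocks vanish: the closed cube is the
  intersection of the larger ones, and finite energy permits continuity from above.\<close>

lemma energy_cube_tendsto:
  assumes F: "F \<in> sets lebesgue" and R: "R \<ge> 0" and fin: "energy F (cubeQ (R + 1) 0) < \<infinity>"
  shows "(\<lambda>j. energy F (cubeQ (R + 1 / real (Suc j)) 0)) \<longlonglongrightarrow> energy F (cubeQ R 0)"
proof -
  let ?q = "\<lambda>j. cubeQ (R + 1 / real (Suc j)) (0 :: real ^ 'n)"
  let ?A = "\<lambda>j. cutset F \<inter> touch (?q j)"
  have q: "?q j \<in> sets lebesgue" for j using R by (intro cubeQ_lebesgue) simp
  have dec: "1 / real (Suc j) \<le> 1 / real (Suc i)" if "i \<le> j" for i j using that by (intro divide_left_mono) auto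
  have eq: "(\<Inter>j. ?A j) = cutset F \<inter> touch (cubeQ R 0)"
  proof (intro set_eqI iffI)
    fix p assume p: "p \<in> (\<Inter>j. ?A j)"
    have lim: "x \<in> cubeQ R 0" if x: "\<And>j. \<exists>i\<ge>j. x \<in> ?q i" for x :: "real ^ 'n"
    proof -
      have "\<bar>x $ k\<bar> \<le> R" for k
      proof -
        have "\<bar>x $ k\<bar> \<le> R + 1 / real (Suc j)" for j
        proof -
          obtain i where "i \<ge> j" "x \<in> ?q i" using x by blast
          then have "\<bar>x $ k\<bar> \<le> R + 1 / real (Suc i)" by (simp add: cubeQ_def)
          with dec[OF \<open>i \<ge> j\<close>] show ?thesis by linarith
        qed
        moreover have "(\<lambda>j. R + 1 / real (Suc j)) \<longlonglongrightarrow> R + 0"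
          by (intro tendsto_intros LIMSEQ_Suc[OF lim_1_over_n])
        ultimately show ?thesis using LIMSEQ_le_const by fastforce
      qed
      then show ?thesis by (simp add: cubeQ_def)
    qed
    have "fst p \<in> cubeQ R 0 \<or> snd p \<in> cubeQ R 0"
    \<comment> \<open>Pigeonhole: a pair touching all the cubes has one coordinate that lies in
      infinitely many of them, hence in the closed cube.\<close>
    proof (cases "\<forall>j. \<exists>i\<ge>j. fst p \<in> ?q i")
      case False
      then obtain j where j: "\<And>i. i \<ge> j \<Longrightarrow> fst p \<notin> ?q i" by blast
      have "snd p \<in> cubeQ R 0"
      proof (rule lim)
        fix j' show "\<exists>i\<ge>j'. snd p \<in> ?q i"
          using p j[of "max j j'"] by (intro exI[of _ "max j j'"]) (auto simp: touch_def)
      qed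
      then show ?thesis ..
    qed (use lim in blast)
    with p show "p \<in> cutset F \<inter> touch (cubeQ R 0)" by (auto simp: touch_def)
  next
    fix p assume "p \<in> cutset F \<inter> touch (cubeQ R 0)"
    moreover have "cubeQ R 0 \<subseteq> ?q j" for j by (rule cubeQ_mono) simp
    ultimately show "p \<in> (\<Inter>j. ?A j)" by (auto simp: touch_def)
  qed
  have "(\<lambda>j. emeasure mu (?A j)) \<longlonglongrightarrow> emeasure mu (\<Inter>j. ?A j)"
  proof (rule Lim_emeasure_decseq)
    show "range ?A \<subseteq> sets mu" using cut_touch_sets[OF F q] by auto
    show "decseq ?A"
    proof (rule decseq_SucI)
      fix j
      have "?q (Suc j) \<subseteq> ?q j" using dec[of j "Suc j"] by (intro cubeQ_mono) simp
      then show "?A (Suc j) \<subseteq> ?A j" by (auto simp: touch_def)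
    qed
    show "emeasure mu (?A j) \<noteq> \<infinity>" for j
    proof -
      have "energy F (?q j) \<le> energy F (cubeQ (R + 1) 0)"
        using R dec[of 0 j] by (intro energy_mono F cubeQ_lebesgue cubeQ_mono) auto
      then show ?thesis using fin by (auto simp: energy_def top_unique)
    qed
  qed
  then show ?thesis unfolding eq energy_def .
qed

end

text \<open>Since C has finite measure, its indicator dominates and almost everywhere convergence
  becomes convergence in measure on C.\<close>

lemma sym_diff_measure_tendsto:
  fixes E :: "nat \<Rightarrow> 'a::euclidean_space set"
  assumes E: "\<And>n. E n \<in> sets lebesgue" and E0: "E0 \<in> sets lebesgue" and C: "C \<in> sets lebesgue" "emeasure lebesgue C < \<infinity>"
    and conv: "AE x in lebesgue. \<forall>\<^sub>F n in sequentially. x \<in> E n \<longleftrightarrow> x \<in> E0"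
  shows "(\<lambda>n. emeasure lebesgue ((E n - E0 \<union> (E0 - E n)) \<inter> C)) \<longlonglongrightarrow> 0"
proof -
  let ?D = "\<lambda>n. (E n - E0 \<union> (E0 - E n)) \<inter> C"
  have D: "?D n \<in> sets lebesgue" for n using E[of n] E0 C by auto
  have "(\<lambda>n. \<integral>\<^sup>+ x. indicator (?D n) x \<partial>lebesgue) \<longlonglongrightarrow> (\<integral>\<^sup>+ x. 0 \<partial>(lebesgue :: 'a measure))"
  proof (rule nn_integral_dominated_convergence[where w = "indicator C"])
    show "(indicator (?D n) :: 'a \<Rightarrow> ennreal) \<in> borel_measurable lebesgue" for n using D by (rule borel_measurable_indicator)
    show "(indicator C :: 'a \<Rightarrow> ennreal) \<in> borel_measurable lebesgue" using C(1) by (rule borel_measurable_indicator)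
    show "(\<integral>\<^sup>+ x. indicator C x \<partial>lebesgue) < \<infinity>" using C by simp
    show "AE x in lebesgue. indicator (?D n) x \<le> (indicator C x :: ennreal)" for n by (auto simp: indicator_def)
    show "AE x in lebesgue. (\<lambda>n. indicator (?D n) x :: ennreal) \<longlonglongrightarrow> 0"
      using conv
    proof eventually_elim
      case (elim x)
      then have "\<forall>\<^sub>F n in sequentially. (indicator (?D n) x :: ennreal) = 0"
        by eventually_elim (auto simp: indicator_def)
      then show ?case by (rule tendsto_eventually)
    qed
  qed simp
  then show ?thesis using D by simp
qed

section \<open>Minimality of the limit set\<close>

context nonlocal_kernel
begin

context
  fixes eps :: "nat \<Rightarrow> real" and u :: "nat \<Rightarrow> int ^ 'n \<Rightarrow> int" and E0 :: "(real ^ 'n) set"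
  assumes eps: "\<And>n. 0 < eps n \<and> eps n < 1" and eps_lim: "eps \<longlonglongrightarrow> 0"
    and ground: "\<And>n. ground_state K s (eps n) (u n)"
    and E0: "E0 \<in> sets lebesgue"
    and conv: "AE x in lebesgue. \<forall>\<^sub>F n in sequentially. x \<in> {x. u n (cell (eps n) x) = 1} \<longleftrightarrow> x \<in> E0"
begin

abbreviation "phase n \<equiv> {x. u n (cell (eps n) x) = 1}"

lemma phase_lebesgue: "phase n \<in> sets lebesgue"
  using cell_lebesgue[of "eps n" "{i. u n i = 1}"] eps[of n] by simp

lemma limit_energy_finite:
  assumes T: "T \<ge> 1"
  shows "energy E0 (cubeQ T 0) < \<infinity>"
proof -
  let ?b = "ennreal Lam * (ennreal ((2 * T + 3) powr (real CARD('n) - s)) * H0)"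
  have "energy E0 (cubeQ T 0) \<le> liminf (\<lambda>n. energy (phase n) (cubeQ T 0))"
    using T by (intro energy_fatou phase_lebesgue E0 cubeQ_lebesgue conv) simp
  also have "\<dots> \<le> limsup (\<lambda>n. energy (phase n) (cubeQ T 0))" by (rule Liminf_le_Limsup) simp
  also have "\<dots> \<le> ?b"
    using eps by (intro Limsup_bounded always_eventually allI ground_state_energy_cube ground T) auto
  also have "?b < \<infinity>" using H0_finite by (simp add: ennreal_mult_less_top)
  finally show ?thesis .
qed

text \<open>The parameters are fixed in the order R', \<eta>, r, n. The range r makes the short and
  the crossing terms small; afterwards n makes the volume term small, whose constant blows up as r
  decreases. Finally \<eta> and then R' - R tend to 0.\<close>

lemma limit_energy_le:
  assumes R: "R \<ge> 1" and F: "F \<in> sets lebesgue" "F - cubeQ R 0 = E0 - cubeQ R 0"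
  shows "energy E0 (cubeQ R 0) \<le> energy F (cubeQ R 0)"
proof (cases "energy F (cubeQ R 0) = \<infinity>")
  case False
  have QR: "cubeQ T (0 :: real ^ 'n) \<in> sets lebesgue" if "T \<ge> 0" for T using that by (rule cubeQ_lebesgue)
  \<comment> \<open>A pair with no point in the cube of radius R sees no difference between F and
    \<open>E0\<close>, and \<open>E0\<close> has finite energy on the larger cube.\<close>
  have fin2: "energy F (cubeQ (R + 2) 0) < \<infinity>"
  proof -
    have "cutset F \<inter> touch (cubeQ (R + 2) 0) \<subseteq> (cutset F \<inter> touch (cubeQ R 0)) \<union> (cutset E0 \<inter> touch (cubeQ (R + 2) 0))"
    proof
      fix p assume p: "p \<in> cutset F \<inter> touch (cubeQ (R + 2) 0)"
      show "p \<in> (cutset F \<inter> touch (cubeQ R 0)) \<union> (cutset E0 \<inter> touch (cubeQ (R + 2) 0))"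
      proof (cases "p \<in> touch (cubeQ R 0)")
        case False
        then have "fst p \<in> F \<longleftrightarrow> fst p \<in> E0" "snd p \<in> F \<longleftrightarrow> snd p \<in> E0"
          using F(2) unfolding touch_def by blast+
        then show ?thesis using p by (auto simp: cutset_def)
      qed (use p in blast)
    qed
    then have "energy F (cubeQ (R + 2) 0) \<le> emeasure mu ((cutset F \<inter> touch (cubeQ R 0)) \<union> (cutset E0 \<inter> touch (cubeQ (R + 2) 0)))"
      unfolding energy_def using cut_touch_sets[OF F(1) QR] cut_touch_sets[OF E0 QR] R by (intro emeasure_mono) auto
    also have "\<dots> \<le> energy F (cubeQ R 0) + energy E0 (cubeQ (R + 2) 0)"
      unfolding energy_def using cut_touch_sets[OF F(1) QR] cut_touch_sets[OF E0 QR] R by (intro emeasure_subadditive) auto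
    also have "\<dots> < \<infinity>" using False limit_energy_finite[of "R + 2"] R by (simp add: top.not_eq_extremum)
    finally show ?thesis .
  qed
  have step: "energy E0 (cubeQ R 0) \<le> energy F (cubeQ R' 0)" if R': "R' > R" for R'
  proof (rule ennreal_le_epsilon)
    fix \<eta> :: real assume \<eta>: "0 < \<eta>"
    \<comment> \<open>One third for each of the error terms \<open>?a\<close>, \<open>?b\<close> and
      \<open>?c\<close>.\<close>
    define \<eta>3 where "\<eta>3 = ennreal (\<eta> / 3)"
    have \<eta>3: "0 < \<eta>3" using \<eta> by (simp add: \<eta>3_def)
    let ?a = "\<lambda>r. ennreal pair_const * emeasure mu (cutset F \<inter> touch (cubeQ (R + 2) 0) \<inter> {p. l1norm (fst p - snd p) < (1 + 2 * real CARD('n)) * r})"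
    let ?b = "\<lambda>r. ennreal Lam * (ennreal ((2 * R + 3) powr (real CARD('n) - s)) * emeasure (hmeas s) (cutset (unit_cell :: (real ^ 'n) set) \<inter> shortlong ((2 * R + 3) * r)))"
    have "(\<lambda>j. ?a (1 / real (Suc j))) \<longlonglongrightarrow> ennreal pair_const * 0"
      using R by (intro ennreal_tendsto_cmult short_energy_tendsto F QR fin2) auto
    then have "\<forall>\<^sub>F j in sequentially. ?a (1 / real (Suc j)) < \<eta>3"
      by (rule order_tendstoD(2)) (use \<eta>3 in simp)
    moreover have "(\<lambda>j. ?b (1 / real (Suc j))) \<longlonglongrightarrow> ennreal Lam * (ennreal ((2 * R + 3) powr (real CARD('n) - s)) * 0)"
      using R hmeas_shortlong_tendsto[OF s_pos s_less_1, of "2 * R + 3", where 'n='n]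
      by (intro ennreal_tendsto_cmult) auto
    then have "\<forall>\<^sub>F j in sequentially. ?b (1 / real (Suc j)) < \<eta>3"
      by (rule order_tendstoD(2)) (use \<eta>3 in simp)
    ultimately have "\<forall>\<^sub>F j in sequentially. ?a (1 / real (Suc j)) < \<eta>3 \<and> ?b (1 / real (Suc j)) < \<eta>3"
      by eventually_elim simp
    then obtain j where j: "?a (1 / real (Suc j)) < \<eta>3" "?b (1 / real (Suc j)) < \<eta>3"
      by (auto simp only: eventually_sequentially)
    define r where "r = 1 / real (Suc j)"
    have r: "r > 0" by (simp add: r_def)
    let ?C = "cubeQ (R + 2 + 1 / r) (0 :: real ^ 'n)"
    have "R + 2 + 1 / r \<ge> 0" using R r by simp
    then have C: "?C \<in> sets lebesgue" "emeasure lebesgue ?C < \<infinity>"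
      by (simp_all only: cubeQ_lebesgue emeasure_cubeQ_lebesgue ennreal_less_top infinity_ennreal_def)
    let ?t = "\<lambda>n. ennreal (poincare_const * eps n powr s) * energy F (cubeQ (R + 2) 0) + emeasure lebesgue ((phase n - E0 \<union> (E0 - phase n)) \<inter> ?C)"
    let ?c = "\<lambda>n. ennreal (Lam * r powr (- (real CARD('n) + s))) * (2 * emeasure lebesgue ?C * ?t n)"
    have "(\<lambda>n. poincare_const * eps n powr s) \<longlonglongrightarrow> poincare_const * 0"
    proof (intro tendsto_mult tendsto_const)
      show "(\<lambda>n. eps n powr s) \<longlonglongrightarrow> 0"
        using tendsto_powr'[OF eps_lim tendsto_const, of s] eps s_pos by (simp add: less_imp_le)
    qed
    then have "(\<lambda>n. ennreal (poincare_const * eps n powr s)) \<longlonglongrightarrow> ennreal (poincare_const * 0)" by (rule tendsto_ennrealI)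
    then have "(\<lambda>n. energy F (cubeQ (R + 2) 0) * ennreal (poincare_const * eps n powr s)) \<longlonglongrightarrow> energy F (cubeQ (R + 2) 0) * ennreal (poincare_const * 0)"
      using fin2 by (intro ennreal_tendsto_cmult) auto
    then have "(\<lambda>n. ennreal (poincare_const * eps n powr s) * energy F (cubeQ (R + 2) 0)) \<longlonglongrightarrow> 0"
      by (simp add: mult.commute)
    moreover have "(\<lambda>n. emeasure lebesgue ((phase n - E0 \<union> (E0 - phase n)) \<inter> ?C)) \<longlonglongrightarrow> 0"
      by (rule sym_diff_measure_tendsto[OF phase_lebesgue E0 C conv])
    ultimately have "(\<lambda>n. ?t n) \<longlonglongrightarrow> 0 + 0" by (rule tendsto_add)
    then have "(\<lambda>n. ?c n) \<longlonglongrightarrow> ennreal (Lam * r powr (- (real CARD('n) + s))) * (2 * emeasure lebesgue ?C * (0 + 0))"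
      using C(2) by (intro ennreal_tendsto_cmult) (auto simp: ennreal_mult_less_top)
    then have c: "\<forall>\<^sub>F n in sequentially. ?c n < \<eta>3"
      by (rule order_tendstoD(2)) (use \<eta>3 in simp)
    \<comment> \<open>Both side conditions of \<open>majority_config_energy\<close>: cells no larger
      than r, and a block that fits into the cube of radius R'.\<close>
    have "\<forall>\<^sub>F n in sequentially. eps n < min r ((R' - R) / 2)"
      using R' r by (intro order_tendstoD(2)[OF eps_lim]) auto
    with c have "\<forall>\<^sub>F n in sequentially. energy (phase n) (cubeQ R 0) \<le> energy F (cubeQ R' 0) + ennreal \<eta>"
    proof eventually_elim
      case (elim n)
      have "energy (phase n) (cubeQ R 0) \<le> energy F (cubeQ R' 0) + ?a r + ?b r + ?c n"
        using eps[of n] elim(2) by (intro majority_config_energy ground R F E0 r) auto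
      also have "\<dots> \<le> energy F (cubeQ R' 0) + \<eta>3 + \<eta>3 + \<eta>3"
        using j elim(1) unfolding r_def[symmetric] by (intro add_mono order_refl less_imp_le)
      also have "\<dots> = energy F (cubeQ R' 0) + ennreal \<eta>"
      proof -
        have "\<eta>3 + \<eta>3 + \<eta>3 = ennreal \<eta>"
          using \<eta> by (simp add: \<eta>3_def ennreal_plus[symmetric] del: ennreal_plus)
        then show ?thesis by (simp add: add.assoc)
      qed
      finally show ?case .
    qed
    then have "limsup (\<lambda>n. energy (phase n) (cubeQ R 0)) \<le> energy F (cubeQ R' 0) + ennreal \<eta>" by (rule Limsup_bounded)
    moreover have "energy E0 (cubeQ R 0) \<le> liminf (\<lambda>n. energy (phase n) (cubeQ R 0))"
      using R by (intro energy_fatou phase_lebesgue E0 QR conv) simp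
    moreover have "liminf (\<lambda>n. energy (phase n) (cubeQ R 0)) \<le> limsup (\<lambda>n. energy (phase n) (cubeQ R 0))"
      by (rule Liminf_le_Limsup) simp
    ultimately show "energy E0 (cubeQ R 0) \<le> energy F (cubeQ R' 0) + ennreal \<eta>" by (meson order_trans)
  qed
  have "energy F (cubeQ (R + 1) 0) \<le> energy F (cubeQ (R + 2) 0)"
    using R by (intro energy_mono F QR cubeQ_mono) auto
  then have "energy F (cubeQ (R + 1) 0) < \<infinity>" using fin2 by (rule order_le_less_trans)
  then have "(\<lambda>j. energy F (cubeQ (R + 1 / real (Suc j)) 0)) \<longlonglongrightarrow> energy F (cubeQ R 0)"
    using R by (intro energy_cube_tendsto F) auto
  then show ?thesis by (rule LIMSEQ_le_const) (auto intro!: step)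
qed simp

text \<open>Minimality in a large cube passes to every \<Omega> inside it: the pairs touching the
  cube but not \<Omega> carry the same finite energy for \<open>E0\<close> and for a competitor
  equal to it off \<Omega>, and cancel.\<close>

lemma limit_classA: "classA_minimal K E0"
  unfolding classA_minimal_def
proof (intro conjI allI impI E0)
  fix \<Omega> :: "(real ^ 'n) set" assume "open \<Omega> \<and> bounded \<Omega>"
  then have O: "\<Omega> \<in> sets lebesgue" and "bounded \<Omega>" by auto
  then obtain B where B: "\<And>x. x \<in> \<Omega> \<Longrightarrow> norm x \<le> B" by (auto simp: bounded_iff)
  define R where "R = max 1 B"
  have R: "R \<ge> 1" by (simp add: R_def)
  let ?Q = "cubeQ R (0 :: real ^ 'n)"
  have OQ: "\<Omega> \<subseteq> ?Q"
  proof
    fix x assume "x \<in> \<Omega>"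
    then have "\<bar>x $ k\<bar> \<le> R" for k using B[of x] component_le_norm_cart[of x k] by (simp add: R_def)
    then show "x \<in> ?Q" by (simp add: cubeQ_def)
  qed
  have Q: "?Q \<in> sets lebesgue" using R by (intro cubeQ_lebesgue) simp
  have fin: "energy E0 ?Q < \<infinity>" by (rule limit_energy_finite[OF R])
  have split: "energy G ?Q = emeasure mu (cutset G \<inter> touch ?Q - touch \<Omega>) + energy G \<Omega>" if "G \<in> sets lebesgue" for G
  proof -
    have "cutset G \<inter> touch ?Q = (cutset G \<inter> touch ?Q - touch \<Omega>) \<union> (cutset G \<inter> touch \<Omega>)"
      using OQ by (auto simp: touch_def)
    then have "energy G ?Q = emeasure mu ((cutset G \<inter> touch ?Q - touch \<Omega>) \<union> (cutset G \<inter> touch \<Omega>))"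
      unfolding energy_def by simp
    also have "\<dots> = emeasure mu (cutset G \<inter> touch ?Q - touch \<Omega>) + emeasure mu (cutset G \<inter> touch \<Omega>)"
      using cut_touch_sets[OF that Q] cut_touch_sets[OF that O] touch_sets_lebesgue[OF O]
      by (intro plus_emeasure[symmetric]) auto
    finally show ?thesis by (simp add: energy_def)
  qed
  show "PerK_minimizer K E0 \<Omega>"
    unfolding PerK_minimizer_def
  proof (intro conjI ballI impI)
    have "energy E0 \<Omega> < \<infinity>" using energy_mono[OF E0 Q OQ] fin by (rule order_le_less_trans)
    then show "PerK K E0 \<Omega> < \<infinity>" by (auto simp: energy_eq_PerK[OF E0 O] ennreal_mult_less_top)
    fix F assume F: "F \<in> sets lebesgue" "F - \<Omega> = E0 - \<Omega>"
    have "F - ?Q = E0 - ?Q" using F(2) OQ by blast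
    then have "energy E0 ?Q \<le> energy F ?Q" by (rule limit_energy_le[OF R F(1)])
    moreover have "cutset F \<inter> touch ?Q - touch \<Omega> = cutset E0 \<inter> touch ?Q - touch \<Omega>"
      using F(2) unfolding cutset_def touch_def by blast
    \<comment> \<open>Finiteness is what permits the cancellation in \<open>ennreal\<close>.\<close>
    moreover have "emeasure mu (cutset E0 \<inter> touch ?Q - touch \<Omega>) \<noteq> \<infinity>"
      using fin split[OF E0] by auto
    ultimately have "energy E0 \<Omega> \<le> energy F \<Omega>"
      using split[OF E0] split[OF F(1)] by (simp add: ennreal_add_left_cancel_le)
    then show "PerK K E0 \<Omega> \<le> PerK K F \<Omega>"
      by (simp add: energy_eq_PerK[OF E0 O] energy_eq_PerK[OF F(1) O] ennreal_mult_le_mult_iff)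
  qed
qed

end

end

theorem theorem1p2:
  fixes K :: "real ^ 'n \<Rightarrow> real ^ 'n \<Rightarrow> ennreal"
    and s lam Lam :: real
    and eps :: "nat \<Rightarrow> real"
    and u :: "nat \<Rightarrow> int ^ 'n \<Rightarrow> int"
  assumes "CARD('n) \<ge> 2"
    and "kernel_K1K2 K s lam Lam"
    and "\<And>n. 0 < eps n \<and> eps n < 1"
    and "eps \<longlonglongrightarrow> 0"
    and "\<And>n. ground_state K s (eps n) (u n)"
  shows "\<exists>nk :: nat \<Rightarrow> nat. \<exists>E. filterlim nk at_top sequentially \<and> classA_minimal K E \<and>
    (AE x in lebesgue.
       (\<lambda>k. real_of_int (ext_config (eps (nk k)) (u (nk k)) x))
         \<longlonglongrightarrow> (if x \<in> E then 1 else -1))"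
proof -
  interpret nonlocal_kernel K s lam Lam by unfold_locales (rule assms(2))
  let ?E = "\<lambda>n. {x. u n (cell (eps n) x) = 1}"
  have Eborel: "?E n \<in> sets borel" for n
    using cell_borel[of "eps n" "{i. u n i = 1}"] assms(3)[of n] by simp
  then have E: "?E n \<in> sets lebesgue" for n by auto
  have "\<exists>b\<ge>0. \<forall>n. energy (?E n) (cubeQ R 0) \<le> ennreal b" if R: "R \<ge> 1" for R
  proof -
    let ?b = "ennreal Lam * (ennreal ((2 * R + 3) powr (real CARD('n) - s)) * H0)"
    have "?b < top" using H0_finite by (simp add: ennreal_mult_less_top)
    then have "?b = ennreal (enn2real ?b)" by simp
    then show ?thesis
      using ground_state_energy_cube[OF _ _ assms(5) R] assms(3) by (metis enn2real_nonneg)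
  qed
  then obtain r where r: "strict_mono r"
    and AE_r: "AE x in lebesgue. (\<forall>\<^sub>F n in sequentially. x \<in> ?E (r n)) \<or> (\<forall>\<^sub>F n in sequentially. x \<notin> ?E (r n))"
    using energy_compactness[of ?E] E by blast
  \<comment> \<open>The lower limit of the phases is Borel by construction and agrees almost
    everywhere with the limit provided by compactness.\<close>
  define E0 where "E0 = {x. \<forall>\<^sub>F n in sequentially. x \<in> ?E (r n)}"
  have "E0 = (\<Union>N. \<Inter>n\<in>{N..}. ?E (r n))" by (auto simp: E0_def eventually_sequentially)
  also have "\<dots> \<in> sets borel"
    by (intro sets.countable_UN'' sets.countable_INT'' Eborel) auto
  finally have E0: "E0 \<in> sets lebesgue" by auto
  have conv: "AE x in lebesgue. \<forall>\<^sub>F n in sequentially. x \<in> ?E (r n) \<longleftrightarrow> x \<in> E0"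
    using AE_r
  proof eventually_elim
    case (elim x)
    show ?case
    proof (cases "x \<in> E0")
      case True
      then show ?thesis by (simp add: E0_def)
    next
      case False
      then have "\<forall>\<^sub>F n in sequentially. x \<notin> ?E (r n)" using elim by (auto simp: E0_def)
      then show ?thesis by eventually_elim (use False in simp)
    qed
  qed
  have "(\<lambda>n. eps (r n)) \<longlonglongrightarrow> 0"
    using LIMSEQ_subseq_LIMSEQ[OF assms(4) r] by (simp add: comp_def)
  then have "classA_minimal K E0"
    using assms(3,5) E0 conv by (intro limit_classA[of "\<lambda>n. eps (r n)" "\<lambda>n. u (r n)"]) auto
  moreover have "AE x in lebesgue. (\<lambda>k. real_of_int (ext_config (eps (r k)) (u (r k)) x)) \<longlonglongrightarrow> (if x \<in> E0 then 1 else -1)"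
  proof -
    \<comment> \<open>One null set serves all n, because there are only countably many
      configurations in the sequence.\<close>
    have "AE x in lebesgue. \<forall>n. ext_config (eps n) (u n) x = u n (cell (eps n) x)"
      unfolding AE_all_countable using ext_config_eq_AE assms(3) by blast
    with conv show ?thesis
    proof eventually_elim
      case (elim x)
      have pm: "u n i = 1 \<or> u n i = -1" for n i using assms(5)[of n] by (auto simp: ground_state_def config_def)
      from elim(1) have "\<forall>\<^sub>F k in sequentially. real_of_int (ext_config (eps (r k)) (u (r k)) x) = (if x \<in> E0 then 1 else -1)"
      proof eventually_elim
        case (elim k)
        then show ?case
          using \<open>\<forall>n. ext_config (eps n) (u n) x = u n (cell (eps n) x)\<close> pm[of "r k" "cell (eps (r k)) x"] by auto
      qed
      then show ?case by (rule tendsto_eventually)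
    qed
  qed
  ultimately show ?thesis using filterlim_subseq[OF r] by blast
qed

end
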